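(* Let $n\ge1$ and $k,m\ge0$ be integers with $k+m\le n$. Every amplituhedron $\mathcal{A}_{n,k,m}(Z)$ with either $k+m\le2$ or $n-k-m\le2$ is a twisted Vandermonde amplituhedron. In particular, it is homeomorphic to a closed ball, its interior (in $\mathrm{Gr}_{k,k+m}(\mathbb{R})$) is homeomorphic to an open ball, and its boundary is homeomorphic to a sphere.
   Context: Flags: $\mathrm{Fl}_n(\mathbb{C})$ is the variety of complete flags $(V_1\subset\dots\subset V_{n-1})$ in $\mathbb{C}^n$, $\dim V_j=j$ (put $V_0=0$, $V_n=\mathbb{C}^n$); an invertible matrix represents the flag whose $j$-th subspace is the span of its first $j$ columns. $\mathrm{Fl}_n^{>0}$ is the set of flags represented by real matrices all of whose minors are positive, and $\mathrm{Fl}_n^{\ge0}$ is its closure. $\mathrm{Gr}_{k,n}^{\ge 0}$ is the set of subspaces of $\mathbb{C}^n$ spanned by the columns of a real $n\times k$ matrix of rank $k$ whose $k\times k$ minors are all nonnegative. Twist map: each $V\in\mathrm{Fl}_n^{\ge 0}$ is represented by a unique real orthogonal matrix $g$ all of whose left-justified minors (row set $I$, column set $\{1,\dots,|I|\}$) are nonnegative; $\vartheta(V)$ is the flag represented by $\delta_ng^{-1}\delta_n$, with $\delta_n=\mathrm{Diag}(1,-1,\dots,(-1)^{n-1})$. It maps $\mathrm{Fl}_n^{>0}$ to itself. Totally positive Vandermonde flags: $\mathcal{V}_n^{>0}\subseteq\mathrm{Fl}_n^{>0}$ is the set of flags represented by matrices $(\lambda_i^{j-1}x_i)_{1\le i,j\le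 n}$ with $\lambda_1>\dots>\lambda_n$ real and $x_1,\dots,x_n>0$. Amplituhedron: let $Z$ be a real $(k+m)\times n$ matrix whose $(k+m)\times(k+m)$ minors are all positive, viewed as a linear map $\mathbb{C}^n\to\mathbb{C}^{k+m}$. The map $\tilde Z(V)=\{Z(v):v\in V\}$ is defined on $\mathrm{Gr}_{k,n}^{\ge 0}$ with values in $\mathrm{Gr}_{k,k+m}(\mathbb{R})\subseteq\mathrm{Gr}_{k,k+m}(\mathbb{C})$, and the amplituhedron is $\mathcal{A}_{n,k,m}(Z)=\tilde Z(\mathrm{Gr}_{k,n}^{\ge0})$. It is a twisted Vandermonde amplituhedron if there is $V\in\mathcal{V}_n^{>0}$ such that the rows of $Z$ form a basis of the $(k+m)$-dimensional subspace of the flag $\vartheta(V)$. *)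

theory Defs
  imports
    "HOL-Analysis.Abstract_Euclidean_Space"
    "Jordan_Normal_Form.Gauss_Jordan_Elimination"
    "Jordan_Normal_Form.DL_Rank"
    "Jordan_Normal_Form.DL_Submatrix"
begin

text \<open>Vectors and matrices are those of \<open>Jordan_Normal_Form\<close>, so all row and column indices start
  at \<open>0\<close>; \<open>submatrix A I J\<close> selects the rows in \<open>I\<close> and the columns in \<open>J\<close>, in increasing order.\<close>

abbreviation complex_mat :: "real mat \<Rightarrow> complex mat" where
  "complex_mat \<equiv> map_mat complex_of_real"


section \<open>Grassmannians\<close>

definition grassmannian :: "nat \<Rightarrow> nat \<Rightarrow> complex vec set set" where
  "grassmannian k n = {W. VectorSpace.subspace class_ring W (module_vec TYPE(complex) n) \<and>
     vectorspace.dim class_ring ((module_vec TYPE(complex) n)\<lparr>carrier := W\<rparr>) = k}"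

definition frames :: "nat \<Rightarrow> nat \<Rightarrow> complex mat set" where
  "frames k n = {A \<in> carrier_mat n k. vec_space.rank n A = k}"

text \<open>The space of full-rank \<open>n \<times> k\<close> matrices, topologized entrywise.\<close>

definition frame_topology :: "nat \<Rightarrow> nat \<Rightarrow> complex mat topology" where
  "frame_topology k n = pullback_topology (frames k n)
     (\<lambda>A. \<lambda>ij\<in>{..<n} \<times> {..<k}. A $$ ij)
     (product_topology (\<lambda>_. euclidean) ({..<n} \<times> {..<k}))"

text \<open>The quotient topology along \<open>vec_space.col_space n\<close>;
  see \<open>quotient_map_grassmannian\<close> below.\<close>

definition grassmannian_topology :: "nat \<Rightarrow> nat \<Rightarrow> complex vec set topology" where
  "grassmannian_topology k n = topology (\<lambda>U. U \<subseteq> grassmannian k n \<and>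
     openin (frame_topology k n) {A \<in> frames k n. vec_space.col_space n A \<in> U})"

definition real_grassmannian :: "nat \<Rightarrow> nat \<Rightarrow> complex vec set set" where
  "real_grassmannian k n = {vec_space.col_space n (complex_mat A) | A.
     A \<in> carrier_mat n k \<and> vec_space.rank n A = k}"

definition real_grassmannian_topology :: "nat \<Rightarrow> nat \<Rightarrow> complex vec set topology" where
  "real_grassmannian_topology k n =
     subtopology (grassmannian_topology k n) (real_grassmannian k n)"

definition nonneg_grassmannian :: "nat \<Rightarrow> nat \<Rightarrow> complex vec set set" where
  "nonneg_grassmannian k n = {vec_space.col_space n (complex_mat A) | A.
     A \<in> carrier_mat n k \<and> vec_space.rank n A = k \<and>
     (\<forall>I. I \<subseteq> {..<n} \<and> card I = k \<longrightarrow> det (submatrix A I {..<k}) \<ge> 0)}"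

lemma topspace_frame_topology: "topspace (frame_topology k n) = frames k n"
  by (auto simp: frame_topology_def topspace_pullback_topology)

lemma grassmannian_eq_col_spaces: "grassmannian k n = vec_space.col_space n ` frames k n"
proof -
  interpret vec_space "TYPE(complex)" n .
  have "col_space A \<in> grassmannian k n" if "A \<in> frames k n" for A
  proof -
    have "set (cols A) \<subseteq> carrier_vec n"
      using that cols_dim unfolding frames_def by blast
    then show ?thesis
      using that span_is_subspace[of "set (cols A)"]
      unfolding grassmannian_def frames_def col_space_def rank_def by auto
  qed
  moreover have "W \<in> col_space ` frames k n" if W: "W \<in> grassmannian k n" for W
  proof -
    have sub: "VectorSpace.subspace class_ring W V" and dimW: "vectorspace.dim class_ring (vs W) = k"
      using W unfolding grassmannian_def by auto
    then have subm: "submodule class_ring W V" by (simp add: VectorSpace.subspace_def)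
    have Wc: "W \<subseteq> carrier_vec n" using subm submodule_def[of class_ring W V] by auto
    interpret W: vectorspace class_ring "vs W"
      using sub by (rule subspace_is_vs)
    let ?li = "\<lambda>S. S \<subseteq> W \<and> lin_indpt S"
    have li_W: "W.lin_dep S \<longleftrightarrow> lin_dep S" if "S \<subseteq> W" for S
      using span_li_not_depend(2)[OF that subm] by simp
    have bound: "finite S \<and> card S \<le> n" if "?li S" for S
      using that Wc li_le_dim[OF fin_dim, of S] dim_is_n by auto
    have "?li {}" by (simp add: lin_dep_def)
    then obtain B where B: "maximal B ?li"
      using maximal_exists[of ?li n "{}"] bound by blast
    then have "maximal B (\<lambda>S. S \<subseteq> carrier (vs W) \<and> W.lin_indpt S)"
      unfolding maximal_def using li_W by (metis carrier_vs_is_self)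
    then have "W.gen_set B" by (rule W.max_li_is_gen)
    then have B: "finite B" "W.basis B"
      using B bound[of B] li_W unfolding W.basis_def maximal_def by auto
    then have cardB: "card B = k" using W.dim_basis dimW by simp
    have BW: "B \<subseteq> W" using B(2) unfolding W.basis_def by simp
    have "W.span B = W" using B(2) unfolding W.basis_def by simp
    then have spanB: "span B = W"
      using span_li_not_depend(1)[OF BW subm] by simp
    obtain bs where bs: "set bs = B" "distinct bs" using finite_distinct_list[OF B(1)] by blast
    have len: "length bs = k" using bs cardB distinct_card by force
    have cols_bs: "cols (mat_of_cols n bs) = bs"
      using BW Wc bs(1) by (intro cols_mat_of_cols) auto
    have "span (set (cols (mat_of_cols n bs))) = W"
      using cols_bs bs(1) spanB by simp
    then have "mat_of_cols n bs \<in> frames k n" "col_space (mat_of_cols n bs) = W"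
      using dimW len unfolding frames_def rank_def col_space_def by auto
    then show ?thesis by blast
  qed
  ultimately show ?thesis by blast
qed

lemma quotient_map_grassmannian:
  "quotient_map (frame_topology k n) (grassmannian_topology k n) (vec_space.col_space n)"
proof -
  let ?P = "\<lambda>U. {A \<in> frames k n. vec_space.col_space n A \<in> U}"
  let ?L = "\<lambda>U. U \<subseteq> grassmannian k n \<and> openin (frame_topology k n) (?P U)"
  have "istopology ?L"
    unfolding istopology_def
  proof (intro conjI allI impI)
    fix S T assume "?L S" "?L T"
    moreover have "?P (S \<inter> T) = ?P S \<inter> ?P T" by auto
    ultimately show "openin (frame_topology k n) (?P (S \<inter> T))" by auto
  next
    fix K assume "\<forall>S\<in>K. ?L S"
    moreover have "?P (\<Union>K) = \<Union>(?P ` K)" by auto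
    ultimately show "openin (frame_topology k n) (?P (\<Union>K))" by auto
  qed auto
  then have op: "openin (grassmannian_topology k n) = ?L"
    unfolding grassmannian_topology_def by (rule topology_inverse')
  have "?P (grassmannian k n) = topspace (frame_topology k n)"
    by (auto simp: grassmannian_eq_col_spaces topspace_frame_topology)
  then have "openin (grassmannian_topology k n) (grassmannian k n)"
    unfolding op by simp
  then have "topspace (grassmannian_topology k n) = grassmannian k n"
    unfolding topspace_def op by auto
  then show ?thesis
    unfolding quotient_map_def
    by (auto simp: op topspace_frame_topology grassmannian_eq_col_spaces)
qed


section \<open>Flags and the twist map\<close>

text \<open>A flag is encoded as the function taking \<open>j\<close> to its \<open>j\<close>-th subspace, so \<open>0\<close> is sent to the
  zero space. For an invertible \<open>n \<times> n\<close> matrix \<open>M\<close>, every \<open>j \<ge> n\<close> is sent to the whole space, so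
  two such matrices represent the same flag iff the functions are equal.\<close>

definition flag_of :: "nat \<Rightarrow> complex mat \<Rightarrow> nat \<Rightarrow> complex vec set" where
  "flag_of n M = (\<lambda>j. LinearCombinations.module.span class_ring (module_vec TYPE(complex) n)
     (set (take j (cols M))))"

definition nonneg_orthogonal_rep :: "nat \<Rightarrow> (nat \<Rightarrow> complex vec set) \<Rightarrow> real mat \<Rightarrow> bool" where
  "nonneg_orthogonal_rep n V g \<longleftrightarrow>
     g \<in> carrier_mat n n \<and> transpose_mat g * g = 1\<^sub>m n \<and> flag_of n (complex_mat g) = V \<and>
     (\<forall>I. I \<subseteq> {..<n} \<longrightarrow> det (submatrix g I {..<card I}) \<ge> 0)"

text \<open>Only meaningful on totally nonnegative flags, where the representative \<open>g\<close> exists uniquely.\<close>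

definition twist :: "nat \<Rightarrow> (nat \<Rightarrow> complex vec set) \<Rightarrow> nat \<Rightarrow> complex vec set" where
  "twist n V =
     (let g = (THE g. nonneg_orthogonal_rep n V g);
          \<delta> = mat_diag n (\<lambda>i. (-1) ^ i)
      in flag_of n (complex_mat (\<delta> * the (mat_inverse g) * \<delta>)))"

definition positive_vandermonde_flags :: "nat \<Rightarrow> (nat \<Rightarrow> complex vec set) set" where
  "positive_vandermonde_flags n =
     {flag_of n (complex_mat (mat n n (\<lambda>(i, j). \<mu> i ^ j * x i))) | (\<mu> :: nat \<Rightarrow> real) (x :: nat \<Rightarrow> real).
        (\<forall>i j. i < j \<and> j < n \<longrightarrow> \<mu> i > \<mu> j) \<and> (\<forall>i < n. x i > 0)}"


section \<open>Amplituhedra\<close>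

definition amplituhedron :: "nat \<Rightarrow> nat \<Rightarrow> real mat \<Rightarrow> complex vec set set" where
  "amplituhedron n k Z =
     (\<lambda>W. (\<lambda>v. complex_mat Z *\<^sub>v v) ` W) ` nonneg_grassmannian k n"

definition twisted_vandermonde :: "nat \<Rightarrow> nat \<Rightarrow> nat \<Rightarrow> real mat \<Rightarrow> bool" where
  "twisted_vandermonde n k m Z \<longleftrightarrow>
     (\<exists>V \<in> positive_vandermonde_flags n.
        distinct (rows (complex_mat Z)) \<and>
        vectorspace.basis class_ring
          ((module_vec TYPE(complex) n)\<lparr>carrier := twist n V (k + m)\<rparr>)
          (set (rows (complex_mat Z))))"


section \<open>Balls and spheres\<close>

definition closed_unit_ball :: "nat \<Rightarrow> (nat \<Rightarrow> real) topology" where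
  "closed_unit_ball d = subtopology (Euclidean_space d) {x. (\<Sum>i<d. (x i)\<^sup>2) \<le> 1}"

definition open_unit_ball :: "nat \<Rightarrow> (nat \<Rightarrow> real) topology" where
  "open_unit_ball d = subtopology (Euclidean_space d) {x. (\<Sum>i<d. (x i)\<^sup>2) < 1}"

text \<open>The \<open>(d-1)\<close>-dimensional sphere bounding the \<open>d\<close>-dimensional ball. It is
  \<open>nsphere (d - 1)\<close> for \<open>d > 0\<close>, but empty for \<open>d = 0\<close>.\<close>

definition unit_sphere :: "nat \<Rightarrow> (nat \<Rightarrow> real) topology" where
  "unit_sphere d = subtopology (Euclidean_space d) {x. (\<Sum>i<d. (x i)\<^sup>2) = 1}"

end

theory Submission
  imports Defs "Jordan_Normal_Form.Char_Poly" "HOL-Analysis.Function_Metric"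
    "HOL-Analysis.Abstract_Topological_Spaces"
begin

text \<open>
  The kernel of \<open>Z\<close> is stable under some Jacobi matrix, that is, a real symmetric tridiagonal matrix
  with positive off-diagonal entries: for \<open>k + m \<le> 2\<close> one solves for its entries, starting from a
  positive vector and a second vector orthogonal to it in the row space, and for \<open>n - k - m \<le> 2\<close>
  one does the same for the kernel with alternating signs. Along the flow \<open>exp (t A)\<close> of a Jacobi
  matrix \<open>A\<close> the minors of a fixed size satisfy a cooperative linear system that connects all row
  sets, so nonnegative minors that do not all vanish become positive for \<open>t > 0\<close>. Letting \<open>t\<close> grow,
  the eigenvectors \<open>u\<^sub>0, u\<^sub>1, \<dots>\<close> (with decreasing eigenvalues) have left-justified minors of constant
  sign. Hence the row space of \<open>Z\<close>, being spanned by eigenvectors, is that of \<open>u\<^sub>0, \<dots>, u\<^sub>k\<^sub>+\<^sub>m\<^sub>-\<^sub>1\<close>, and the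
  rows of the eigenvector matrix arise, up to sign, from a Vandermonde matrix in the eigenvalues by
  Gram-Schmidt, because the components of an eigenvector are polynomials in its eigenvalue.

  In the affine chart of the Grassmannian in which a subspace is the graph of a map from the first
  \<open>k\<close> eigenvectors to the others, \<open>Z\<close> forgets coordinates and the flow is diagonal and contracting.
  So the amplituhedron is a compact set \<open>Q\<close> which an anisotropic dilation maps into its own interior,
  and comparing the gauges of \<open>Q\<close> and of the unit ball gives a homeomorphism of the chart that takes
  \<open>Q\<close> to the ball.
\<close>

section \<open>Minors and the Cauchy-Binet formula\<close>

text \<open>The bound 2 comes from counting unknowns. Prescribing A f = 0 determines the diagonal of
  A from its off-diagonal entries, and a second eigenvector g then determines those one after
  another; a third would overdetermine them. The eigenvalues 0 and -1 are a normalization: adding a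
  multiple of the identity and multiplying by a positive number keep A a Jacobi matrix with the same
  eigenvectors. Positivity enters through one pairing: the Cauchy-Binet sum of positive minors
  against nonnegative ones that do not all vanish is positive. It shows that the first k + m
  eigenvectors are independent modulo the kernel of Z, that every totally nonnegative subspace lies
  in the single chart centred at the span of the first k eigenvectors, and, once the sum is
  normalized to 1, that these subspaces form a bounded set there. In that chart the flow multiplies
  the coordinate from eigenvector j to eigenvector p by exp (- t (mu_j - mu_p)). These rates differ,
  and nothing is known to be convex, so orbits of weighted dilations take the place of rays.\<close>

definition minor :: "nat \<Rightarrow> (nat \<Rightarrow> nat \<Rightarrow> 'a::comm_ring_1) \<Rightarrow> nat set \<Rightarrow> 'a" where
  "minor k f I = det (mat k k (\<lambda>(i, j). f (pick I i) j))"

abbreviation ksets :: "nat \<Rightarrow> nat \<Rightarrow> nat set set" where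
  "ksets n k \<equiv> {I. I \<subseteq> {..<n} \<and> card I = k}"

lemma finite_ksets [simp]: "finite (ksets n k)"
  by (rule finite_subset[of _ "Pow {..<n}"]) auto

lemma pick_strict_mono:
  assumes "i < j" "j < card I" shows "pick I i < pick I j"
proof (cases "finite I")
  case True
  then show ?thesis using assms pick_mono_le by blast
qed (use assms in auto)

lemma pick_inj_iff:
  assumes "i < card I" "j < card I" shows "pick I i = pick I j \<longleftrightarrow> i = j"
  using assms pick_strict_mono[of i j I] pick_strict_mono[of j i I]
  by (cases i j rule: linorder_cases) auto

lemma bij_betw_pick:
  assumes "finite I" shows "bij_betw (pick I) {..<card I} I"
proof -
  have inj: "inj_on (pick I) {..<card I}"
    by (auto simp: inj_on_def pick_inj_iff)
  have "pick I ` {..<card I} \<subseteq> I" using pick_in_set_le by auto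
  moreover have "card (pick I ` {..<card I}) = card I" using inj by (simp add: card_image)
  ultimately have "pick I ` {..<card I} = I"
    using assms card_subset_eq by blast
  then show ?thesis using inj by (simp add: bij_betw_def)
qed

text \<open>For \<open>a\<close> in \<open>I\<close>, \<open>pick I\<close> at the number of
  elements of \<open>I\<close> below \<open>a\<close> returns \<open>a\<close>; a strictly
  increasing enumeration \<open>f\<close> has exactly \<open>r\<close> values below
  \<open>f r\<close>.\<close>

lemma pick_eqI:
  assumes mono: "\<And>i j. i < j \<Longrightarrow> j < k \<Longrightarrow> f i < f j" and im: "f ` {..<k} = I" and "r < k"
  shows "pick I r = (f r :: nat)"
proof -
  have inj: "inj_on f {..<k}"
    using mono by (metis inj_onI lessThan_iff linorder_neqE_nat nat_neq_iff)
  have "{a \<in> I. a < f r} = f ` {..<r}"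
  proof
    show "{a \<in> I. a < f r} \<subseteq> f ` {..<r}"
    proof
      fix a assume "a \<in> {a \<in> I. a < f r}"
      then obtain s where s: "s < k" "a = f s" "f s < f r" using im by auto
      then have "s < r" using mono[of r s] by (metis less_asym linorder_neqE_nat)
      then show "a \<in> f ` {..<r}" using s by auto
    qed
    show "f ` {..<r} \<subseteq> {a \<in> I. a < f r}"
    proof
      fix a assume "a \<in> f ` {..<r}"
      then obtain s where "s < r" "a = f s" by auto
      then show "a \<in> {a \<in> I. a < f r}" using mono[of s r] im \<open>r < k\<close> by auto
    qed
  qed
  moreover have "card (f ` {..<r}) = r"
    using inj \<open>r < k\<close> by (subst card_image) (auto intro: inj_on_subset)
  ultimately have "card {a \<in> I. a < f r} = r" by simp
  moreover have "f r \<in> I" using im \<open>r < k\<close> by auto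
  ultimately show ?thesis using pick_card_in_set[of "f r" I] by simp
qed

lemma pick_lessThan: "r < k \<Longrightarrow> pick {..<k} r = r"
  by (rule pick_eqI[where k = k]) auto

lemma permutes_lt: "p permutes {0..<k} \<Longrightarrow> i < k \<Longrightarrow> p i < (k::nat)"
  using permutes_in_image[of p "{0..<k}" i] by simp

lemma det_mat: "det (mat k k (\<lambda>(i, j). f i j)) =
    (\<Sum>p | p permutes {0..<k}. signof p * (\<Prod>i = 0..<k. f i (p i)))"
  by (subst det_def'[of _ k])
     (auto intro!: sum.cong prod.cong arg_cong2[where f = "(*)"] simp: permutes_lt)

lemma det_mat_cong:
  assumes "\<And>i j. i < k \<Longrightarrow> j < k \<Longrightarrow> f i j = g i j"
  shows "det (mat k k (\<lambda>(i, j). f i j)) = det (mat k k (\<lambda>(i, j). g i j))"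
  using assms by (intro arg_cong[where f = det] eq_matI) auto

lemma det_mat_permute_rows:
  assumes "p permutes {0..<k}"
  shows "det (mat k k (\<lambda>(i, j). f (p i) j)) = signof p * det (mat k k (\<lambda>(i, j). f i j))"
proof -
  have "det (mat k k (\<lambda>(i, j). f (p i) j)) = 
     det (mat k k (\<lambda>(i, j). (mat k k (\<lambda>(i, j). f i j)) $$ (p i, j)))"
    using assms by (intro arg_cong[where f = det] eq_matI) (auto simp: permutes_lt)
  then show ?thesis using det_permute_rows[OF _ assms, of "mat k k (\<lambda>(i, j). f i j)"] by simp
qed

lemma det_mat_identical_rows:
  assumes "i \<noteq> j" "i < k" "j < k" "\<And>c. c < k \<Longrightarrow> f i c = f j c"
  shows "det (mat k k (\<lambda>(i, j). f i j)) = 0"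
  by (rule det_identical_rows[of _ k i j]) (use assms in auto)

lemma det_mat_row_sum:
  fixes f :: "nat \<Rightarrow> nat \<Rightarrow> 'a::comm_ring_1" and c :: "'b \<Rightarrow> 'a"
  assumes "r < k" "finite S"
  shows "det (mat k k (\<lambda>(i, j). if i = r then \<Sum>s\<in>S. c s * g s j else f i j)) =
     (\<Sum>s\<in>S. c s * det (mat k k (\<lambda>(i, j). if i = r then g s j else f i j)))"
proof -
  have *: "(\<Prod>i = 0..<k. if i = r then h (p i) else f i (p i)) =
       h (p r) * (\<Prod>i\<in>{0..<k} - {r}. f i (p i))" for p and h :: "nat \<Rightarrow> 'a"
    using assms by (subst prod.remove[of _ r]) (auto intro!: arg_cong2[where f = "(*)"] prod.cong)
  show ?thesis
    unfolding det_mat *[of "\<lambda>j. \<Sum>s\<in>S. c s * g s j"] *[of "g _"] sum_distrib_left sum_distrib_right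
    by (subst sum.swap) (simp add: mult_ac)
qed

lemma det_mat_row_scale:
  "det (mat k k (\<lambda>(i, j). c i * f i j)) = (\<Prod>i<k. c i) * det (mat k k (\<lambda>(i, j). f i j))"
  unfolding det_mat sum_distrib_left
  by (rule sum.cong) (auto simp: prod.distrib atLeast0LessThan mult_ac)

lemma det_mat_transpose:
  "det (mat k k (\<lambda>(i, j). f j i)) = det (mat k k (\<lambda>(i, j). f i j))"
proof -
  have "mat k k (\<lambda>(i, j). f j i) = transpose_mat (mat k k (\<lambda>(i, j). f i j))"
    by (intro eq_matI) auto
  then show ?thesis by (metis det_transpose mat_carrier)
qed

lemma det_mat_col_scale:
  "det (mat k k (\<lambda>(i, j). c j * f i j)) = (\<Prod>i<k. c i) * det (mat k k (\<lambda>(i, j). f i j))"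
  unfolding det_mat_transpose[of k "\<lambda>i j. c i * f j i"] det_mat_row_scale
  unfolding det_mat_transpose[of k f] by (rule refl)

lemma minor_cong:
  assumes "\<And>i j. i \<in> I \<Longrightarrow> j < k \<Longrightarrow> f i j = g i j" "card I = k"
  shows "minor k f I = minor k g I"
  unfolding minor_def by (rule det_mat_cong) (use assms pick_in_set_le in auto)

lemma det_submatrix_rows:
  assumes "A \<in> carrier_mat n k" "I \<in> ksets n k"
  shows "det (submatrix A I {..<k}) = minor k (\<lambda>i j. A $$ (i, j)) I"
proof -
  have 1: "{i. i < n \<and> i \<in> I} = I" "{j. j < k \<and> j \<in> {..<k}} = {..<k}" using assms by auto
  show ?thesis unfolding submatrix_def minor_def
    using assms 1 by (intro arg_cong[where f = det] eq_matI) (auto simp: pick_lessThan)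
qed

lemma det_submatrix_cols:
  assumes "A \<in> carrier_mat k n" "I \<in> ksets n k"
  shows "det (submatrix A {..<k} I) = minor k (\<lambda>i j. A $$ (j, i)) I"
proof -
  have 1: "{i. i < n \<and> i \<in> I} = I" "{j. j < k \<and> j \<in> {..<k}} = {..<k}" using assms by auto
  have "det (submatrix A {..<k} I) = det (mat k k (\<lambda>(i, j). A $$ (i, pick I j)))"
    unfolding submatrix_def
    using assms 1 by (intro arg_cong[where f = det] eq_matI) (auto simp: pick_lessThan)
  then show ?thesis unfolding minor_def by (simp add: det_mat_transpose[of k "\<lambda>i j. A $$ (i, pick I j)"])
qed

text \<open>Expanding every entry gives a sum over all maps \<open>h\<close> that choose a row for
  each index. A map that is not injective repeats a row of \<open>g\<close> and contributes 0. The
  injective ones are sorted by their image \<open>I\<close>; each is \<open>pick I\<close> after a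
  permutation, and summing over the permutations reassembles the minor of \<open>f\<close>.\<close>

lemma cauchy_binet:
  "det (mat k k (\<lambda>(i, j). \<Sum>l<n. f l i * g l j)) = (\<Sum>I\<in>ksets n k. minor k f I * minor k g I)"
proof -
  let ?D = "\<lambda>h. det (mat k k (\<lambda>(i, j). g (h i) j))"
  let ?F = "PiE {0..<k} (\<lambda>_. {..<n})"
  let ?G = "\<lambda>h. (\<Prod>i = 0..<k. f (h i) i) * ?D h"
  let ?B = "\<lambda>I. {h \<in> ?F. bij_betw h {0..<k} I}"
  have finF: "finite ?F" by (simp add: finite_PiE)
  have "det (mat k k (\<lambda>(i, j). \<Sum>l<n. f l i * g l j)) =
     (\<Sum>p | p permutes {0..<k}. signof p * (\<Sum>h\<in>?F. \<Prod>i = 0..<k. f (h i) i * g (h i) (p i)))"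
    unfolding det_mat by (subst prod_sum_PiE) auto
  also have "\<dots> = (\<Sum>h\<in>?F. ?G h)"
    unfolding sum_distrib_left det_mat
    by (subst sum.swap) (simp add: prod.distrib mult_ac)
  also have "\<dots> = (\<Sum>h\<in>(\<Union>I\<in>ksets n k. ?B I). ?G h)"
  proof (rule sum.mono_neutral_right)
    show "\<forall>h\<in>?F - (\<Union>I\<in>ksets n k. ?B I). ?G h = 0"
    proof
      fix h assume h: "h \<in> ?F - (\<Union>I\<in>ksets n k. ?B I)"
      have "\<not> inj_on h {0..<k}"
      proof
        assume inj: "inj_on h {0..<k}"
        then have "h ` {0..<k} \<in> ksets n k" using h by (auto simp: card_image)
        moreover have "bij_betw h {0..<k} (h ` {0..<k})" using inj by (simp add: bij_betw_def)
        ultimately show False using h by auto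
      qed
      then obtain i j where "i < k" "j < k" "i \<noteq> j" "h i = h j" by (auto simp: inj_on_def)
      then show "?G h = 0" using det_mat_identical_rows[of i j k "\<lambda>i. g (h i)"] by simp
    qed
  qed (use finF in auto)
  also have "\<dots> = (\<Sum>I\<in>ksets n k. \<Sum>h\<in>?B I. ?G h)"
    by (rule sum.UNION_disjoint) (use finF in \<open>auto simp: bij_betw_def\<close>)
  also have "\<dots> = (\<Sum>I\<in>ksets n k. minor k f I * minor k g I)"
  proof (rule sum.cong[OF refl])
    fix I assume I: "I \<in> ksets n k"
    then have finI: "finite I" using finite_subset by auto
    have bp: "bij_betw (pick I) {0..<k} I" using bij_betw_pick[OF finI] I by (simp add: atLeast0LessThan)
    let ?P = "{p. p permutes {0..<k}}"
    let ?inv = "the_inv_into {0..<k} (pick I)"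
    have "(\<Sum>h\<in>?B I. ?G h) = (\<Sum>p\<in>?P. ?G (\<lambda>i. pick I (p i)))"
    \<comment> \<open>Bijections onto \<open>I\<close> correspond to permutations. Outside
      \<open>{0..<k}\<close> the former are undefined and the latter are the identity, which
      explains the two ways of extending them.\<close>
    proof (rule sum.reindex_bij_witness[where
          i = "\<lambda>p. restrict (\<lambda>i. pick I (p i)) {0..<k}" and
          j = "\<lambda>h i. if i < k then ?inv (h i) else i"])
      fix h assume h: "h \<in> ?B I"
      have pinv: "pick I (?inv x) = x" "?inv x \<in> {0..<k}" if "x \<in> I" for x
        using that bp f_the_inv_into_f[of "pick I" "{0..<k}" x]
          the_inv_into_into[of "pick I" "{0..<k}" x "{0..<k}"] by (auto simp: bij_betw_def)
      have hI: "h i \<in> I" if "i < k" for i using h that by (auto simp: bij_betw_def)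
      show "restrict (\<lambda>i. pick I (if i < k then ?inv (h i) else i)) {0..<k} = h"
      proof
        fix i show "restrict (\<lambda>i. pick I (if i < k then ?inv (h i) else i)) {0..<k} i = h i"
          using h pinv hI by (auto simp: PiE_def extensional_def)
      qed
      have "bij_betw (?inv \<circ> h) {0..<k} {0..<k}"
        using h bij_betw_trans[OF _ bij_betw_the_inv_into[OF bp]] by blast
      then have "bij_betw (\<lambda>i. if i < k then ?inv (h i) else i) {0..<k} {0..<k}"
        by (rule bij_betw_cong[THEN iffD1, rotated]) auto
      then show "(\<lambda>i. if i < k then ?inv (h i) else i) \<in> ?P"
        by (auto intro: bij_imp_permutes)
      show "?G (\<lambda>i. pick I (if i < k then ?inv (h i) else i)) = ?G h"
      proof -
        have "(\<Prod>i = 0..<k. f (pick I (if i < k then ?inv (h i) else i)) i) = (\<Prod>i = 0..<k. f (h i) i)"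
          by (rule prod.cong) (auto simp: pinv hI)
        moreover have "?D (\<lambda>i. pick I (if i < k then ?inv (h i) else i)) = ?D h"
          by (rule det_mat_cong) (auto simp: pinv hI)
        ultimately show ?thesis by simp
      qed
    next
      fix p assume p: "p \<in> ?P"
      have inj: "inj_on (pick I) {0..<k}" using bp by (simp add: bij_betw_def)
      show "(\<lambda>i. if i < k then ?inv (restrict (\<lambda>i. pick I (p i)) {0..<k} i) else i) = p"
      proof
        fix i
        have "p i = i" if "\<not> i < k" using p that by (auto simp: permutes_def)
        moreover have "p i \<in> {0..<k}" if "i < k" using p that by (auto simp: permutes_lt)
        ultimately show "(if i < k then ?inv (restrict (\<lambda>i. pick I (p i)) {0..<k} i) else i) = p i"
          using the_inv_into_f_f[OF inj] by auto
      qed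
      have "bij_betw (pick I \<circ> p) {0..<k} I"
        using p bp bij_betw_trans permutes_imp_bij by blast
      then have b: "bij_betw (restrict (\<lambda>i. pick I (p i)) {0..<k}) {0..<k} I"
        by (rule bij_betw_cong[THEN iffD1, rotated]) auto
      then show "restrict (\<lambda>i. pick I (p i)) {0..<k} \<in> ?B I"
        using I by (auto simp: bij_betw_def)
    qed
    also have "\<dots> = (\<Sum>p\<in>?P. (signof p * (\<Prod>i = 0..<k. f (pick I (p i)) i)) * minor k g I)"
      by (rule sum.cong) (auto simp: det_mat_permute_rows[of _ k "\<lambda>i. g (pick I i)"] minor_def mult_ac)
    also have "\<dots> = minor k f I * minor k g I"
      unfolding sum_distrib_right[symmetric]
      unfolding det_mat[of k "\<lambda>i j. f (pick I j) i", symmetric]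
      unfolding minor_def det_mat_transpose[of k "\<lambda>i. f (pick I i)"] by (rule refl)
    finally show "(\<Sum>h\<in>?B I. ?G h) = minor k f I * minor k g I" .
  qed
  finally show ?thesis .
qed

lemma lessThan_in_ksets: "k \<le> n \<Longrightarrow> {..<k} \<in> ksets n k"
  by auto

lemma minor_lessThan: "minor k f {..<k} = det (mat k k (\<lambda>(i, j). f i j))"
  unfolding minor_def by (rule det_mat_cong) (simp add: pick_lessThan)

lemma det_mat_delta: "det (mat k k (\<lambda>(i, j). if i = j then 1 else 0)) = (1::'a::comm_ring_1)"
proof -
  have "mat k k (\<lambda>(i, j). if i = j then 1 else 0) = (1\<^sub>m k :: 'a mat)" by (intro eq_matI) auto
  then show ?thesis by simp
qed

section \<open>Spectral theory of Jacobi matrices\<close>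

text \<open>The matrix is infinite; the sums over \<open>{..<n}\<close> cut it down to size
  \<open>n\<close>. This allows positivity of \<open>a\<close> to be assumed at all indices.\<close>

definition jacobi :: "(nat \<Rightarrow> real) \<Rightarrow> (nat \<Rightarrow> real) \<Rightarrow> nat \<Rightarrow> nat \<Rightarrow> real" where
  "jacobi a b i j = (if i = j then b i else if j = Suc i then a i else if i = Suc j then a j else 0)"

lemma jacobi_sym: "jacobi a b i j = jacobi a b j i"
  by (auto simp: jacobi_def)

lemma sum_jacobi:
  assumes "i < n"
  shows "(\<Sum>j<n. jacobi a b i j * v j) =
    (if i > 0 then a (i - 1) * v (i - 1) else 0) + b i * v i + (if Suc i < n then a i * v (Suc i) else 0)"
proof -
  have "jacobi a b i j * v j = (if j = i then b i * v i else 0) + (if j = Suc i then a i * v (Suc i) else 0)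
      + (if j = i - 1 then if i > 0 then a (i - 1) * v (i - 1) else 0 else 0)" for j
    by (cases i) (auto simp: jacobi_def)
  then have "(\<Sum>j<n. jacobi a b i j * v j) = (\<Sum>j<n. if j = i then b i * v i else 0)
      + (\<Sum>j<n. if j = Suc i then a i * v (Suc i) else 0)
      + (\<Sum>j<n. if j = i - 1 then if i > 0 then a (i - 1) * v (i - 1) else 0 else 0)"
    by (simp only: sum.distrib)
  then show ?thesis using assms by (simp add: less_imp_diff_less)
qed

lemma jacobi_self_adjoint:
  "(\<Sum>i<n. w i * (\<Sum>j<n. jacobi a b i j * v j)) = (\<Sum>i<n. (\<Sum>j<n. jacobi a b i j * w j) * v i)"
  unfolding sum_distrib_left sum_distrib_right
  by (subst sum.swap) (simp add: jacobi_sym mult_ac)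

text \<open>The components of an eigenvector for the eigenvalue \<open>x\<close> are the values of these polynomials at \<open>x\<close>.\<close>

fun rec_poly :: "(nat \<Rightarrow> 'a::field) \<Rightarrow> (nat \<Rightarrow> 'a) \<Rightarrow> nat \<Rightarrow> 'a poly" where
  "rec_poly a b 0 = 1"
| "rec_poly a b (Suc 0) = smult (1 / a 0) [:- b 0, 1:]"
| "rec_poly a b (Suc (Suc j)) =
     smult (1 / a (Suc j)) ([:- b (Suc j), 1:] * rec_poly a b (Suc j) - smult (a j) (rec_poly a b j))"

lemma rec_poly_degree:
  assumes "\<And>i. a i \<noteq> 0"
  shows "degree (rec_poly a b j) = j \<and> lead_coeff (rec_poly a b j) = (\<Prod>i<j. 1 / a i)"
  using assms
proof (induction a b j rule: rec_poly.induct)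
  case (3 a b j)
  let ?p = "[:- b (Suc j), 1:] * rec_poly a b (Suc j)"
  note IH = "3.IH"(1)[OF "3.prems"] "3.IH"(2)[OF "3.prems"]
  have nz: "rec_poly a b (Suc j) \<noteq> 0" using IH(1) by force
  have dp: "degree ?p = Suc (Suc j)" using nz IH(1) by (subst degree_mult_eq) auto
  have lp: "lead_coeff ?p = (\<Prod>i<Suc j. 1 / a i)" using IH(1) by (subst lead_coeff_mult) auto
  have lt: "degree (smult (a j) (rec_poly a b j)) < degree ?p"
    using dp IH(2) degree_smult_le[of "a j" "rec_poly a b j"] by linarith
  have d: "degree (?p - smult (a j) (rec_poly a b j)) = Suc (Suc j)"
    using degree_add_eq_left[of "- smult (a j) (rec_poly a b j)" ?p] lt dp unfolding diff_conv_add_uminus degree_minus by linarith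
  have "lead_coeff (?p - smult (a j) (rec_poly a b j)) = lead_coeff ?p"
    unfolding d dp coeff_diff using lt dp coeff_eq_0[of "smult (a j) (rec_poly a b j)" "Suc (Suc j)"] by simp
  then have l: "lead_coeff (?p - smult (a j) (rec_poly a b j)) = (\<Prod>i<Suc j. 1 / a i)"
    using lp by simp
  show ?case
    unfolding rec_poly.simps degree_smult_eq lead_coeff_smult using d l "3.prems"[of "Suc j"] by (simp del: mult_pCons_left)
qed auto

text \<open>Row \<open>i\<close> of the eigenvector equation. In a matrix of size \<open>n\<close>
  the last row lacks the term with \<open>Suc i = n\<close>, so there the equation holds exactly at
  the roots of \<open>rec_poly a b n\<close>.\<close>

lemma poly_rec_poly_rec:
  assumes "\<And>i. a i \<noteq> 0"
  shows "x * poly (rec_poly a b i) x =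
    (if i > 0 then a (i - 1) * poly (rec_poly a b (i - 1)) x else 0) + b i * poly (rec_poly a b i) x
      + a i * poly (rec_poly a b (Suc i)) x"
proof (cases i)
  case (Suc m)
  have "a (Suc m) * poly (rec_poly a b (Suc (Suc m))) x =
      (x - b (Suc m)) * poly (rec_poly a b (Suc m)) x - a m * poly (rec_poly a b m) x"
    using assms[of "Suc m"] by (simp add: left_diff_distrib)
  then show ?thesis using Suc by (simp add: algebra_simps del: rec_poly.simps)
qed (use assms[of 0] in \<open>simp add: field_simps\<close>)

text \<open>The recurrence at \<open>x\<close> is multiplied by the value at \<open>y\<close> and
  conversely; the diagonal terms cancel and the rest telescopes. There are three uses: two distinct
  roots give orthogonality, conjugate arguments force the roots to be real, and the confluent form
  makes them simple.\<close>

lemma christoffel_darboux: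
  assumes "\<And>i. a i \<noteq> 0"
  shows "(x - y) * (\<Sum>i<Suc n. poly (rec_poly a b i) x * poly (rec_poly a b i) y) =
    a n * (poly (rec_poly a b (Suc n)) x * poly (rec_poly a b n) y - poly (rec_poly a b n) x * poly (rec_poly a b (Suc n)) y)"
proof (induction n)
  case 0
  then show ?case using assms[of 0] by (simp add: field_simps)
next
  case (Suc n)
  let ?q = "\<lambda>i x. poly (rec_poly a b i) x"
  have "(x - y) * (\<Sum>i<Suc (Suc n). ?q i x * ?q i y) =
    a n * (?q (Suc n) x * ?q n y - ?q n x * ?q (Suc n) y)
      + ((x * ?q (Suc n) x) * ?q (Suc n) y - ?q (Suc n) x * (y * ?q (Suc n) y))"
    using Suc.IH by (simp add: algebra_simps)
  also have "\<dots> = a (Suc n) * (?q (Suc (Suc n)) x * ?q (Suc n) y - ?q (Suc n) x * ?q (Suc (Suc n)) y)"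
    unfolding poly_rec_poly_rec[OF assms, where i = "Suc n"] by (simp add: algebra_simps del: rec_poly.simps)
  finally show ?case .
qed

text \<open>The confluent case. Instead of a limit for \<open>x\<close> tending to \<open>z\<close>,
  the identity is read as one between polynomials in \<open>x\<close> and differentiated at
  \<open>z\<close>, where the factor \<open>x - z\<close> disappears.\<close>

lemma christoffel_darboux_diag:
  fixes a b :: "nat \<Rightarrow> 'a::field_char_0"
  assumes "\<And>i. a i \<noteq> 0" and "poly (rec_poly a b (Suc n)) z = 0"
  shows "(\<Sum>i<Suc n. (poly (rec_poly a b i) z)\<^sup>2) = a n * poly (rec_poly a b n) z * poly (pderiv (rec_poly a b (Suc n))) z"
proof -
  let ?s = "\<Sum>i<Suc n. smult (poly (rec_poly a b i) z) (rec_poly a b i)"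
  have s: "poly ?s x = (\<Sum>i<Suc n. poly (rec_poly a b i) x * poly (rec_poly a b i) z)" for x
    unfolding poly_sum poly_smult by (simp add: mult_ac)
  have "poly ([:- z, 1:] * ?s) x = poly (smult (a n * poly (rec_poly a b n) z) (rec_poly a b (Suc n))) x" for x
  proof -
    have "poly ([:- z, 1:] * ?s) x = (x - z) * poly ?s x" by (simp only: poly_mult) simp
    also have "\<dots> = a n * (poly (rec_poly a b (Suc n)) x * poly (rec_poly a b n) z - poly (rec_poly a b n) x * poly (rec_poly a b (Suc n)) z)"
      unfolding s by (rule christoffel_darboux[OF assms(1)])
    also have "\<dots> = poly (smult (a n * poly (rec_poly a b n) z) (rec_poly a b (Suc n))) x"
      using assms(2) by (simp add: mult_ac del: rec_poly.simps)
    finally show ?thesis .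
  qed
  then have "[:- z, 1:] * ?s = smult (a n * poly (rec_poly a b n) z) (rec_poly a b (Suc n))"
    by (intro poly_eq_poly_eq_iff[THEN iffD1]) (rule ext)
  then have "pderiv ([:- z, 1:] * ?s) = smult (a n * poly (rec_poly a b n) z) (pderiv (rec_poly a b (Suc n)))"
    by (simp only: pderiv_smult)
  then have "poly (pderiv ([:- z, 1:] * ?s)) z = a n * poly (rec_poly a b n) z * poly (pderiv (rec_poly a b (Suc n))) z"
    by (simp only: poly_smult)
  moreover have "poly (pderiv ([:- z, 1:] * ?s)) z = poly ?s z"
    by (simp only: pderiv_mult poly_add poly_mult) (simp add: pderiv_pCons del: rec_poly.simps sum.lessThan_Suc)
  ultimately show ?thesis unfolding s by (simp add: power2_eq_square del: rec_poly.simps sum.lessThan_Suc)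
qed

lemma poly_rec_poly_of_real:
  "poly (rec_poly (\<lambda>i. complex_of_real (a i)) (\<lambda>i. complex_of_real (b i)) j) (complex_of_real x) =
    complex_of_real (poly (rec_poly a b j) x)"
  by (induction a b j rule: rec_poly.induct) auto

lemma poly_rec_poly_cnj:
  "poly (rec_poly (\<lambda>i. complex_of_real (a i)) (\<lambda>i. complex_of_real (b i)) j) (cnj z) =
    cnj (poly (rec_poly (\<lambda>i. complex_of_real (a i)) (\<lambda>i. complex_of_real (b i)) j) z)"
  by (induction a b j rule: rec_poly.induct) auto

text \<open>Over the complex numbers a polynomial with only simple roots has as many of them as its
  degree, so it suffices that all complex roots are real and simple.\<close>

lemma rec_poly_roots:
  fixes a b :: "nat \<Rightarrow> real"
  assumes "\<And>i. a i > 0"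
  shows "card {x. poly (rec_poly a b n) x = 0} = n"
proof (cases n)
  case (Suc m)
  let ?a = "\<lambda>i. complex_of_real (a i)" and ?b = "\<lambda>i. complex_of_real (b i)"
  let ?p = "rec_poly ?a ?b"
  have nz: "?a i \<noteq> 0" for i using assms[of i] by simp
  have real: "z \<in> \<real>" if z: "poly (?p n) z = 0" for z
  proof -
    \<comment> \<open>Christoffel-Darboux at \<open>z\<close> and \<open>cnj z\<close>: the right
      side vanishes, while the sum is a sum of squared moduli that starts with 1, the polynomial of
      index 0.\<close>
    have prod0: "(z - cnj z) * (\<Sum>i<Suc m. poly (?p i) z * poly (?p i) (cnj z)) = 0"
      unfolding christoffel_darboux[OF nz]
      using z Suc by (simp add: poly_rec_poly_cnj del: rec_poly.simps sum.lessThan_Suc mult_eq_0_iff)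
    have sum_eq: "(\<Sum>i<Suc m. poly (?p i) z * poly (?p i) (cnj z)) =
        complex_of_real (\<Sum>i<Suc m. (cmod (poly (?p i) z))\<^sup>2)"
      unfolding poly_rec_poly_cnj of_real_sum by (intro sum.cong refl) (simp only: complex_norm_square)
    have ge1: "(\<Sum>i<Suc m. (cmod (poly (?p i) z))\<^sup>2) \<ge> 1"
      by (subst sum.lessThan_Suc_shift) (simp add: sum_nonneg)
    have "(\<Sum>i<Suc m. (cmod (poly (?p i) z))\<^sup>2) \<noteq> 0" using ge1 by linarith
    then have "z - cnj z = 0"
      using prod0 unfolding sum_eq mult_eq_0_iff of_real_eq_0_iff by blast
    then have "z = cnj z" by simp
    then show ?thesis by (simp add: Reals_cnj_iff)
  qed
  have roots: "{z. poly (?p n) z = 0} = complex_of_real ` {x. poly (rec_poly a b n) x = 0}"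
  proof (intro equalityI subsetI)
    fix z assume "z \<in> {z. poly (?p n) z = 0}"
    then obtain x where "z = complex_of_real x" "poly (?p n) z = 0" using real by (auto elim: Reals_cases)
    then show "z \<in> complex_of_real ` {x. poly (rec_poly a b n) x = 0}"
      using poly_rec_poly_of_real[of a b n x] by auto
  qed (auto simp: poly_rec_poly_of_real)
  have "rsquarefree (?p n)"
    unfolding rsquarefree_roots
  proof (intro allI notI)
    fix z assume z: "poly (?p n) z = 0 \<and> poly (pderiv (?p n)) z = 0"
    then obtain x where x: "z = complex_of_real x" using real by (auto elim: Reals_cases)
    \<comment> \<open>A double root would make this sum vanish, but \<open>z\<close> is real, so it
      is a sum of real squares that starts with 1.\<close>
    have "(\<Sum>i<Suc m. (poly (?p i) z)\<^sup>2) = 0"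
      using christoffel_darboux_diag[OF nz, where b = ?b and n = m and z = z] z Suc by (simp del: rec_poly.simps sum.lessThan_Suc)
    then have "complex_of_real (\<Sum>i<Suc m. (poly (rec_poly a b i) x)\<^sup>2) = 0"
      unfolding x poly_rec_poly_of_real by (simp del: sum.lessThan_Suc)
    moreover have "(\<Sum>i<Suc m. (poly (rec_poly a b i) x)\<^sup>2) \<ge> 1"
      by (subst sum.lessThan_Suc_shift) (simp add: sum_nonneg)
    ultimately show False by (simp only: of_real_eq_0_iff)
  qed
  moreover have "?p n \<noteq> 0" using rec_poly_degree[of ?a ?b n] nz Suc by force
  ultimately have "card {z. poly (?p n) z = 0} = n"
    using rsquarefree_card_degree rec_poly_degree[of ?a ?b n] nz by auto
  then show ?thesis unfolding roots by (subst (asm) card_image) (auto simp: inj_on_def)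
qed simp


text \<open>The eigenvalues are the roots of \<open>rec_poly a b n\<close> in decreasing order; the
  eigenvectors are the normalized values of the lower polynomials there. Columns are orthonormal by
  Christoffel-Darboux, and rows because a one-sided inverse of a square matrix is two-sided.\<close>

theorem jacobi_spectral:
  fixes a b :: "nat \<Rightarrow> real"
  assumes a: "\<And>i. a i > 0"
  obtains \<mu> :: "nat \<Rightarrow> real" and U :: "nat \<Rightarrow> nat \<Rightarrow> real" where
    "\<And>i j. i < j \<Longrightarrow> j < n \<Longrightarrow> \<mu> i > \<mu> j"
    "\<And>i j. i < n \<Longrightarrow> j < n \<Longrightarrow> (\<Sum>r<n. U r i * U r j) = (if i = j then 1 else 0)"
    "\<And>i j. i < n \<Longrightarrow> j < n \<Longrightarrow> (\<Sum>r<n. U i r * U j r) = (if i = j then 1 else 0)"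
    "\<And>i c. i < n \<Longrightarrow> c < n \<Longrightarrow> (\<Sum>j<n. jacobi a b i j * U j c) = \<mu> c * U i c"
    "\<And>c. c < n \<Longrightarrow> U 0 c > 0"
    "\<And>j c. j < n \<Longrightarrow> c < n \<Longrightarrow> U j c = U 0 c * poly (rec_poly a b j) (\<mu> c)"
proof -
  let ?q = "rec_poly a b"
  have nz: "a i \<noteq> 0" for i using a[of i] by simp
  let ?R = "{x. poly (?q n) x = 0}"
  define \<mu> where "\<mu> i = rev (sorted_list_of_set ?R) ! i" for i
  have card: "card ?R = n" by (rule rec_poly_roots[OF a])
  have "(\<Prod>i<n. 1 / a i) \<noteq> 0" using nz by (simp add: prod_zero_iff)
  then have "lead_coeff (?q n) \<noteq> 0"
    using rec_poly_degree[where a = a and b = b and j = n, OF nz] by metis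
  then have "?q n \<noteq> 0" by fastforce
  then have fin: "finite ?R" by (rule poly_roots_finite)
  have len: "length (sorted_list_of_set ?R) = n" using card by simp
  have mono: "\<mu> i > \<mu> j" if "i < j" "j < n" for i j
    using that len sorted_wrt_nth_less[OF strict_sorted_list_of_set, of "n - Suc j" "n - Suc i" ?R]
    unfolding \<mu>_def by (simp add: rev_nth)
  have root: "poly (?q n) (\<mu> i) = 0" if "i < n" for i
  proof -
    have "\<mu> i \<in> set (rev (sorted_list_of_set ?R))" unfolding \<mu>_def using that len by (metis length_rev nth_mem)
    then show ?thesis using fin by simp
  qed
  define N where "N c = sqrt (\<Sum>i<n. (poly (?q i) (\<mu> c))\<^sup>2)" for c
  define U where "U j c = poly (?q j) (\<mu> c) / N c" for j c
  have sq: "(\<Sum>i<n. (poly (?q i) x)\<^sup>2) \<ge> 1" if n: "0 < n" for x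
  proof -
    obtain m where "n = Suc m" using n by (cases n) auto
    then show ?thesis by (simp only:) (subst sum.lessThan_Suc_shift, simp add: sum_nonneg)
  qed
  have N: "N c > 0" if "c < n" for c using sq[of "\<mu> c"] that unfolding N_def by simp
  have orth: "(\<Sum>r<n. poly (?q r) (\<mu> i) * poly (?q r) (\<mu> j)) = 0" if ij: "i < n" "j < n" "i \<noteq> j" for i j
  proof -
    have "\<mu> i \<noteq> \<mu> j" using that mono[of i j] mono[of j i] by (cases i j rule: linorder_cases) auto
    moreover obtain m where m: "n = Suc m" using ij by (cases n) auto
    ultimately show ?thesis
      using christoffel_darboux[where a = a, OF nz, where x = "\<mu> i" and y = "\<mu> j" and b = b and n = m] root[OF that(1)] root[OF that(2)]
      by (simp del: rec_poly.simps sum.lessThan_Suc)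
  qed
  have cols: "(\<Sum>r<n. U r i * U r j) = (if i = j then 1 else 0)" if "i < n" "j < n" for i j
  proof -
    have "(\<Sum>r<n. U r i * U r j) = (\<Sum>r<n. poly (?q r) (\<mu> i) * poly (?q r) (\<mu> j)) / (N i * N j)"
      unfolding U_def sum_divide_distrib by simp
    moreover have "(\<Sum>r<n. poly (?q r) (\<mu> i) * poly (?q r) (\<mu> i)) = N i * N i"
      unfolding N_def by (simp add: sum_nonneg power2_eq_square)
    ultimately show ?thesis using orth[OF that] N[OF that(1)] by auto
  qed
  let ?M = "mat n n (\<lambda>(i, j). U i j)"
  have MM': "transpose_mat ?M * ?M = 1\<^sub>m n"
    by (intro eq_matI) (auto simp: scalar_prod_def atLeast0LessThan cols)
  have MM: "?M * transpose_mat ?M = 1\<^sub>m n"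
    by (rule mat_mult_left_right_inverse[OF _ _ MM']) auto
  have rows: "(\<Sum>r<n. U i r * U j r) = (if i = j then 1 else 0)" if "i < n" "j < n" for i j
    using arg_cong[OF MM, of "\<lambda>A. A $$ (i, j)"] that by (simp add: scalar_prod_def atLeast0LessThan)
  have eig: "(\<Sum>j<n. jacobi a b i j * U j c) = \<mu> c * U i c" if "i < n" "c < n" for i c
  proof -
    have "(\<Sum>j<n. jacobi a b i j * U j c) = ((if i > 0 then a (i - 1) * poly (?q (i - 1)) (\<mu> c) else 0)
      + b i * poly (?q i) (\<mu> c) + (if Suc i < n then a i * poly (?q (Suc i)) (\<mu> c) else 0)) / N c"
      unfolding sum_jacobi[OF that(1)] U_def by (auto simp: add_divide_distrib)
    \<comment> \<open>In the last row the missing neighbour may be added, since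
      \<open>rec_poly a b n\<close> vanishes at the eigenvalue.\<close>
    also have "(if Suc i < n then a i * poly (?q (Suc i)) (\<mu> c) else 0) = a i * poly (?q (Suc i)) (\<mu> c)"
      using root[OF that(2)] that(1) by (cases "Suc i = n") (auto simp del: rec_poly.simps)
    finally have "(\<Sum>j<n. jacobi a b i j * U j c) = (\<mu> c * poly (?q i) (\<mu> c)) / N c"
      unfolding poly_rec_poly_rec[where a = a, OF nz, where i = i, symmetric] .
    then show ?thesis by (simp add: U_def)
  qed
  have U0: "U 0 c > 0" if "c < n" for c using N[OF that] by (simp add: U_def)
  have Uj: "U j c = U 0 c * poly (rec_poly a b j) (\<mu> c)" for j c by (simp add: U_def)
  show ?thesis by (rule that[OF mono cols rows eig U0 Uj])
qed

section \<open>Positivity of minors along the flow\<close>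

text \<open>Component \<open>s\<close> is driven by the components \<open>nx s e\<close> with
  positive weights. Adding \<open>\<epsilon> * exp (L * t)\<close> makes all initial values strictly
  positive. At the first time when some perturbed component is not positive, that component has had
  a positive derivative all along, a contradiction.\<close>

lemma metzler_nonneg:
  fixes q :: "'s \<Rightarrow> real \<Rightarrow> real"
  assumes S: "finite S" and w: "\<And>s e. s \<in> S \<Longrightarrow> e \<in> E s \<Longrightarrow> w s e > 0"
    and nx: "\<And>s e. s \<in> S \<Longrightarrow> e \<in> E s \<Longrightarrow> nx s e \<in> S" and c: "\<And>s. s \<in> S \<Longrightarrow> c s \<ge> 0"
    and der: "\<And>s t. s \<in> S \<Longrightarrow>
      (q s has_real_derivative c s * q s t + (\<Sum>e\<in>E s. w s e * q (nx s e) t)) (at t)"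
    and init: "\<And>s. s \<in> S \<Longrightarrow> q s 0 \<ge> 0"
    and s: "s \<in> S" and t: "t \<ge> 0"
  shows "q s t \<ge> 0"
proof -
  \<comment> \<open>Strictly above every row sum of the system, so that the growth of the
    perturbation outweighs the most negative drive possible while all components stay above
    \<open>- \<epsilon> * exp (L * t)\<close>.\<close>
  define L where "L = 1 + (\<Sum>s\<in>S. c s + (\<Sum>e\<in>E s. w s e))"
  have w0: "(\<Sum>e\<in>E s. w s e) \<ge> 0" if "s \<in> S" for s using w[OF that] by (simp add: sum_nonneg less_imp_le)
  have L: "c s + (\<Sum>e\<in>E s. w s e) < L" if "s \<in> S" for s
    using member_le_sum[OF that, of "\<lambda>s. c s + (\<Sum>e\<in>E s. w s e)"] c w0 S unfolding L_def
    by (simp add: add_nonneg_nonneg)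
  have main: "q s t + \<epsilon> * exp (L * t) > 0" if eps: "\<epsilon> > 0" and st: "s \<in> S" "t \<ge> 0" for \<epsilon> s t
  proof (rule ccontr)
    define z where "z s t = q s t + \<epsilon> * exp (L * t)" for s t
    assume "\<not> q s t + \<epsilon> * exp (L * t) > 0"
    then have neg: "z s t \<le> 0" by (simp add: z_def)
    have zder: "(z s has_real_derivative c s * q s t + (\<Sum>e\<in>E s. w s e * q (nx s e) t) + \<epsilon> * (exp (L * t) * L)) (at t)"
      if "s \<in> S" for s t
      unfolding z_def using der[OF that] by (auto intro!: derivative_eq_intros)
    have cont: "continuous_on UNIV (z s)" if "s \<in> S" for s
      using zder[OF that] by (meson DERIV_isCont continuous_at_imp_continuous_on)
    \<comment> \<open>The times at which some perturbed component is not positive; the set is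
      closed, so its infimum is the first of them.\<close>
    define B where "B = (\<Union>s\<in>S. {0..} \<inter> z s -` {..0})"
    have "closed B" unfolding B_def
      by (intro closed_UN S closed_Int closed_vimage closed_atLeast closed_atMost ballI cont)
    moreover have "t \<in> B" using st neg unfolding B_def by auto
    moreover have bdd: "bdd_below B" unfolding B_def by (rule bdd_belowI[of _ 0]) auto
    ultimately have "Inf B \<in> B" using closed_contains_Inf by blast
    then obtain s0 where s0: "s0 \<in> S" "Inf B \<ge> 0" "z s0 (Inf B) \<le> 0" unfolding B_def by auto
    have before: "z s u > 0" if "s \<in> S" "0 \<le> u" "u < Inf B" for s u
    proof (rule ccontr)
      assume "\<not> z s u > 0"
      then have "u \<in> B" using that(1,2) unfolding B_def by (intro UN_I[of s]) auto
      then show False using cInf_lower[OF _ bdd] that by fastforce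
    qed
    have z0: "z s0 0 > 0" using init[OF s0(1)] eps by (simp add: z_def add_nonneg_pos)
    then have pos: "Inf B > 0" using s0 by (cases "Inf B = 0") auto
    have "z s0 0 < z s0 (Inf B)"
    proof (rule DERIV_pos_imp_increasing_open[OF pos])
      fix u assume u: "0 < u" "u < Inf B"
      let ?e = "\<epsilon> * exp (L * u)"
      have q: "q s u \<ge> - ?e" if "s \<in> S" for s using before[OF that, of u] u unfolding z_def by simp
      have "c s0 * q s0 u \<ge> c s0 * (- ?e)" by (intro mult_left_mono q c s0(1))
      moreover have "(\<Sum>e\<in>E s0. w s0 e * (- ?e)) \<le> (\<Sum>e\<in>E s0. w s0 e * q (nx s0 e) u)"
        by (intro sum_mono mult_left_mono q nx s0(1)) (use w s0 less_imp_le in auto)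
      ultimately have "c s0 * q s0 u + (\<Sum>e\<in>E s0. w s0 e * q (nx s0 e) u) + ?e * L
          \<ge> ?e * (L - (c s0 + (\<Sum>e\<in>E s0. w s0 e)))"
        unfolding sum_distrib_right[symmetric] right_diff_distrib distrib_left by (simp add: mult.commute)
      moreover have "?e * (L - (c s0 + (\<Sum>e\<in>E s0. w s0 e))) > 0" using L[OF s0(1)] eps by simp
      ultimately have "c s0 * q s0 u + (\<Sum>e\<in>E s0. w s0 e * q (nx s0 e) u) + \<epsilon> * (exp (L * u) * L) > 0"
        by (simp only: mult.assoc)
      then show "\<exists>y. (z s0 has_real_derivative y) (at u) \<and> 0 < y"
        using zder[OF s0(1), of u] by blast
    next
      show "continuous_on {0..Inf B} (z s0)" using cont[OF s0(1)] continuous_on_subset by blast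
    qed
    then show False using z0 s0 by simp
  qed
  show ?thesis
  proof (rule ccontr)
    assume "\<not> q s t \<ge> 0"
    \<comment> \<open>With this number as \<open>\<epsilon>\<close> the perturbed value at
      \<open>t\<close> is exactly 0.\<close>
    then have "- q s t / exp (L * t) > 0" by (intro divide_pos_pos) auto
    from main[OF this s t] show False by simp
  qed
qed

text \<open>With nonnegative coefficients a nonnegative solution never decreases, so
  \<open>s0\<close> stays positive. Positivity spreads backwards along edges: once
  \<open>nx s e\<close> is positive at all positive times, so is the derivative of \<open>s\<close>.
  The premise \<open>conn\<close> is induction along paths that end in \<open>s0\<close>.\<close>

lemma metzler_pos_aux:
  fixes q :: "'s \<Rightarrow> real \<Rightarrow> real"
  assumes S: "finite S" and w: "\<And>s e. s \<in> S \<Longrightarrow> e \<in> E s \<Longrightarrow> w s e > 0"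
    and E: "\<And>s. s \<in> S \<Longrightarrow> finite (E s)"
    and nx: "\<And>s e. s \<in> S \<Longrightarrow> e \<in> E s \<Longrightarrow> nx s e \<in> S" and c: "\<And>s. s \<in> S \<Longrightarrow> c s \<ge> 0"
    and der: "\<And>s t. s \<in> S \<Longrightarrow>
      (q s has_real_derivative c s * q s t + (\<Sum>e\<in>E s. w s e * q (nx s e) t)) (at t)"
    and init: "\<And>s. s \<in> S \<Longrightarrow> q s 0 \<ge> 0"
    and s0: "s0 \<in> S" "q s0 0 > 0"
    and conn: "\<And>P. P s0 \<Longrightarrow> (\<And>s e. s \<in> S \<Longrightarrow> e \<in> E s \<Longrightarrow> P (nx s e) \<Longrightarrow> P s) \<Longrightarrow> \<forall>s\<in>S. P s"
    and s: "s \<in> S" and t: "t > 0"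
  shows "q s t > 0"
proof -
  have nonneg: "q s t \<ge> 0" if "s \<in> S" "t \<ge> 0" for s t
    by (rule metzler_nonneg[OF S w nx c der init that])
  have terms: "w s e * q (nx s e) t \<ge> 0" if "s \<in> S" "t \<ge> 0" "e \<in> E s" for s t e
    using w[of s e] nonneg nx that by (simp add: less_imp_le)
  have dpos: "c s * q s t + (\<Sum>e\<in>E s. w s e * q (nx s e) t) \<ge> 0" if "s \<in> S" "t \<ge> 0" for s t
    using c nonneg terms that by (simp add: sum_nonneg)
  have mono: "q s u \<le> q s t" if "s \<in> S" "0 \<le> u" "u \<le> t" for s u t
    by (rule DERIV_nonneg_imp_nondecreasing[OF that(3)]) (use der dpos that in force)
  have "\<forall>s\<in>S. \<forall>t>0. q s t > 0"
  proof (rule conn)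
    show "\<forall>t>0. q s0 t > 0"
    proof (intro allI impI)
      fix t :: real assume "t > 0"
      then show "q s0 t > 0" using mono[OF s0(1), of 0 t] s0(2) by simp
    qed
  next
    fix s e assume se: "s \<in> S" "e \<in> E s" "\<forall>t>0. q (nx s e) t > 0"
    show "\<forall>t>0. q s t > 0"
    proof (intro allI impI)
      fix t :: real assume t: "t > 0"
      have "q s 0 < q s t"
      proof (rule DERIV_pos_imp_increasing_open[OF t])
        fix u assume u: "0 < u" "u < t"
        have "w s e * q (nx s e) u \<le> (\<Sum>e\<in>E s. w s e * q (nx s e) u)"
          by (rule member_le_sum) (use se terms u E in auto)
        moreover have "w s e * q (nx s e) u > 0" using se w u by simp
        moreover have "c s * q s u \<ge> 0" using c nonneg se u by simp
        ultimately have "c s * q s u + (\<Sum>e\<in>E s. w s e * q (nx s e) u) > 0" by linarith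
        then show "\<exists>y. (q s has_real_derivative y) (at u) \<and> 0 < y" using der[OF se(1)] by blast
      next
        show "continuous_on {0..t} (q s)"
          using der[OF se(1)] by (meson DERIV_isCont continuous_at_imp_continuous_on)
      qed
      then show "q s t > 0" using init[OF se(1)] by linarith
    qed
  qed
  then show ?thesis using s t by blast
qed

text \<open>The factor \<open>exp (C * t)\<close> adds \<open>C\<close> to each diagonal coefficient
  without changing any sign of the solution, which removes the sign condition on
  \<open>c\<close>.\<close>

lemma metzler_pos:
  fixes q :: "'s \<Rightarrow> real \<Rightarrow> real"
  assumes S: "finite S" and w: "\<And>s e. s \<in> S \<Longrightarrow> e \<in> E s \<Longrightarrow> w s e > 0"
    and E: "\<And>s. s \<in> S \<Longrightarrow> finite (E s)"
    and nx: "\<And>s e. s \<in> S \<Longrightarrow> e \<in> E s \<Longrightarrow> nx s e \<in> S"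
    and der: "\<And>s t. s \<in> S \<Longrightarrow>
      (q s has_real_derivative c s * q s t + (\<Sum>e\<in>E s. w s e * q (nx s e) t)) (at t)"
    and init: "\<And>s. s \<in> S \<Longrightarrow> q s 0 \<ge> 0"
    and s0: "s0 \<in> S" "q s0 0 > 0"
    and conn: "\<And>P. P s0 \<Longrightarrow> (\<And>s e. s \<in> S \<Longrightarrow> e \<in> E s \<Longrightarrow> P (nx s e) \<Longrightarrow> P s) \<Longrightarrow> \<forall>s\<in>S. P s"
    and s: "s \<in> S" and t: "t > 0"
  shows "q s t > 0"
proof -
  define C where "C = (\<Sum>s\<in>S. \<bar>c s\<bar>)"
  have C: "C + c s \<ge> 0" if "s \<in> S" for s
    using member_le_sum[OF that, of "\<lambda>s. \<bar>c s\<bar>"] S unfolding C_def by simp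
  let ?z = "\<lambda>s t. exp (C * t) * q s t"
  have "?z s t > 0"
  proof (rule metzler_pos_aux[of S E w nx "\<lambda>s. C + c s" ?z s0 s t])
    fix s t assume "s \<in> S"
    have "((\<lambda>t. exp (C * t) * q s t) has_real_derivative
        exp (C * t) * C * q s t + exp (C * t) * (c s * q s t + (\<Sum>e\<in>E s. w s e * q (nx s e) t))) (at t)"
      using der[OF \<open>s \<in> S\<close>, of t] by (auto intro!: derivative_eq_intros)
    then show "((\<lambda>t. exp (C * t) * q s t) has_real_derivative
        (C + c s) * (exp (C * t) * q s t) + (\<Sum>e\<in>E s. w s e * (exp (C * t) * q (nx s e) t))) (at t)"
      by (simp add: algebra_simps sum_distrib_left)
  next
    show "\<forall>s\<in>S. P s" if "P s0" "\<And>s e. s \<in> S \<Longrightarrow> e \<in> E s \<Longrightarrow> P (nx s e) \<Longrightarrow> P s" for P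
      using conn[of P] that by blast
  qed (use assms(1-4) init s0 s t C in auto)
  then show ?thesis by (simp add: zero_less_mult_iff)
qed

section \<open>Differential equations for the minors along a linear flow\<close>

lemma det_mat_deriv:
  fixes f :: "real \<Rightarrow> nat \<Rightarrow> nat \<Rightarrow> real"
  assumes "\<And>i j. i < k \<Longrightarrow> j < k \<Longrightarrow> ((\<lambda>t. f t i j) has_real_derivative f' i j) (at t)"
  shows "((\<lambda>t. det (mat k k (\<lambda>(i, j). f t i j))) has_real_derivative
    (\<Sum>r<k. det (mat k k (\<lambda>(i, j). if i = r then f' i j else f t i j)))) (at t)"
proof -
  have prod: "((\<lambda>t. \<Prod>i = 0..<k. f t i (p i)) has_real_derivative
     (\<Sum>r<k. \<Prod>i = 0..<k. if i = r then f' i (p i) else f t i (p i))) (at t)" if "p permutes {0..<k}" for p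
  proof -
    have "((\<lambda>t. \<Prod>i\<in>{0..<k}. f t i (p i)) has_derivative
        (\<lambda>y. \<Sum>r\<in>{0..<k}. (f' r (p r) * y) * (\<Prod>j\<in>{0..<k} - {r}. f t j (p j)))) (at t)"
      by (rule has_derivative_prod)
         (use assms that permutes_lt in \<open>auto simp: has_field_derivative_def\<close>)
    moreover have "(\<Prod>i = 0..<k. if i = r then f' i (p i) else f t i (p i)) =
        f' r (p r) * (\<Prod>j\<in>{0..<k} - {r}. f t j (p j))" if "r < k" for r
      using that by (subst prod.remove[of _ r]) (auto intro!: arg_cong2[where f = "(*)"] prod.cong)
    ultimately show ?thesis
      unfolding has_field_derivative_def
      by (elim has_derivative_eq_rhs) (auto simp: fun_eq_iff sum_distrib_left mult_ac atLeast0LessThan)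
  qed
  show ?thesis
    unfolding det_mat sum.swap[of _ _ "{..<k}"] sum_distrib_left[symmetric]
    by (intro DERIV_sum DERIV_cmult prod) auto
qed

text \<open>The row sets reached from \<open>I\<close> by moving one element by one step, which index the off-diagonal terms of the system of differential equations for the minors.\<close>

definition moves :: "nat \<Rightarrow> nat \<Rightarrow> nat set \<Rightarrow> (nat \<times> nat) set" where
  "moves n k I = {(r, l). r < k \<and> l < n \<and> l \<notin> I \<and> (l = Suc (pick I r) \<or> Suc l = pick I r)}"

definition move :: "nat set \<Rightarrow> nat \<times> nat \<Rightarrow> nat set" where
  "move I = (\<lambda>(r, l). insert l (I - {pick I r}))"

lemma finite_moves: "finite (moves n k I)"
  by (rule finite_subset[of _ "{..<k} \<times> {..<n}"]) (auto simp: moves_def)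

lemma ksetsD: "I \<in> ksets n k \<Longrightarrow> finite I" "I \<in> ksets n k \<Longrightarrow> card I = k"
  "I \<in> ksets n k \<Longrightarrow> r < k \<Longrightarrow> pick I r \<in> I" "I \<in> ksets n k \<Longrightarrow> r < k \<Longrightarrow> pick I r < n"
  using finite_subset pick_in_set_le[of r I] by auto

lemma ksets_pickE:
  assumes "I \<in> ksets n k" "i \<in> I" obtains r where "r < k" "pick I r = i"
proof -
  have "pick I ` {..<k} = I"
    using bij_betw_pick[OF ksetsD(1)[OF assms(1)]] ksetsD(2)[OF assms(1)] by (simp add: bij_betw_def)
  then obtain r where "r \<in> {..<k}" "i = pick I r" using assms(2) by (metis imageE)
  then show ?thesis by (intro that[of r]) auto
qed

lemma move_in_ksets:
  assumes "I \<in> ksets n k" "i \<in> I" "l < n" "l \<notin> I"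
  shows "insert l (I - {i}) \<in> ksets n k"
proof -
  have "finite I" using assms finite_subset by auto
  moreover from this have "card I > 0" using assms by (metis card_gt_0_iff empty_iff)
  ultimately have "card (insert l (I - {i})) = card I" using assms by simp
  then show ?thesis using assms by auto
qed

text \<open>A step to an adjacent free place overtakes no other element, so the order of the rows,
  and with it the sign of the minor, is kept. This is what makes the system for the minors
  cooperative.\<close>

lemma pick_move:
  assumes I: "I \<in> ksets n k" and e: "(r, l) \<in> moves n k I" and i: "i < k"
  shows "pick (move I (r, l)) i = (if i = r then l else pick I i)"
proof (rule pick_eqI[where k = k])
  have rl: "r < k" "l \<notin> I" "l = Suc (pick I r) \<or> Suc l = pick I r" using e by (auto simp: moves_def)
  have card: "card I = k" using I by auto
  fix i j assume ij: "i < j" "j < k"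
  have "pick I i < pick I j" using pick_strict_mono ij card by auto
  moreover have "pick I i \<noteq> l" "pick I j \<noteq> l" using rl ksetsD(3)[OF I] ij by (metis less_trans)+
  ultimately show "(if i = r then l else pick I i) < (if j = r then l else pick I j)"
    using rl ij by auto
next
  have r: "r < k" using e by (auto simp: moves_def)
  have b: "bij_betw (pick I) {..<k} I" using bij_betw_pick ksetsD[OF I] by metis
  have "pick I ` ({..<k} - {r}) = I - {pick I r}"
    using b r by (subst inj_on_image_set_diff[of _ "{..<k}"]) (auto simp: bij_betw_def)
  moreover have "(\<lambda>i. if i = r then l else pick I i) ` {..<k} = insert l (pick I ` ({..<k} - {r}))"
    using r by auto
  ultimately show "(\<lambda>i. if i = r then l else pick I i) ` {..<k} = move I (r, l)"
    by (simp add: move_def)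
qed (rule i)

text \<open>The determinant is differentiated row by row, and the new row \<open>r\<close> is
  expanded into the rows \<open>l\<close>. A row already present elsewhere in \<open>I\<close> gives
  0, a row not adjacent to \<open>pick I r\<close> has coefficient 0, and the diagonal and the moves
  remain. The coefficients form the additive compound of the Jacobi matrix.\<close>

lemma minor_deriv:
  assumes F: "\<And>i j. i < n \<Longrightarrow> j < k \<Longrightarrow>
      ((\<lambda>t. F t i j) has_real_derivative (\<Sum>l<n. jacobi a b i l * F t l j)) (at t)"
    and I: "I \<in> ksets n k"
  shows "((\<lambda>t. minor k (F t) I) has_real_derivative (\<Sum>r<k. b (pick I r)) * minor k (F t) I
     + (\<Sum>e\<in>moves n k I. jacobi a b (pick I (fst e)) (snd e) * minor k (F t) (move I e))) (at t)"
proof -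
  let ?D = "\<lambda>r l. det (mat k k (\<lambda>(i, j). if i = r then F t l j else F t (pick I i) j))"
  let ?m = "\<lambda>r l. jacobi a b (pick I r) l * minor k (F t) (move I (r, l))"
  have entry: "jacobi a b (pick I r) l * ?D r l = (if l = pick I r then b l * minor k (F t) I else 0)
      + (if (r, l) \<in> moves n k I then ?m r l else 0)" if r: "r < k" and l: "l < n" for r l
  proof -
    consider "l = pick I r" | "l \<in> I" "l \<noteq> pick I r" | "l \<notin> I" "(r, l) \<notin> moves n k I" | "(r, l) \<in> moves n k I" by blast
    then show ?thesis
    proof cases
      case 1
      then have "l \<in> I" using ksetsD(3)[OF I r] by simp
      moreover have "?D r l = minor k (F t) I" unfolding minor_def using 1 by (intro det_mat_cong) auto
      ultimately show ?thesis using 1 by (simp add: jacobi_def moves_def)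
    next
      case 2
      obtain s where s: "s < k" "pick I s = l" using ksets_pickE[OF I 2(1)] .
      have "?D r l = 0" by (rule det_mat_identical_rows[of r s]) (use s 2 r in auto)
      then show ?thesis using 2 by (simp add: moves_def)
    next
      case 3
      then have "l \<noteq> pick I r" using ksetsD(3)[OF I r] by auto
      then have "jacobi a b (pick I r) l = 0" using 3 r l by (auto simp: jacobi_def moves_def)
      then show ?thesis using 3 \<open>l \<noteq> pick I r\<close> by simp
    next
      case 4
      then have "l \<noteq> pick I r" by (auto simp: moves_def)
      moreover have "?D r l = minor k (F t) (move I (r, l))"
        unfolding minor_def using pick_move[OF I 4] by (intro det_mat_cong) auto
      ultimately show ?thesis using 4 by simp
    qed
  qed
  have "(\<Sum>r<k. det (mat k k (\<lambda>(i, j). if i = r then \<Sum>l<n. jacobi a b (pick I i) l * F t l j else F t (pick I i) j)))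
     = (\<Sum>r<k. det (mat k k (\<lambda>(i, j). if i = r then \<Sum>l<n. jacobi a b (pick I r) l * F t l j else F t (pick I i) j)))"
    by (intro sum.cong refl det_mat_cong) auto
  also have "\<dots> = (\<Sum>r<k. \<Sum>l<n. jacobi a b (pick I r) l * ?D r l)"
    by (intro sum.cong refl det_mat_row_sum) auto
  also have "\<dots> = (\<Sum>r<k. \<Sum>l<n. (if l = pick I r then b l * minor k (F t) I else 0)
      + (if (r, l) \<in> moves n k I then ?m r l else 0))"
    using entry by (intro sum.cong refl) auto
  also have "\<dots> = (\<Sum>r<k. b (pick I r)) * minor k (F t) I
      + (\<Sum>(r, l)\<in>{..<k} \<times> {..<n}. if (r, l) \<in> moves n k I then ?m r l else 0)"
    using ksetsD(4)[OF I] by (simp add: sum.distrib sum.cartesian_product sum_distrib_right)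
  also have "(\<Sum>(r, l)\<in>{..<k} \<times> {..<n}. if (r, l) \<in> moves n k I then ?m r l else 0) =
      (\<Sum>e\<in>moves n k I. jacobi a b (pick I (fst e)) (snd e) * minor k (F t) (move I e))"
    by (rule sum.mono_neutral_cong_right) (auto simp: moves_def split: if_splits)
  finally show ?thesis
    using det_mat_deriv[of k "\<lambda>t i j. F t (pick I i) j" "\<lambda>i j. \<Sum>l<n. jacobi a b (pick I i) l * F t l j" t]
      F ksetsD(4)[OF I] unfolding minor_def by simp
qed

text \<open>Induction on the sum of the elements. Unless \<open>I\<close> is an initial segment, it
  contains some \<open>Suc i\<close> without \<open>i\<close>, and moving that element down lowers
  the sum. The premise covers steps in both directions, so \<open>P\<close> is equivalent for the
  two sets.\<close>

lemma ksets_connected: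
  assumes P: "\<And>I i l. I \<in> ksets n k \<Longrightarrow> i \<in> I \<Longrightarrow> l \<notin> I \<Longrightarrow> l < n \<Longrightarrow> l = Suc i \<or> i = Suc l \<Longrightarrow>
      P (insert l (I - {i})) \<Longrightarrow> P I"
    and I: "I \<in> ksets n k" "P I" and J: "J \<in> ksets n k"
  shows "P J"
proof -
  have iff: "P I \<longleftrightarrow> P {..<k}" if "I \<in> ksets n k" for I
    using that
  proof (induction "\<Sum>I" arbitrary: I rule: less_induct)
    case less
    have fin: "finite I" and card: "card I = k" using ksetsD[OF less.prems] by auto
    show ?case
    proof (cases "\<exists>i. Suc i \<in> I \<and> i \<notin> I")
      case True
      then obtain i where i: "Suc i \<in> I" "i \<notin> I" by blast
      let ?J = "insert i (I - {Suc i})"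
      have "i < n" using i less.prems by auto
      have J: "?J \<in> ksets n k" by (rule move_in_ksets[OF less.prems i(1) \<open>i < n\<close> i(2)])
      have "\<Sum>I = Suc i + \<Sum>(I - {Suc i})" using fin i by (simp add: sum.remove)
      then have "\<Sum>?J < \<Sum>I" using fin i by simp
      then have "P ?J \<longleftrightarrow> P {..<k}" using less.hyps J by blast
      moreover have "insert (Suc i) (?J - {i}) = I" using i by auto
      then have "P I \<longleftrightarrow> P ?J"
        using P[OF less.prems i \<open>i < n\<close>] P[OF J, of i "Suc i"] i less.prems by auto
      ultimately show ?thesis by blast
    next
      case False
      have down: "y \<in> I" if "x \<in> I" "y \<le> x" for x y
        using that(2,1) False by (induction rule: inc_induct) auto
      have "I = {..<k}"
      proof (cases "I = {}")
        case False
        have "I = {..Max I}" using down[OF Max_in[OF fin False]] fin by auto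
        then have "I = {..<Suc (Max I)}" "card I = Suc (Max I)" by (simp_all add: lessThan_Suc_atMost) (metis card_atMost)
        then show ?thesis using card by simp
      qed (use card in auto)
      then show ?thesis by simp
    qed
  qed
  show ?thesis using iff[OF I(1)] iff[OF J] I(2) by blast
qed

theorem minor_flow_pos:
  assumes a: "\<And>i. a i > 0"
    and F: "\<And>i j t. i < n \<Longrightarrow> j < k \<Longrightarrow>
      ((\<lambda>t. F t i j) has_real_derivative (\<Sum>l<n. jacobi a b i l * F t l j)) (at t)"
    and init: "\<And>I. I \<in> ksets n k \<Longrightarrow> minor k (F 0) I \<ge> 0"
    and I0: "I0 \<in> ksets n k" "minor k (F 0) I0 > 0"
    and "I \<in> ksets n k" "t > 0"
  shows "minor k (F t) I > 0"
proof (rule metzler_pos[of "ksets n k" "moves n k" "\<lambda>I e. jacobi a b (pick I (fst e)) (snd e)" move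
      "\<lambda>I t. minor k (F t) I" "\<lambda>I. \<Sum>r<k. b (pick I r)" I0 I t])
  fix P assume P: "P I0" "\<And>I e. I \<in> ksets n k \<Longrightarrow> e \<in> moves n k I \<Longrightarrow> P (move I e) \<Longrightarrow> P I"
  show "\<forall>I\<in>ksets n k. P I"
  proof
    fix J assume J: "J \<in> ksets n k"
    show "P J"
    proof (rule ksets_connected[where I = I0 and n = n and k = k and P = P, OF _ I0(1) P(1) J])
      fix I i l assume *: "I \<in> ksets n k" "i \<in> I" "l \<notin> I" "l < n" "l = Suc i \<or> i = Suc l"
        "P (insert l (I - {i}))"
      obtain r where "r < k" "pick I r = i" using ksets_pickE[OF *(1,2)] .
      then have "(r, l) \<in> moves n k I" "move I (r, l) = insert l (I - {i})"
        using * by (auto simp: moves_def move_def)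
      then show "P I" using P(2)[OF *(1)] *(6) by metis
    qed
  qed
next
  fix I e assume I: "I \<in> ksets n k" "e \<in> moves n k I"
  then show "move I e \<in> ksets n k" using move_in_ksets[OF I(1)] ksetsD(3)[OF I(1)]
    by (auto simp: moves_def move_def)
  show "jacobi a b (pick I (fst e)) (snd e) > 0" using I a by (auto simp: moves_def jacobi_def)
qed (use assms finite_moves minor_deriv in auto)

section \<open>Sign of the minors of the eigenvectors\<close>

text \<open>The flow in spectral form: \<open>W\<close> holds the coordinates of the initial value
  in the eigenbasis \<open>U\<close>, and each is multiplied by the exponential of its eigenvalue
  times \<open>t\<close>.\<close>

lemma flow_deriv:
  fixes U :: "nat \<Rightarrow> nat \<Rightarrow> real"
  assumes eig: "\<And>i c. i < n \<Longrightarrow> c < n \<Longrightarrow> (\<Sum>j<n. jacobi a b i j * U j c) = \<mu> c * U i c"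
    and i: "i < n"
  shows "((\<lambda>t. \<Sum>l<n. U i l * (exp (t * \<mu> l) * W l j)) has_real_derivative
     (\<Sum>r<n. jacobi a b i r * (\<Sum>l<n. U r l * (exp (t * \<mu> l) * W l j)))) (at t)"
proof -
  have "((\<lambda>t. \<Sum>l<n. U i l * (exp (t * \<mu> l) * W l j)) has_real_derivative
     (\<Sum>l<n. U i l * (exp (t * \<mu> l) * \<mu> l * W l j))) (at t)"
    by (auto intro!: derivative_eq_intros sum.cong simp: mult_ac)
  moreover have "(\<Sum>r<n. jacobi a b i r * (\<Sum>l<n. U r l * (exp (t * \<mu> l) * W l j))) =
     (\<Sum>l<n. (\<Sum>r<n. jacobi a b i r * U r l) * (exp (t * \<mu> l) * W l j))"
    unfolding sum_distrib_left sum_distrib_right by (subst sum.swap) (simp add: mult_ac)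
  ultimately show ?thesis using eig[OF i] by (simp add: mult_ac)
qed

lemma det_mat_zero_row:
  assumes "r < k" "\<And>c. c < k \<Longrightarrow> f r c = 0"
  shows "det (mat k k (\<lambda>(i, j). f i j)) = 0"
proof -
  have "(\<Prod>i = 0..<k. f i (p i)) = 0" if "p permutes {0..<k}" for p
    using assms permutes_lt[OF that assms(1)] by (intro prod_zero bexI[of _ r]) auto
  then show ?thesis unfolding det_mat by (intro sum.neutral) auto
qed

text \<open>An increasing enumeration satisfies \<open>r \<le> pick I r\<close>, and
  \<open>\<mu>\<close> decreases. Hence \<open>{..<k}\<close> has the strictly largest exponent in
  the Cauchy-Binet expansion of the flow.\<close>

lemma sum_pick_less:
  fixes \<mu> :: "nat \<Rightarrow> real"
  assumes mono: "\<And>i j. i < j \<Longrightarrow> j < n \<Longrightarrow> \<mu> i > \<mu> j"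
    and I: "I \<in> ksets n k" "I \<noteq> {..<k}"
  shows "(\<Sum>r<k. \<mu> (pick I r)) < (\<Sum>r<k. \<mu> r)"
proof -
  have ge: "r \<le> pick I r" if "r < k" for r
    using that
  proof (induction r)
    case (Suc r)
    then show ?case using pick_strict_mono[of r "Suc r" I] I by auto
  qed simp
  have le: "\<mu> (pick I r) \<le> \<mu> r" if "r < k" for r
    using ge[OF that] mono[of r "pick I r"] ksetsD(4)[OF I(1) that] by (cases "pick I r = r") auto
  have "\<exists>r<k. pick I r \<noteq> r"
  proof (rule ccontr)
    assume *: "\<not> (\<exists>r<k. pick I r \<noteq> r)"
    have "pick I ` {..<k} = I"
      using bij_betw_pick[OF ksetsD(1)[OF I(1)]] ksetsD(2)[OF I(1)] by (simp add: bij_betw_def)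
    then show False using * I(2) by auto
  qed
  then obtain r where r: "r < k" "pick I r \<noteq> r" by blast
  then have "\<mu> (pick I r) < \<mu> r"
    using ge[of r] mono[of r "pick I r"] ksetsD(4)[OF I(1)] by auto
  then show ?thesis using le r by (intro sum_strict_mono_ex1) auto
qed

text \<open>Cauchy-Binet for the Gram matrix of the first \<open>k\<close> columns; it supplies a
  nonzero minor.\<close>

lemma sum_minor_sq:
  fixes U :: "nat \<Rightarrow> nat \<Rightarrow> real"
  assumes "k \<le> n"
    and orth: "\<And>i j. i < n \<Longrightarrow> j < n \<Longrightarrow> (\<Sum>r<n. U r i * U r j) = (if i = j then 1 else 0)"
  shows "(\<Sum>I\<in>ksets n k. minor k U I * minor k U I) = 1"
proof -
  have "det (mat k k (\<lambda>(i, j). \<Sum>l<n. U l i * U l j)) = det (mat k k (\<lambda>(i, j). if i = j then 1 else 0))"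
    by (rule det_mat_cong) (use assms in auto)
  then show ?thesis unfolding cauchy_binet det_mat_delta .
qed

text \<open>The flow starts at the unit vectors indexed by \<open>I0\<close>, whose minors are 1 at
  \<open>I0\<close> and 0 elsewhere, so its minor at \<open>I\<close> becomes positive. By
  Cauchy-Binet that minor is a sum of exponentials, and the product in question is the coefficient
  of the dominant one. Dividing by it and letting \<open>t\<close> grow gives the sign.\<close>

lemma perron_product_nonneg:
  fixes U :: "nat \<Rightarrow> nat \<Rightarrow> real"
  assumes a: "\<And>i. a i > 0"
    and mono: "\<And>i j. i < j \<Longrightarrow> j < n \<Longrightarrow> \<mu> i > \<mu> j"
    and rows: "\<And>i j. i < n \<Longrightarrow> j < n \<Longrightarrow> (\<Sum>r<n. U i r * U j r) = (if i = j then 1 else 0)"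
    and eig: "\<And>i c. i < n \<Longrightarrow> c < n \<Longrightarrow> (\<Sum>j<n. jacobi a b i j * U j c) = \<mu> c * U i c"
    and k: "k \<le> n" and I: "I \<in> ksets n k" and I0: "I0 \<in> ksets n k"
  shows "minor k U I * minor k U I0 \<ge> 0"
proof -
  \<comment> \<open>By row orthonormality, \<open>U\<close> times this matrix consists of the unit
    vectors indexed by \<open>I0\<close>.\<close>
  define W where "W = (\<lambda>l j. U (pick I0 j) l)"
  define F where "F t i j = (\<Sum>l<n. U i l * (exp (t * \<mu> l) * W l j))" for t i j
  have F0: "F 0 i j = (if i = pick I0 j then 1 else 0)" if "i < n" "j < k" for i j
    using rows[of i "pick I0 j"] that ksetsD(4)[OF I0] unfolding F_def W_def by simp
  have init: "minor k (F 0) I0 = 1"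
  proof -
    have "minor k (F 0) I0 = det (mat k k (\<lambda>(i, j). if i = j then 1 else 0))"
      unfolding minor_def using I0 ksetsD(4)[OF I0] by (intro det_mat_cong) (auto simp: F0 pick_inj_iff)
    then show ?thesis by (simp add: det_mat_delta)
  qed
  have zero: "minor k (F 0) J = 0" if J: "J \<in> ksets n k" "J \<noteq> I0" for J
  proof -
    have "\<not> J \<subseteq> I0" using J I0 card_subset_eq[of I0 J] ksetsD(1)[OF I0] by auto
    then obtain i where i: "i \<in> J" "i \<notin> I0" by blast
    obtain r where r: "r < k" "pick J r = i" using ksets_pickE[OF J(1) i(1)] .
    have "F 0 i j = 0" if "j < k" for j
    proof -
      have "i < n" using i J by auto
      moreover have "i \<noteq> pick I0 j" using ksetsD(3)[OF I0 that] i by auto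
      ultimately show ?thesis using F0[of i j] that by simp
    qed
    then show ?thesis unfolding minor_def using r by (intro det_mat_zero_row[of r]) auto
  qed
  have nonneg: "minor k (F t) I > 0" if "t > 0" for t
  proof (rule minor_flow_pos[where F = F and n = n and ?I0.0 = I0])
    show "((\<lambda>t. F t i j) has_real_derivative (\<Sum>l<n. jacobi a b i l * F t l j)) (at t)" if "i < n" for i j t
      unfolding F_def by (rule flow_deriv[OF eig that])
    show "minor k (F 0) J \<ge> 0" if "J \<in> ksets n k" for J
      using init zero[OF that] by (cases "J = I0") auto
  qed (use a init I I0 that in auto)
  define \<sigma> where "\<sigma> S = (\<Sum>r<k. \<mu> (pick S r))" for S
  let ?K = "{..<k}"
  let ?f = "\<lambda>S. minor k (\<lambda>l i. U (pick I i) l) S" and ?g = "\<lambda>S. minor k W S"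
  have K: "\<sigma> ?K = (\<Sum>r<k. \<mu> r)" unfolding \<sigma>_def by (simp add: pick_lessThan)
  have expand: "minor k (F t) I = (\<Sum>S\<in>ksets n k. ?f S * (exp (t * \<sigma> S) * ?g S))" for t
  proof -
    have "minor k (\<lambda>l j. exp (t * \<mu> l) * W l j) S = exp (t * \<sigma> S) * ?g S" for S
      unfolding minor_def det_mat_row_scale[of k "\<lambda>i. exp (t * \<mu> (pick S i))" "\<lambda>i. W (pick S i)"] \<sigma>_def
      by (simp add: exp_sum sum_distrib_left)
    then show ?thesis unfolding minor_def[of k "F t" I] F_def
      using cauchy_binet[where k = k and n = n and f = "\<lambda>l i. U (pick I i) l"
          and g = "\<lambda>l j. exp (t * \<mu> l) * W l j"] by simp
  qed
  have lim: "((\<lambda>t. exp (- t * \<sigma> ?K) * minor k (F t) I) \<longlongrightarrow> (\<Sum>S\<in>ksets n k. if S = ?K then ?f S * ?g S else 0)) at_top"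
  proof -
    have eq: "exp (- t * \<sigma> ?K) * minor k (F t) I = (\<Sum>S\<in>ksets n k. exp (t * (\<sigma> S - \<sigma> ?K)) * (?f S * ?g S))" for t
      unfolding expand sum_distrib_left by (intro sum.cong) (auto simp: exp_diff exp_minus field_simps)
    show ?thesis unfolding eq
    proof (rule tendsto_sum)
      fix S assume S: "S \<in> ksets n k"
      show "((\<lambda>t. exp (t * (\<sigma> S - \<sigma> ?K)) * (?f S * ?g S)) \<longlongrightarrow> (if S = ?K then ?f S * ?g S else 0)) at_top"
      proof (cases "S = ?K")
        case False
        then have neg: "\<sigma> S - \<sigma> ?K < 0"
          using sum_pick_less[where n = n and k = k and \<mu> = \<mu> and I = S] mono S unfolding K by (simp add: \<sigma>_def)
        have "filterlim (\<lambda>t. t * (\<sigma> S - \<sigma> ?K)) at_bot at_top"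
          using filterlim_tendsto_neg_mult_at_bot[OF tendsto_const neg filterlim_ident] by (simp add: mult.commute)
        then have "((\<lambda>t. exp (t * (\<sigma> S - \<sigma> ?K))) \<longlongrightarrow> 0) at_top"
          using filterlim_compose[OF exp_at_bot] by blast
        then show ?thesis using False tendsto_mult_left_zero by auto
      qed auto
    qed
  qed
  have "(\<Sum>S\<in>ksets n k. if S = ?K then ?f S * ?g S else 0) = ?f ?K * ?g ?K"
    using lessThan_in_ksets[OF k] by (simp add: sum.delta)
  moreover have "?f ?K = minor k U I"
    unfolding minor_lessThan by (simp only: minor_def det_mat_transpose[of k "\<lambda>i. U (pick I i)"])
  moreover have "?g ?K = minor k U I0"
    unfolding minor_lessThan W_def
    by (simp only: minor_def det_mat_transpose[of k "\<lambda>i. U (pick I0 i)"])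
  ultimately have "((\<lambda>t. exp (- t * \<sigma> ?K) * minor k (F t) I) \<longlongrightarrow> minor k U I * minor k U I0) at_top"
    using lim by simp
  then show ?thesis
    by (rule tendsto_lowerbound)
       (auto intro!: eventually_mono[OF eventually_gt_at_top[of 0]] mult_nonneg_nonneg less_imp_le[OF nonneg])
qed

text \<open>Since the products are nonnegative, each minor vanishes or has the sign of a fixed
  nonzero one. The flow only multiplies the minors of the first \<open>k\<close> eigenvectors by a
  positive number, yet it turns nonnegative minors into positive ones; so none of them was
  0.\<close>

theorem perron_minors:
  fixes U :: "nat \<Rightarrow> nat \<Rightarrow> real"
  assumes a: "\<And>i. a i > 0"
    and mono: "\<And>i j. i < j \<Longrightarrow> j < n \<Longrightarrow> \<mu> i > \<mu> j"
    and cols: "\<And>i j. i < n \<Longrightarrow> j < n \<Longrightarrow> (\<Sum>r<n. U r i * U r j) = (if i = j then 1 else 0)"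
    and rows: "\<And>i j. i < n \<Longrightarrow> j < n \<Longrightarrow> (\<Sum>r<n. U i r * U j r) = (if i = j then 1 else 0)"
    and eig: "\<And>i c. i < n \<Longrightarrow> c < n \<Longrightarrow> (\<Sum>j<n. jacobi a b i j * U j c) = \<mu> c * U i c"
    and k: "k \<le> n"
  obtains \<epsilon> :: real where "\<epsilon> = 1 \<or> \<epsilon> = - 1" "\<And>I. I \<in> ksets n k \<Longrightarrow> \<epsilon> * minor k U I > 0"
proof (cases "k = 0")
  case True
  show ?thesis by (rule that[of 1]) (simp_all add: True minor_def det_dim_zero[OF mat_carrier])
next
  case False
  obtain I0 where I0: "I0 \<in> ksets n k" "minor k U I0 \<noteq> 0"
    using sum_minor_sq[OF k cols] by (metis (no_types, lifting) mult_zero_left sum.neutral zero_neq_one)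
  define \<epsilon> where "\<epsilon> = sgn (minor k U I0)"
  have eps: "\<epsilon> = 1 \<or> \<epsilon> = - 1" using I0 unfolding \<epsilon>_def by (auto simp: sgn_if)
  have nonneg: "\<epsilon> * minor k U I \<ge> 0" if "I \<in> ksets n k" for I
    using perron_product_nonneg[OF a mono rows eig k that I0(1)] I0(2)
    unfolding \<epsilon>_def by (auto simp: sgn_if mult_le_0_iff zero_le_mult_iff)
  \<comment> \<open>The sign is carried by the first column, which needs \<open>k > 0\<close>; for
    \<open>k = 0\<close> the only minor is 1.\<close>
  define s where "s j = (if j = (0::nat) then \<epsilon> else 1)" for j
  have prod_s: "(\<Prod>j<k. s j) = \<epsilon>" using False by (cases k) (simp_all add: s_def prod.lessThan_Suc_shift del: prod.lessThan_Suc)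
  define F where "F t i j = (\<Sum>l<n. U i l * (exp (t * \<mu> l) * (if l = j then s j else 0)))" for t i j
  have F: "F t i j = (exp (t * \<mu> j) * s j) * U i j" if "j < k" for t i j
    using that k unfolding F_def by (simp add: if_distrib cong: if_cong)
  have mF: "minor k (F t) I = (\<Prod>j<k. exp (t * \<mu> j)) * (\<epsilon> * minor k U I)" for t I
  proof -
    have "minor k (F t) I = det (mat k k (\<lambda>(i, j). (exp (t * \<mu> j) * s j) * U (pick I i) j))"
      unfolding minor_def by (rule det_mat_cong) (simp add: F)
    then show ?thesis
      unfolding det_mat_col_scale[of k "\<lambda>j. exp (t * \<mu> j) * s j"] minor_def by (simp add: prod.distrib prod_s)
  qed
  have "minor k (F 1) I > 0" if "I \<in> ksets n k" for I
  proof (rule minor_flow_pos[where F = F and n = n and ?I0.0 = I0])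
    show "((\<lambda>t. F t i j) has_real_derivative (\<Sum>l<n. jacobi a b i l * F t l j)) (at t)" if "i < n" for i j t
      unfolding F_def by (rule flow_deriv[OF eig that])
    show "minor k (F 0) J \<ge> 0" if "J \<in> ksets n k" for J
      unfolding mF using nonneg[OF that] by simp
    show "minor k (F 0) I0 > 0" unfolding mF using I0 by (simp add: \<epsilon>_def sgn_if)
  qed (use a I0 that in auto)
  moreover have "(\<Prod>j<k. exp (1 * \<mu> j)) > 0" by (simp add: prod_pos)
  ultimately have "\<epsilon> * minor k U I > 0" if "I \<in> ksets n k" for I
    using that unfolding mF by (metis zero_less_mult_pos)
  then show ?thesis using eps that by blast
qed

section \<open>Jacobi matrices stabilizing a given kernel\<close>

lemma det_unit_last_row:
  fixes f :: "nat \<Rightarrow> nat \<Rightarrow> 'a::comm_ring_1"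
  assumes "j < Suc m"
  shows "det (mat (Suc m) (Suc m) (\<lambda>(r, c). if r < m then f r c else if c = j then 1 else 0)) =
    (-1) ^ (m + j) * det (mat m m (\<lambda>(r, c). f r (if c < j then c else Suc c)))"
proof -
  let ?A = "mat (Suc m) (Suc m) (\<lambda>(r, c). if r < m then f r c else if c = j then 1 else 0)"
  have "det ?A = (\<Sum>c<Suc m. ?A $$ (m, c) * cofactor ?A m c)"
    by (rule laplace_expansion_row) auto
  also have "\<dots> = (\<Sum>c<Suc m. if c = j then cofactor ?A m c else 0)"
    by (rule sum.cong) auto
  also have "\<dots> = cofactor ?A m j" using assms by simp
  also have "mat_delete ?A m j = mat m m (\<lambda>(r, c). f r (if c < j then c else Suc c))"
    using assms unfolding mat_delete_def by (intro eq_matI) auto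
  then have "cofactor ?A m j = (-1) ^ (m + j) * det (mat m m (\<lambda>(r, c). f r (if c < j then c else Suc c)))"
    unfolding cofactor_def by simp
  finally show ?thesis .
qed

text \<open>Here the cofactors of a matrix completed by unit rows meet the minors of
  \<open>z\<close>, whose positivity is the hypothesis on \<open>Z\<close>.\<close>

lemma minor_omit:
  fixes z :: "nat \<Rightarrow> nat \<Rightarrow> 'a::comm_ring_1"
  assumes "j < Suc m"
  shows "det (mat m m (\<lambda>(r, c). z r (if c < j then c else Suc c))) = minor m (\<lambda>i r. z r i) ({..<Suc m} - {j})"
proof -
  have im: "(\<lambda>c. if c < j then c else Suc c) ` {..<m} = {..<Suc m} - {j}"
  proof (intro equalityI subsetI)
    fix x assume x: "x \<in> {..<Suc m} - {j}"
    then have "x = (\<lambda>c. if c < j then c else Suc c) (if x < j then x else x - 1)" by auto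
    moreover have "(if x < j then x else x - 1) \<in> {..<m}" using x assms by auto
    ultimately show "x \<in> (\<lambda>c. if c < j then c else Suc c) ` {..<m}" by blast
  qed (use assms in auto)
  have "pick ({..<Suc m} - {j}) c = (if c < j then c else Suc c)" if "c < m" for c
    by (rule pick_eqI[where k = m, OF _ im that]) auto
  then have "det (mat m m (\<lambda>(r, c). z r (if c < j then c else Suc c))) =
      det (mat m m (\<lambda>(r, c). z r (pick ({..<Suc m} - {j}) c)))"
    by (intro det_mat_cong) simp
  then show ?thesis unfolding minor_def by (simp add: det_mat_transpose[of m "\<lambda>i r. z i (pick ({..<Suc m} - {j}) r)"])
qed

lemma minor_omit2:
  fixes z :: "nat \<Rightarrow> nat \<Rightarrow> 'a::comm_ring_1"
  assumes "i < j" "j < Suc (Suc m)"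
  shows "det (mat m m (\<lambda>(r, c). z r (if c < i then c else if Suc c < j then Suc c else Suc (Suc c)))) =
    minor m (\<lambda>i r. z r i) ({..<Suc (Suc m)} - {i, j})"
proof -
  let ?s = "\<lambda>c. if c < i then c else if Suc c < j then Suc c else Suc (Suc c)"
  have im: "?s ` {..<m} = {..<Suc (Suc m)} - {i, j}"
  proof (intro equalityI subsetI)
    fix x assume x: "x \<in> {..<Suc (Suc m)} - {i, j}"
    let ?c = "if x < i then x else if x < j then x - 1 else x - 2"
    have "x = ?s ?c" using x assms by auto
    moreover have "?c \<in> {..<m}" using x assms by auto
    ultimately show "x \<in> ?s ` {..<m}" by blast
  qed (use assms in \<open>auto split: if_splits\<close>)
  have "pick ({..<Suc (Suc m)} - {i, j}) c = ?s c" if "c < m" for c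
    by (rule pick_eqI[where k = m, OF _ im that]) (use assms in auto)
  then have "det (mat m m (\<lambda>(r, c). z r (?s c))) =
      det (mat m m (\<lambda>(r, c). z r (pick ({..<Suc (Suc m)} - {i, j}) c)))"
    by (intro det_mat_cong) simp
  then show ?thesis unfolding minor_def by (simp add: det_mat_transpose[of m "\<lambda>r c. z r (pick ({..<Suc (Suc m)} - {i, j}) c)"])
qed

lemma det_mat_2:
  fixes f :: "nat \<Rightarrow> nat \<Rightarrow> 'a::comm_ring_1"
  shows "det (mat 2 2 (\<lambda>(i, j). f i j)) = f 0 0 * f 1 1 - f 0 1 * f 1 0"
proof -
  have d1: "det (mat 1 1 h) = h (0, 0)" for h :: "nat \<times> nat \<Rightarrow> 'a"
    using det_single[of "mat 1 1 h"] by simp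
  let ?A = "mat 2 2 (\<lambda>(i, j). f i j)"
  have "mat_delete ?A 0 0 = mat 1 1 (\<lambda>_. f 1 1)" "mat_delete ?A 0 1 = mat 1 1 (\<lambda>_. f 1 0)"
    unfolding mat_delete_def by (auto intro!: eq_matI)
  moreover have "det ?A = (\<Sum>j<2. ?A $$ (0, j) * cofactor ?A 0 j)"
    by (rule laplace_expansion_row) auto
  ultimately show ?thesis
    by (simp add: numeral_2_eq_2 cofactor_def d1[unfolded One_nat_def])
qed

text \<open>Each row of the equation contains a diagonal entry of its own with nonzero coefficient
  \<open>f i\<close>, so all off-diagonal entries may be taken to be 1.\<close>

lemma jacobi_kernel_1:
  assumes f: "\<And>i. i < n \<Longrightarrow> f i > (0::real)"
  shows "\<exists>a b. (\<forall>i. a i > 0) \<and> (\<forall>i<n. (\<Sum>j<n. jacobi a b i j * f j) = 0)"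
proof -
  define b where "b i = - ((if i > 0 then f (i - 1) else 0) + (if Suc i < n then f (Suc i) else 0)) / f i" for i
  have "(\<Sum>j<n. jacobi (\<lambda>_. 1) b i j * f j) = 0" if "i < n" for i
    unfolding sum_jacobi[OF that] b_def using f[OF that] by (auto simp: field_simps)
  then show ?thesis by (intro exI[of _ "\<lambda>_. 1"] exI[of _ b]) simp
qed

text \<open>The first equation determines \<open>b\<close>. With it, \<open>f i\<close> times row
  \<open>i\<close> of the matrix applied to \<open>g\<close> is the difference of
  \<open>a i * (f i * g (Suc i) - f (Suc i) * g i)\<close> and the same term for
  \<open>i - 1\<close>. So the second equation says that this term is \<open>s i\<close>, minus a
  partial sum of \<open>f j * g j\<close>, which determines \<open>a i\<close>.\<close>

lemma jacobi_eigen_2: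
  fixes f g :: "nat \<Rightarrow> real"
  assumes f: "\<And>i. i < n \<Longrightarrow> f i > 0" and orth: "(\<Sum>i<n. f i * g i) = 0"
    and det: "\<And>i j. i < j \<Longrightarrow> j < n \<Longrightarrow> f i * g j - f j * g i > 0"
  obtains a b where "\<And>i. a i > 0" "\<And>i. i < n \<Longrightarrow> (\<Sum>j<n. jacobi a b i j * f j) = 0"
    "\<And>i. i < n \<Longrightarrow> (\<Sum>j<n. jacobi a b i j * g j) = - g i"
proof -
  define s where "s i = - (\<Sum>j<Suc i. f j * g j)" for i
  \<comment> \<open>The determinant condition says that \<open>g / f\<close> increases. If
    \<open>g i \<ge> 0\<close>, all later values of \<open>g\<close> are positive, and
    \<open>s i\<close> is the sum over the tail because the total is 0. Otherwise all values up to
    \<open>i\<close> are negative.\<close>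
  have s_pos: "s i > 0" if i: "Suc i < n" for i
  proof (cases "g i \<ge> 0")
    case True
    have "g j > 0" if "i < j" "j < n" for j
    proof -
      have "f j * g i \<ge> 0" using f[of j] True that by simp
      then have "f i * g j > 0" using det[OF that] by linarith
      then show ?thesis using f[of i] that by (simp add: zero_less_mult_iff)
    qed
    then have "(\<Sum>j\<in>{Suc i..<n}. f j * g j) > 0" using i f by (intro sum_pos) auto
    moreover have "(\<Sum>j<n. f j * g j) = (\<Sum>j<Suc i. f j * g j) + (\<Sum>j\<in>{Suc i..<n}. f j * g j)"
      using i sum.atLeastLessThan_concat[of 0 "Suc i" n "\<lambda>j. f j * g j"] by (simp add: atLeast0LessThan)
    ultimately show ?thesis using orth unfolding s_def by linarith
  next
    case False
    have "g j < 0" if "j \<le> i" for j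
    proof (cases "j = i")
      case F: False
      then have "f j * g i > f i * g j" using det[of j i] that i by simp
      moreover have "f j * g i < 0" using f[of j] False that i by (simp add: mult_less_0_iff)
      ultimately have "f i * g j < 0" by linarith
      then show ?thesis using f[of i] i by (simp add: mult_less_0_iff)
    qed (use False in auto)
    then have "f j * g j < 0" if "j < Suc i" for j using that f[of j] i by (simp add: mult_less_0_iff)
    then have "(\<Sum>j<Suc i. - (f j * g j)) > 0" by (intro sum_pos) auto
    then show ?thesis unfolding s_def sum_negf by simp
  qed
  define a where "a i = (if Suc i < n then s i / (f i * g (Suc i) - f (Suc i) * g i) else 1)" for i
  have a_pos: "a i > 0" for i unfolding a_def using s_pos det[of i "Suc i"] by simp
  define b where "b i = - ((if i > 0 then a (i - 1) * f (i - 1) else 0) + (if Suc i < n then a i * f (Suc i) else 0)) / f i" for i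
  have Af: "(\<Sum>j<n. jacobi a b i j * f j) = 0" if "i < n" for i
    unfolding sum_jacobi[OF that] b_def using f[OF that] by (auto simp: field_simps)
  have as: "a i * (f i * g (Suc i) - f (Suc i) * g i) = s i" if "Suc i < n" for i
    using det[of i "Suc i"] that unfolding a_def by simp
  have Ag: "(\<Sum>j<n. jacobi a b i j * g j) = - g i" if i: "i < n" for i
  proof -
    let ?p = "if i > 0 then a (i - 1) * (g (i - 1) * f i - f (i - 1) * g i) else 0"
    let ?q = "if Suc i < n then a i * (g (Suc i) * f i - f (Suc i) * g i) else 0"
    have "f i * (\<Sum>j<n. jacobi a b i j * g j) = ?p + ?q"
      unfolding sum_jacobi[OF i] b_def using f[OF i] by (auto simp: field_simps)
    moreover have "?p = (if i > 0 then - s (i - 1) else 0)"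
      using as[of "i - 1"] i by (auto simp: algebra_simps)
    \<comment> \<open>In the last row both sides are 0: there is no next neighbour, and
      orthogonality makes the full sum vanish.\<close>
    moreover have "?q = s i"
    proof (cases "Suc i < n")
      case False
      then have "n = Suc i" using i by simp
      then show ?thesis using orth unfolding s_def by simp
    qed (use as[of i] in \<open>simp add: algebra_simps\<close>)
    moreover have "(if i > 0 then - s (i - 1) else 0) + s i = - f i * g i"
      unfolding s_def by (cases i) auto
    ultimately have "f i * (\<Sum>j<n. jacobi a b i j * g j) = f i * (- g i)" by simp
    then show ?thesis using f[OF i] by (metis less_irrefl mult_left_cancel)
  qed
  show ?thesis by (rule that[OF a_pos Af Ag])
qed

text \<open>In the plane of \<open>y\<close> and \<open>y'\<close> one finds a positive
  \<open>f\<close> and a vector \<open>g\<close> orthogonal to it. The change of basis has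
  determinant \<open>D > 0\<close>, so the 2 by 2 minors of \<open>f\<close>, \<open>g\<close>
  inherit positivity.\<close>

lemma jacobi_plane:
  fixes y y' :: "nat \<Rightarrow> real"
  assumes n: "n \<ge> 2" and det: "\<And>i j. i < j \<Longrightarrow> j < n \<Longrightarrow> y i * y' j - y j * y' i > 0"
  shows "\<exists>a b f g. (\<forall>i. a i > 0) \<and> (\<forall>i<n. (\<Sum>j<n. jacobi a b i j * f j) = 0)
    \<and> (\<forall>i<n. (\<Sum>j<n. jacobi a b i j * g j) = - g i)
    \<and> (\<exists>p q. g = (\<lambda>i. p * y i + q * y' i))
    \<and> (\<exists>p q. y = (\<lambda>i. p * f i + q * g i)) \<and> (\<exists>p q. y' = (\<lambda>i. p * f i + q * g i))"
proof -
  define m where "m = n - 1"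
  have m: "0 < m" "m < n" using n by (auto simp: m_def)
  \<comment> \<open>With these coefficients \<open>f i\<close> is the minor on rows
    \<open>0, i\<close> plus the minor on rows \<open>i, m\<close>; both are nonnegative and at
    least one is positive.\<close>
  define p where "p = y' m - y' 0"
  define q where "q = y 0 - y m"
  define f where "f i = p * y i + q * y' i" for i
  \<comment> \<open>This is the minor on rows \<open>0, i\<close>: a second vector of the plane,
    still to be made orthogonal to \<open>f\<close>.\<close>
  define h where "h i = - y' 0 * y i + y 0 * y' i" for i
  define D where "D = y 0 * y' m - y m * y' 0"
  have D: "D > 0" using det[OF m] by (simp add: D_def)
  have f_eq: "f i = (y 0 * y' i - y i * y' 0) + (y i * y' m - y m * y' i)" for i
    unfolding f_def p_def q_def by (simp add: algebra_simps)
  have f: "f i > 0" if "i < n" for i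
  proof -
    have "i = 0 \<or> i = m \<or> (0 < i \<and> i < m)" using that by (auto simp: m_def)
    then show ?thesis using det[of 0 i] det[of i m] m D unfolding f_eq D_def by auto
  qed
  define c where "c = (\<Sum>i<n. f i * h i) / (\<Sum>i<n. f i * f i)"
  define g where "g i = h i - c * f i" for i
  have "(\<Sum>i<n. f i * f i) > 0" using f n by (intro sum_pos) (auto simp: lessThan_empty_iff)
  moreover have "(\<Sum>i<n. f i * g i) = (\<Sum>i<n. f i * h i) - c * (\<Sum>i<n. f i * f i)"
    unfolding g_def by (simp add: right_diff_distrib sum_subtractf sum_distrib_left mult_ac)
  ultimately have orth: "(\<Sum>i<n. f i * g i) = 0" by (simp add: c_def)
  have fg: "f i * g j - f j * g i = D * (y i * y' j - y j * y' i)" for i j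
    unfolding g_def f_def h_def p_def q_def D_def by (simp add: algebra_simps)
  have det': "f i * g j - f j * g i > 0" if "i < j" "j < n" for i j
    unfolding fg using D det[OF that] by simp
  obtain a b where ab: "\<And>i. a i > 0" "\<And>i. i < n \<Longrightarrow> (\<Sum>j<n. jacobi a b i j * f j) = 0"
    "\<And>i. i < n \<Longrightarrow> (\<Sum>j<n. jacobi a b i j * g j) = - g i"
    using jacobi_eigen_2[OF f orth det'] by blast
  have g_lin: "g = (\<lambda>i. (- y' 0 - c * p) * y i + (y 0 - c * q) * y' i)"
    by (simp add: g_def h_def f_def fun_eq_iff algebra_simps)
  have "D * y i = y 0 * f i - q * h i" "D * y' i = y' 0 * f i + p * h i" for i
    unfolding f_def h_def p_def q_def D_def by (simp_all add: algebra_simps)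
  then have yi: "y i = ((y 0 - q * c) / D) * f i + (- q / D) * g i"
    "y' i = ((y' 0 + p * c) / D) * f i + (p / D) * g i" for i
    using D by (simp_all add: g_def field_simps)
  have y_lin: "y = (\<lambda>i. ((y 0 - q * c) / D) * f i + (- q / D) * g i)"
    by (rule ext) (rule yi(1))
  have y'_lin: "y' = (\<lambda>i. ((y' 0 + p * c) / D) * f i + (p / D) * g i)"
    by (rule ext) (rule yi(2))
  show ?thesis
    by (intro exI[of _ a] exI[of _ b] exI[of _ f] exI[of _ g] conjI allI impI ab)
       (assumption | intro exI, rule g_lin y_lin y'_lin)+
qed

section \<open>Kernel bases and complementary minors\<close>

lemma mat_inverse_obtain:
  fixes A :: "'a::field mat"
  assumes A: "A \<in> carrier_mat n n" and det: "det A \<noteq> 0"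
  obtains B where "B \<in> carrier_mat n n" "A * B = 1\<^sub>m n" "B * A = 1\<^sub>m n"
proof -
  let ?B = "(1 / det A) \<cdot>\<^sub>m adj_mat A"
  have c: "?B \<in> carrier_mat n n" using adj_mat(1)[OF A] by simp
  have "A * ?B = 1\<^sub>m n"
    using adj_mat[OF A] A det
    by (simp add: mult_smult_distrib[OF A adj_mat(1)[OF A]]) (intro eq_matI, auto)
  moreover from mat_mult_left_right_inverse[OF A c this] have "?B * A = 1\<^sub>m n" .
  ultimately show ?thesis using c that by blast
qed

lemma det_unit_rows_first:
  fixes h :: "nat \<Rightarrow> nat \<Rightarrow> 'a::idom"
  shows "det (mat (l + d) (l + d) (\<lambda>(r, c). if r < l then if r = c then 1 else 0 else h r c)) =
    det (mat d d (\<lambda>(r, c). h (l + r) (l + c)))"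
proof -
  have "mat (l + d) (l + d) (\<lambda>(r, c). if r < l then if r = c then 1 else 0 else h r c) =
     four_block_mat (1\<^sub>m l) (0\<^sub>m l d) (mat d l (\<lambda>(r, c). h (l + r) c)) (mat d d (\<lambda>(r, c). h (l + r) (l + c)))"
    by (intro eq_matI) auto
  then show ?thesis
    by (simp add: det_four_block_mat_upper_right_zero[where n = l and m = d])
qed

text \<open>Jacobi's identity for complementary minors. Multiplication by \<open>H\<close> turns the
  rows of \<open>z\<close> into unit rows and the inserted unit rows into rows of \<open>H\<close>,
  so only a block in the last \<open>d\<close> columns of \<open>H\<close> survives in the
  determinant.\<close>

lemma complementary_minor:
  fixes z :: "nat \<Rightarrow> nat \<Rightarrow> 'a::idom"
  assumes H: "H \<in> carrier_mat (l + d) (l + d)"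
    and ZH: "\<And>r c. r < l \<Longrightarrow> c < l + d \<Longrightarrow> (\<Sum>x<l + d. z r x * H $$ (x, c)) = (if r = c then 1 else 0)"
    and i: "\<And>r. r < d \<Longrightarrow> i r < l + d"
  shows "det (mat (l + d) (l + d) (\<lambda>(r, c). if r < l then z r c else if c = i (r - l) then 1 else 0)) * det H =
    det (mat d d (\<lambda>(r, c). H $$ (i r, l + c)))"
proof -
  let ?N = "mat (l + d) (l + d) (\<lambda>(r, c). if r < l then z r c else if c = i (r - l) then 1 else 0)"
  have "?N * H = mat (l + d) (l + d) (\<lambda>(r, c). if r < l then if r = c then 1 else 0 else H $$ (i (r - l), c))"
    (is "_ = ?R")
  proof (rule eq_matI)
    fix r c assume "r < dim_row ?R" "c < dim_col ?R"
    then have rc: "r < l + d" "c < l + d" by auto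
    have e: "(?N * H) $$ (r, c) = (\<Sum>x<l + d. ?N $$ (r, x) * H $$ (x, c))"
      using rc H by (simp add: scalar_prod_def atLeast0LessThan)
    show "(?N * H) $$ (r, c) = ?R $$ (r, c)"
    proof (cases "r < l")
      case True
      then show ?thesis unfolding e using rc ZH[OF True rc(2)] by simp
    next
      case False
      have "(\<Sum>x<l + d. ?N $$ (r, x) * H $$ (x, c)) = (\<Sum>x<l + d. if x = i (r - l) then H $$ (i (r - l), c) else 0)"
        using rc False by (intro sum.cong) auto
      also have "\<dots> = H $$ (i (r - l), c)" using i[of "r - l"] rc False by simp
      finally show ?thesis unfolding e using rc False by simp
    qed
  qed (use H in auto)
  then have "det ?N * det H = det ?R" using det_mult[of ?N "l + d" H] H by simp
  then show ?thesis unfolding det_unit_rows_first by simp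
qed

text \<open>Alternating signs turn a Jacobi matrix into the negative of one, which carries the results over from \<open>Z\<close> to its kernel.\<close>

lemma jacobi_twist: "jacobi a (\<lambda>i. - b i) i j = - ((-1) ^ (i + j)) * jacobi a b i j"
  by (auto simp: jacobi_def)

lemma jacobi_twist_sum:
  "(\<Sum>j<n. jacobi a (\<lambda>i. - b i) i j * ((-1) ^ j * f j)) = - ((-1) ^ i) * (\<Sum>j<n. jacobi a b i j * f j)"
  unfolding sum_distrib_left
proof (rule sum.cong[OF refl])
  fix j
  have "(-1::real) ^ (i + j) * (-1) ^ j = (-1) ^ i"
    by (simp add: power_add mult.assoc flip: power_mult_distrib)
  then show "jacobi a (\<lambda>i. - b i) i j * ((-1) ^ j * f j) = - ((-1) ^ i) * (jacobi a b i j * f j)"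
    unfolding jacobi_twist by (metis (no_types, opaque_lifting) minus_mult_left mult.assoc mult.commute)
qed

text \<open>As the Jacobi matrix is symmetric, this amounts to invariance of the row space of
  \<open>z\<close>.\<close>

definition kernel_stable :: "nat \<Rightarrow> nat \<Rightarrow> (nat \<Rightarrow> nat \<Rightarrow> real) \<Rightarrow> (nat \<Rightarrow> real) \<Rightarrow> (nat \<Rightarrow> real) \<Rightarrow> bool" where
  "kernel_stable n l z a b \<longleftrightarrow> (\<forall>u. (\<forall>r<l. (\<Sum>i<n. z r i * u i) = 0) \<longrightarrow>
     (\<forall>r<l. (\<Sum>i<n. z r i * (\<Sum>j<n. jacobi a b i j * u j)) = 0))"

text \<open>The last \<open>d\<close> unit rows complete \<open>z\<close> to an invertible matrix,
  with inverse \<open>H\<close>. The last \<open>d\<close> columns of \<open>H\<close> then span the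
  kernel of \<open>z\<close>, and the coefficients of a kernel vector are its own last
  \<open>d\<close> entries.\<close>

lemma complement_basis:
  fixes z :: "nat \<Rightarrow> nat \<Rightarrow> real"
  assumes det: "det (mat (l + d) (l + d) (\<lambda>(r, c). if r < l then z r c else if c = r then 1 else 0)) > 0"
  shows "\<exists>H. H \<in> carrier_mat (l + d) (l + d) \<and> det H > 0 \<and>
    (\<forall>r<l. \<forall>c<l + d. (\<Sum>x<l + d. z r x * H $$ (x, c)) = (if r = c then 1 else 0)) \<and>
    (\<forall>u. (\<forall>r<l. (\<Sum>x<l + d. z r x * u x) = 0) \<longrightarrow>
       (\<forall>i<l + d. u i = (\<Sum>c<d. H $$ (i, l + c) * u (l + c))))"
proof -
  let ?n = "l + d"
  let ?G = "mat ?n ?n (\<lambda>(r, c). if r < l then z r c else if c = r then 1 else 0)"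
  have G: "?G \<in> carrier_mat ?n ?n" by simp
  obtain H where H: "H \<in> carrier_mat ?n ?n" "?G * H = 1\<^sub>m ?n" "H * ?G = 1\<^sub>m ?n"
    using mat_inverse_obtain[OF G] det by auto
  have "det ?G * det H = 1" using det_mult[OF G H(1)] H(2) by simp
  then have detH: "det H > 0" using zero_less_mult_pos[of "det ?G" "det H"] det by simp
  have ZH: "(\<Sum>x<?n. z r x * H $$ (x, c)) = (if r = c then 1 else 0)" if rc: "r < l" "c < ?n" for r c
  proof -
    have "(?G * H) $$ (r, c) = (\<Sum>x<?n. ?G $$ (r, x) * H $$ (x, c))"
      using rc H(1) by (simp add: scalar_prod_def atLeast0LessThan)
    also have "\<dots> = (\<Sum>x<?n. z r x * H $$ (x, c))" using rc by (intro sum.cong) auto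
    finally show ?thesis using H(2) rc by simp
  qed
  have ker: "u i = (\<Sum>c<d. H $$ (i, l + c) * u (l + c))"
    if u: "\<And>r. r < l \<Longrightarrow> (\<Sum>x<?n. z r x * u x) = 0" and i: "i < ?n" for u i
  proof -
    have Gu: "(\<Sum>x<?n. ?G $$ (r, x) * u x) = (if r < l then 0 else u r)" if r: "r < ?n" for r
    proof (cases "r < l")
      case False
      have "(\<Sum>x<?n. ?G $$ (r, x) * u x) = (\<Sum>x<?n. if x = r then u r else 0)"
        using r False by (intro sum.cong) auto
      then show ?thesis using r False by simp
    qed (use u r in auto)
    have "(\<Sum>x<?n. (H * ?G) $$ (i, x) * u x) = (\<Sum>x<?n. if x = i then u i else 0)"
      unfolding H(3) using i by (intro sum.cong) auto
    then have "u i = (\<Sum>x<?n. (H * ?G) $$ (i, x) * u x)" using i by simp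
    also have "\<dots> = (\<Sum>x<?n. (\<Sum>r<?n. H $$ (i, r) * ?G $$ (r, x)) * u x)"
      using i H(1) by (intro sum.cong) (auto simp: scalar_prod_def atLeast0LessThan)
    also have "\<dots> = (\<Sum>r<?n. H $$ (i, r) * (\<Sum>x<?n. ?G $$ (r, x) * u x))"
      unfolding sum_distrib_right sum_distrib_left by (subst sum.swap) (simp only: mult.assoc)
    also have "\<dots> = (\<Sum>r<?n. H $$ (i, r) * (if r < l then 0 else u r))"
      by (rule sum.cong) (simp_all only: Gu lessThan_iff)
    also have "\<dots> = (\<Sum>r\<in>{l..<l + d}. H $$ (i, r) * u r)"
      by (rule sum.mono_neutral_cong_right) auto
    also have "\<dots> = (\<Sum>c<d. H $$ (i, l + c) * u (l + c))"
      by (rule sum.reindex_bij_witness[where i = "\<lambda>c. l + c" and j = "\<lambda>r. r - l"]) auto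
    finally show ?thesis .
  qed
  show ?thesis using H(1) detH ZH ker by blast
qed

text \<open>The kernel is a line spanned by a vector of cofactors, that is, of maximal minors of
  \<open>z\<close> with alternating signs. Stripped of the signs it is positive, hence killed by
  some Jacobi matrix; restoring the signs replaces \<open>b\<close> by its negative.\<close>

lemma kernel_stable_codim_1:
  fixes z :: "nat \<Rightarrow> nat \<Rightarrow> real"
  assumes pos: "\<And>J. J \<in> ksets (Suc l) l \<Longrightarrow> minor l (\<lambda>i r. z r i) J > 0"
  obtains a b where "\<And>i. a i > 0" "kernel_stable (Suc l) l z a b"
proof -
  let ?N = "\<lambda>i. mat (l + 1) (l + 1) (\<lambda>(r, c). if r < l then z r c else if c = i (r - l) then 1 else 0)"
  define m where "m i = minor l (\<lambda>i r. z r i) ({..<Suc l} - {i})" for i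
  have m: "m i > 0" if "i < Suc l" for i unfolding m_def using that by (intro pos) auto
  have N: "det (?N i) = (-1) ^ (l + i 0) * m (i 0)" if "i 0 < Suc l" for i
  proof -
    have "det (?N i) = det (mat (Suc l) (Suc l) (\<lambda>(r, c). if r < l then z r c else if c = i 0 then 1 else 0))"
      unfolding Suc_eq_plus1[symmetric] by (rule det_mat_cong) (auto simp: less_Suc_eq)
    then show ?thesis unfolding det_unit_last_row[OF that] minor_omit[OF that] m_def .
  qed
  \<comment> \<open>For the last unit row the cofactor sign is \<open>(-1) ^ (l + l)\<close>, so the
    completed matrix has positive determinant.\<close>
  have "det (mat (l + 1) (l + 1) (\<lambda>(r, c). if r < l then z r c else if c = r then 1 else 0)) = det (?N (\<lambda>_. l))"
    by (rule det_mat_cong) auto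
  also have "\<dots> > 0" using N[of "\<lambda>_. l"] m[of l] by (simp add: power_add flip: power_mult_distrib)
  finally have "\<exists>H. H \<in> carrier_mat (l + 1) (l + 1) \<and> det H > 0 \<and>
      (\<forall>r<l. \<forall>c<l + 1. (\<Sum>x<l + 1. z r x * H $$ (x, c)) = (if r = c then 1 else 0)) \<and>
      (\<forall>u. (\<forall>r<l. (\<Sum>x<l + 1. z r x * u x) = 0) \<longrightarrow>
         (\<forall>i<l + 1. u i = (\<Sum>c<1. H $$ (i, l + c) * u (l + c))))"
    by (rule complement_basis)
  then obtain H where H': "H \<in> carrier_mat (l + 1) (l + 1) \<and> det H > 0 \<and>
      (\<forall>r<l. \<forall>c<l + 1. (\<Sum>x<l + 1. z r x * H $$ (x, c)) = (if r = c then 1 else 0)) \<and>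
      (\<forall>u. (\<forall>r<l. (\<Sum>x<l + 1. z r x * u x) = 0) \<longrightarrow>
         (\<forall>i<l + 1. u i = (\<Sum>c<1. H $$ (i, l + c) * u (l + c))))"
    by (elim exE)
  then have H: "H \<in> carrier_mat (l + 1) (l + 1)" "det H > 0"
      "\<And>r c. r < l \<Longrightarrow> c < l + 1 \<Longrightarrow> (\<Sum>x<l + 1. z r x * H $$ (x, c)) = (if r = c then 1 else 0)"
      "\<And>u i. (\<And>r. r < l \<Longrightarrow> (\<Sum>x<l + 1. z r x * u x) = 0) \<Longrightarrow> i < l + 1 \<Longrightarrow>
         u i = (\<Sum>c<1. H $$ (i, l + c) * u (l + c))"
    by blast+
  define f where "f i = m i * det H" for i
  have f: "f i > 0" if "i < Suc l" for i using m[OF that] H(2) by (simp add: f_def)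
  have y: "H $$ (i, l) = (-1) ^ l * ((-1) ^ i * f i)" if "i < Suc l" for i
  proof -
    have "det (?N (\<lambda>_. i)) * det H = H $$ (i, l)"
      using complementary_minor[OF H(1,3), of "\<lambda>_. i"] that
      by (simp add: det_single[of "mat (Suc 0) (Suc 0) _"])
    then show ?thesis using N[of "\<lambda>_. i"] that by (simp add: f_def power_add)
  qed
  obtain a b where ab: "\<And>i. a i > 0" "\<And>i. i < Suc l \<Longrightarrow> (\<Sum>j<Suc l. jacobi a b i j * f j) = 0"
    using jacobi_kernel_1[of "Suc l" f] f by metis
  have "kernel_stable (Suc l) l z a (\<lambda>i. - b i)"
    unfolding kernel_stable_def
  proof (intro allI impI)
    fix u r assume u: "\<forall>r<l. (\<Sum>i<Suc l. z r i * u i) = 0" and r: "r < l"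
    define c where "c = (-1) ^ l * u l"
    have ui: "u j = c * ((-1) ^ j * f j)" if "j < Suc l" for j
    proof -
      have "u j = (\<Sum>x<1. H $$ (j, l + x) * u (l + x))" by (rule H(4)) (use u that in auto)
      then show ?thesis using y[OF that] by (simp add: c_def)
    qed
    have "(\<Sum>j<Suc l. jacobi a (\<lambda>i. - b i) i j * u j) = 0" if "i < Suc l" for i
    proof -
      have "(\<Sum>j<Suc l. jacobi a (\<lambda>i. - b i) i j * u j) =
        c * (\<Sum>j<Suc l. jacobi a (\<lambda>i. - b i) i j * ((-1) ^ j * f j))"
        unfolding sum_distrib_left using ui by (intro sum.cong refl) (simp add: mult_ac)
      then show ?thesis unfolding jacobi_twist_sum ab(2)[OF that] by simp
    qed
    then show "(\<Sum>i<Suc l. z r i * (\<Sum>j<Suc l. jacobi a (\<lambda>i. - b i) i j * u j)) = 0"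
      by (intro sum.neutral) (simp del: sum.lessThan_Suc)
  qed
  then show ?thesis using that ab(1) by blast
qed

text \<open>The 2 by 2 minors of a basis of the kernel are complementary minors of \<open>z\<close>
  up to positive factors and signs. After a correction of the signs, the kernel is a plane to which
  \<open>jacobi_plane\<close> applies.\<close>

lemma kernel_stable_codim_2:
  fixes z :: "nat \<Rightarrow> nat \<Rightarrow> real"
  assumes pos: "\<And>J. J \<in> ksets (l + 2) l \<Longrightarrow> minor l (\<lambda>i r. z r i) J > 0"
  obtains a b where "\<And>i. a i > 0" "kernel_stable (l + 2) l z a b"
proof -
  let ?n = "l + 2"
  let ?N = "\<lambda>i. mat ?n ?n (\<lambda>(r, c). if r < l then z r c else if c = i (r - l) then 1 else 0)"
  define m where "m i j = minor l (\<lambda>i r. z r i) ({..<Suc (Suc l)} - {i, j})" for i j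
  have m: "m i j > 0" if "i < j" "j < ?n" for i j
    unfolding m_def using that by (intro pos) (auto simp: card_Diff_subset)
  have N: "det (?N i) = - ((-1) ^ (i 0 + i 1)) * m (i 0) (i 1)" if i: "i 0 < i 1" "i 1 < ?n" for i
  proof -
    let ?s = "\<lambda>c. if c < i 1 then c else Suc c" and ?t = "\<lambda>c. if c < i 0 then c else Suc c"
    let ?f = "\<lambda>r c. if r < l then z r c else if c = i 0 then 1 else 0"
    have "det (?N i) = det (mat (Suc (Suc l)) (Suc (Suc l)) (\<lambda>(r, c). if r < Suc l then ?f r c else if c = i 1 then 1 else 0))"
      unfolding add_2_eq_Suc'
    proof (rule det_mat_cong)
      fix r c assume "r < Suc (Suc l)"
      then consider "r < l" | "r = l" | "r = Suc l" by linarith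
      then show "(if r < l then z r c else if c = i (r - l) then 1 else 0) =
        (if r < Suc l then ?f r c else if c = i 1 then 1 else 0)" by cases auto
    qed
    also have "\<dots> = (-1) ^ (Suc l + i 1) * det (mat (Suc l) (Suc l) (\<lambda>(r, c). ?f r (?s c)))"
      by (rule det_unit_last_row) (use i in auto)
    also have "det (mat (Suc l) (Suc l) (\<lambda>(r, c). ?f r (?s c))) =
        det (mat (Suc l) (Suc l) (\<lambda>(r, c). if r < l then z r (?s c) else if c = i 0 then 1 else 0))"
      by (rule det_mat_cong) (use i in auto)
    also have "\<dots> = (-1) ^ (l + i 0) * det (mat l l (\<lambda>(r, c). z r (?s (?t c))))"
      by (rule det_unit_last_row) (use i in auto)
    also have "det (mat l l (\<lambda>(r, c). z r (?s (?t c)))) =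
        det (mat l l (\<lambda>(r, c). z r (if c < i 0 then c else if Suc c < i 1 then Suc c else Suc (Suc c))))"
      by (intro det_mat_cong arg_cong2[where f = z]) (use i in auto)
    also have "\<dots> = m (i 0) (i 1)" unfolding m_def by (rule minor_omit2) (use i in auto)
    finally show ?thesis by (simp add: power_add mult_ac flip: power_mult_distrib)
  qed
  \<comment> \<open>The last two unit rows give the sign \<open>- ((-1) ^ (l + Suc l))\<close>,
    which is 1.\<close>
  have "det (mat ?n ?n (\<lambda>(r, c). if r < l then z r c else if c = r then 1 else 0)) = det (?N (\<lambda>r. l + r))"
    by (rule det_mat_cong) auto
  also have "\<dots> > 0"
    using N[of "\<lambda>r. l + r"] m[of l "Suc l"] by (simp add: power_add flip: power_mult_distrib)
  finally have "\<exists>H. H \<in> carrier_mat ?n ?n \<and> det H > 0 \<and>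
      (\<forall>r<l. \<forall>c<?n. (\<Sum>x<?n. z r x * H $$ (x, c)) = (if r = c then 1 else 0)) \<and>
      (\<forall>u. (\<forall>r<l. (\<Sum>x<?n. z r x * u x) = 0) \<longrightarrow>
         (\<forall>i<?n. u i = (\<Sum>c<2. H $$ (i, l + c) * u (l + c))))"
    by (rule complement_basis)
  then obtain H where H': "H \<in> carrier_mat ?n ?n \<and> det H > 0 \<and>
      (\<forall>r<l. \<forall>c<?n. (\<Sum>x<?n. z r x * H $$ (x, c)) = (if r = c then 1 else 0)) \<and>
      (\<forall>u. (\<forall>r<l. (\<Sum>x<?n. z r x * u x) = 0) \<longrightarrow>
         (\<forall>i<?n. u i = (\<Sum>c<2. H $$ (i, l + c) * u (l + c))))"
    by (elim exE)
  then have H: "H \<in> carrier_mat ?n ?n" "det H > 0"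
      "\<And>r c. r < l \<Longrightarrow> c < ?n \<Longrightarrow> (\<Sum>x<?n. z r x * H $$ (x, c)) = (if r = c then 1 else 0)"
      "\<And>u i. (\<And>r. r < l \<Longrightarrow> (\<Sum>x<?n. z r x * u x) = 0) \<Longrightarrow> i < ?n \<Longrightarrow>
         u i = (\<Sum>c<2. H $$ (i, l + c) * u (l + c))"
    by blast+
  define y where "y i = H $$ (i, l)" for i
  define y' where "y' i = H $$ (i, Suc l)" for i
  have yy: "y i * y' j - y' i * y j = - ((-1) ^ (i + j)) * (m i j * det H)" if ij: "i < j" "j < ?n" for i j
  proof -
    let ?i = "\<lambda>r. if r = 0 then i else j"
    have "det (?N ?i) * det H = det (mat 2 2 (\<lambda>(r, c). H $$ (?i r, l + c)))"
      by (rule complementary_minor[OF H(1,3)]) (use ij in auto)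
    also have "\<dots> = y i * y' j - y' i * y j" unfolding det_mat_2 by (simp add: y_def y'_def)
    finally show ?thesis using N[of ?i] ij by simp
  qed
  \<comment> \<open>The alternating factors remove the sign \<open>(-1) ^ (i + j)\<close> in
    \<open>yy\<close>, and exchanging the two vectors removes the remaining minus.\<close>
  define Y where "Y i = (-1) ^ i * y' i" for i
  define Y' where "Y' i = (-1) ^ i * y i" for i
  have YY: "Y i * Y' j - Y j * Y' i > 0" if ij: "i < j" "j < ?n" for i j
  proof -
    have "Y i * Y' j - Y j * Y' i = - ((-1) ^ (i + j)) * (y i * y' j - y' i * y j)"
      by (simp add: Y_def Y'_def power_add algebra_simps)
    also have "\<dots> = m i j * det H"
    proof -
      have "(-1::real) ^ (i + j) * (-1) ^ (i + j) = 1" by (simp flip: power_mult_distrib)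
      then have "- ((-1) ^ (i + j)) * (- ((-1) ^ (i + j)) * x) = x" for x :: real
        by (metis minus_mult_minus mult.assoc mult_1)
      then show ?thesis unfolding yy[OF ij] .
    qed
    finally show ?thesis using m[OF ij] H(2) by simp
  qed
  have "2 \<le> ?n" by simp
  then have "\<exists>a b f g. (\<forall>i. a i > 0) \<and> (\<forall>i<?n. (\<Sum>j<?n. jacobi a b i j * f j) = 0)
    \<and> (\<forall>i<?n. (\<Sum>j<?n. jacobi a b i j * g j) = - g i)
    \<and> (\<exists>p q. g = (\<lambda>i. p * Y i + q * Y' i))
    \<and> (\<exists>p q. Y = (\<lambda>i. p * f i + q * g i)) \<and> (\<exists>p q. Y' = (\<lambda>i. p * f i + q * g i))"
    using YY by (rule jacobi_plane)
  then obtain a b f g where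
    "(\<forall>i. a i > 0) \<and> (\<forall>i<?n. (\<Sum>j<?n. jacobi a b i j * f j) = 0)
    \<and> (\<forall>i<?n. (\<Sum>j<?n. jacobi a b i j * g j) = - g i)
    \<and> (\<exists>p q. g = (\<lambda>i. p * Y i + q * Y' i))
    \<and> (\<exists>p q. Y = (\<lambda>i. p * f i + q * g i)) \<and> (\<exists>p q. Y' = (\<lambda>i. p * f i + q * g i))"
    by (elim exE)
  then have ab: "\<And>i. a i > 0"
    and f: "\<And>i. i < ?n \<Longrightarrow> (\<Sum>j<?n. jacobi a b i j * f j) = 0"
    and g: "\<And>i. i < ?n \<Longrightarrow> (\<Sum>j<?n. jacobi a b i j * g j) = - g i"
    and gY: "\<exists>p q. g = (\<lambda>i. p * Y i + q * Y' i)"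
    and Yf0: "\<exists>p q. Y = (\<lambda>i. p * f i + q * g i)" "\<exists>p q. Y' = (\<lambda>i. p * f i + q * g i)"
    by blast+
  from Yf0 obtain p q p' q' where Yf: "Y = (\<lambda>i. p * f i + q * g i)" "Y' = (\<lambda>i. p' * f i + q' * g i)"
    by (elim exE)
  have zy: "(\<Sum>x<?n. z r x * y x) = 0" "(\<Sum>x<?n. z r x * y' x) = 0" if "r < l" for r
    using H(3)[OF that, of l] H(3)[OF that, of "Suc l"] that by (auto simp: y_def y'_def)
  obtain p'' q'' where g_eq: "\<And>i. g i = p'' * Y i + q'' * Y' i" using gY by metis
  have tw: "(-1) ^ i * ((-1) ^ i * x) = (x::real)" for i x by (simp flip: mult.assoc power_mult_distrib)
  have "kernel_stable ?n l z a (\<lambda>i. - b i)"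
    unfolding kernel_stable_def
  proof (intro allI impI)
    fix u r assume u: "\<forall>r<l. (\<Sum>i<?n. z r i * u i) = 0" and r: "r < l"
    define \<alpha> where "\<alpha> = p' * u l + p * u (Suc l)"
    define \<beta> where "\<beta> = q' * u l + q * u (Suc l)"
    have ui: "u j = (-1) ^ j * (\<alpha> * f j + \<beta> * g j)" if "j < ?n" for j
    proof -
      have "u j = y j * u l + y' j * u (Suc l)"
        using H(4)[of u j] u that by (simp add: numeral_2_eq_2 y_def y'_def)
      also have "\<dots> = (-1) ^ j * (Y' j * u l + Y j * u (Suc l))"
        unfolding Y_def Y'_def by (simp add: distrib_left mult.assoc tw)
      also have "Y' j * u l + Y j * u (Suc l) = \<alpha> * f j + \<beta> * g j"
        unfolding Yf \<alpha>_def \<beta>_def by (simp add: algebra_simps)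
      finally show ?thesis .
    qed
    have Au: "(\<Sum>j<?n. jacobi a (\<lambda>i. - b i) i j * u j) = (-1) ^ i * (\<beta> * g i)" if i: "i < ?n" for i
    proof -
      have "(\<Sum>j<?n. jacobi a (\<lambda>i. - b i) i j * u j) =
          (\<Sum>j<?n. jacobi a (\<lambda>i. - b i) i j * ((-1) ^ j * (\<alpha> * f j + \<beta> * g j)))"
        using ui by (intro sum.cong refl) simp
      also have "\<dots> = - ((-1) ^ i) * (\<Sum>j<?n. \<alpha> * (jacobi a b i j * f j) + \<beta> * (jacobi a b i j * g j))"
        unfolding jacobi_twist_sum by (simp add: algebra_simps)
      also have "\<dots> = (-1) ^ i * (\<beta> * g i)"
        unfolding sum.distrib sum_distrib_left[symmetric] f[OF i] g[OF i] by simp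
      finally show ?thesis .
    qed
    have "(\<Sum>i<?n. z r i * (\<Sum>j<?n. jacobi a (\<lambda>i. - b i) i j * u j)) =
        (\<Sum>i<?n. \<beta> * p'' * (z r i * y' i) + \<beta> * q'' * (z r i * y i))"
    proof (rule sum.cong[OF refl])
      fix i assume "i \<in> {..<?n}"
      then have "(\<Sum>j<?n. jacobi a (\<lambda>i. - b i) i j * u j) = (-1) ^ i * (\<beta> * g i)" using Au by simp
      also have "\<dots> = \<beta> * p'' * ((-1) ^ i * Y i) + \<beta> * q'' * ((-1) ^ i * Y' i)"
        unfolding g_eq by (simp add: algebra_simps)
      also have "\<dots> = \<beta> * p'' * y' i + \<beta> * q'' * y i" unfolding Y_def Y'_def tw ..
      finally show "z r i * (\<Sum>j<?n. jacobi a (\<lambda>i. - b i) i j * u j) =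
        \<beta> * p'' * (z r i * y' i) + \<beta> * q'' * (z r i * y i)" by (simp add: algebra_simps)
    qed
    also have "\<dots> = 0" unfolding sum.distrib sum_distrib_left[symmetric] zy[OF r] by simp
    finally show "(\<Sum>i<?n. z r i * (\<Sum>j<?n. jacobi a (\<lambda>i. - b i) i j * u j)) = 0" .
  qed
  then show ?thesis using that ab by blast
qed

text \<open>The matrix is built from the row space if \<open>l\<close> is 1 or 2, and from the
  kernel if that has dimension 1 or 2. For \<open>l = 0\<close> and \<open>n = l\<close> every
  Jacobi matrix serves.\<close>

theorem kernel_stable_jacobi:
  fixes z :: "nat \<Rightarrow> nat \<Rightarrow> real"
  assumes pos: "\<And>J. J \<in> ksets n l \<Longrightarrow> minor l (\<lambda>i r. z r i) J > 0"
    and l: "l \<le> n" and small: "l \<le> 2 \<or> n - l \<le> 2"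
  obtains a b where "\<And>i. a i > 0" "kernel_stable n l z a b"
proof -
  consider "l = 0" | "n = l" | "n = Suc l" | "n = l + 2" | "l = 1" | "l = 2" "n \<ge> 2"
    using l small by linarith
  then show ?thesis
  proof cases
    case 1
    then show ?thesis using that[of "\<lambda>_. 1"] by (simp add: kernel_stable_def)
  next
    case 2
    have "det (mat (l + 0) (l + 0) (\<lambda>(r, c). if r < l then z r c else if c = r then 1 else 0)) =
        det (mat l l (\<lambda>(r, c). z r c))"
      unfolding add_0_right by (rule det_mat_cong) auto
    also have "\<dots> = minor l (\<lambda>i r. z r i) {..<l}" unfolding minor_lessThan by (rule det_mat_transpose[symmetric])
    also have "\<dots> > 0" using pos 2 by auto
    finally have "\<exists>H. H \<in> carrier_mat (l + 0) (l + 0) \<and> det H > 0 \<and>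
      (\<forall>r<l. \<forall>c<l + 0. (\<Sum>x<l + 0. z r x * H $$ (x, c)) = (if r = c then 1 else 0)) \<and>
      (\<forall>u. (\<forall>r<l. (\<Sum>x<l + 0. z r x * u x) = 0) \<longrightarrow>
         (\<forall>i<l + 0. u i = (\<Sum>c<0. H $$ (i, l + c) * u (l + c))))"
      by (rule complement_basis)
    then obtain H where H': "H \<in> carrier_mat (l + 0) (l + 0) \<and> det H > 0 \<and>
      (\<forall>r<l. \<forall>c<l + 0. (\<Sum>x<l + 0. z r x * H $$ (x, c)) = (if r = c then 1 else 0)) \<and>
      (\<forall>u. (\<forall>r<l. (\<Sum>x<l + 0. z r x * u x) = 0) \<longrightarrow>
         (\<forall>i<l + 0. u i = (\<Sum>c<0. H $$ (i, l + c) * u (l + c))))"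
      by (elim exE)
    then have H: "H \<in> carrier_mat (l + 0) (l + 0)" "det H > 0"
      "\<And>r c. r < l \<Longrightarrow> c < l + 0 \<Longrightarrow> (\<Sum>x<l + 0. z r x * H $$ (x, c)) = (if r = c then 1 else 0)"
      "\<And>u i. (\<And>r. r < l \<Longrightarrow> (\<Sum>x<l + 0. z r x * u x) = 0) \<Longrightarrow> i < l + 0 \<Longrightarrow>
         u i = (\<Sum>c<0. H $$ (i, l + c) * u (l + c))"
      by blast+
    have "kernel_stable n l z (\<lambda>_. 1) (\<lambda>_. 0)"
      unfolding kernel_stable_def 2
    proof (intro allI impI)
      fix u r assume u: "\<forall>r<l. (\<Sum>i<l. z r i * u i) = 0"
      have u0: "u i = 0" if "i < l" for i
      proof -
        have "u i = (\<Sum>c<0. H $$ (i, l + c) * u (l + c))" by (rule H(4)) (use u that in auto)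
        then show ?thesis by simp
      qed
      show "(\<Sum>i<l. z r i * (\<Sum>j<l. jacobi (\<lambda>_. 1) (\<lambda>_. 0) i j * u j)) = 0"
        by (simp add: u0)
    qed
    then show ?thesis using that[of "\<lambda>_. 1"] by simp
  next
    case 3
    then show ?thesis using kernel_stable_codim_1[of l z] pos that by metis
  next
    case 4
    then show ?thesis using kernel_stable_codim_2[of l z] pos that by metis
  next
    case 5
    have f: "z 0 i > 0" if "i < n" for i
    proof -
      have "pick {i} 0 = i" by (rule pick_eqI[where k = 1]) auto
      then have "minor 1 (\<lambda>i r. z r i) {i} = z 0 i" unfolding minor_def by (simp add: det_single[of "mat (Suc 0) (Suc 0) _"])
      then show ?thesis using pos[of "{i}"] that 5 by simp
    qed
    obtain a b where ab: "\<And>i. a i > 0" "\<And>i. i < n \<Longrightarrow> (\<Sum>j<n. jacobi a b i j * z 0 j) = 0"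
      using jacobi_kernel_1[of n "z 0"] f by metis
    then have "kernel_stable n l z a b" unfolding kernel_stable_def 5 by (simp add: jacobi_self_adjoint)
    then show ?thesis using that ab by blast
  next
    case 6
    have det: "z 0 i * z 1 j - z 0 j * z 1 i > 0" if ij: "i < j" "j < n" for i j
    proof -
      have "pick {i, j} r = (if r = 0 then i else j)" if "r < 2" for r
        by (rule pick_eqI[where k = 2, OF _ _ that]) (use ij in \<open>auto simp: less_2_cases_iff lessThan_Suc numeral_2_eq_2\<close>)
      from this[of 0] this[of 1] have "pick {i, j} 0 = i" "pick {i, j} 1 = j"
        by (simp_all del: pick.simps)
      then have "minor 2 (\<lambda>i r. z r i) {i, j} = z 0 i * z 1 j - z 0 j * z 1 i"
        unfolding minor_def det_mat_2 by (simp add: mult.commute del: pick.simps One_nat_def)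
      then show ?thesis using pos[of "{i, j}"] ij 6 by simp
    qed
    from 6(2) det have "\<exists>a b f g. (\<forall>i. a i > 0) \<and> (\<forall>i<n. (\<Sum>j<n. jacobi a b i j * f j) = 0)
      \<and> (\<forall>i<n. (\<Sum>j<n. jacobi a b i j * g j) = - g i)
      \<and> (\<exists>p q. g = (\<lambda>i. p * z 0 i + q * z 1 i))
      \<and> (\<exists>p q. z 0 = (\<lambda>i. p * f i + q * g i)) \<and> (\<exists>p q. z 1 = (\<lambda>i. p * f i + q * g i))"
      by (rule jacobi_plane)
    then obtain a b f g where
      "(\<forall>i. a i > 0) \<and> (\<forall>i<n. (\<Sum>j<n. jacobi a b i j * f j) = 0)
      \<and> (\<forall>i<n. (\<Sum>j<n. jacobi a b i j * g j) = - g i)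
      \<and> (\<exists>p q. g = (\<lambda>i. p * z 0 i + q * z 1 i))
      \<and> (\<exists>p q. z 0 = (\<lambda>i. p * f i + q * g i)) \<and> (\<exists>p q. z 1 = (\<lambda>i. p * f i + q * g i))"
      by (elim exE)
    then have ab: "\<And>i. a i > 0"
      and f: "\<And>i. i < n \<Longrightarrow> (\<Sum>j<n. jacobi a b i j * f j) = 0"
      and g: "\<And>i. i < n \<Longrightarrow> (\<Sum>j<n. jacobi a b i j * g j) = - g i"
      and gz: "\<exists>p q. g = (\<lambda>i. p * z 0 i + q * z 1 i)"
      and zf0: "\<exists>p q. z 0 = (\<lambda>i. p * f i + q * g i)" "\<exists>p q. z 1 = (\<lambda>i. p * f i + q * g i)"
      by blast+
    from zf0 obtain p q p' q' where zf: "z 0 = (\<lambda>i. p * f i + q * g i)" "z 1 = (\<lambda>i. p' * f i + q' * g i)"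
      by (elim exE)
    obtain c d where gcd: "g = (\<lambda>i. c * z 0 i + d * z 1 i)" using gz by blast
    have "kernel_stable n l z a b" unfolding kernel_stable_def
    proof (intro allI impI)
      fix u r assume u: "\<forall>r<l. (\<Sum>i<n. z r i * u i) = 0" and r: "r < l"
      have "(\<Sum>i<n. g i * u i) = c * (\<Sum>i<n. z 0 i * u i) + d * (\<Sum>i<n. z 1 i * u i)"
        unfolding gcd by (simp add: algebra_simps sum.distrib sum_distrib_left)
      then have gu: "(\<Sum>i<n. g i * u i) = 0" using u 6 by simp
      \<comment> \<open>Moved to the other factor, the Jacobi matrix kills \<open>f\<close> and
        negates \<open>g\<close>; and \<open>g\<close>, lying in the row space, is orthogonal to
        \<open>u\<close>.\<close>
      have key: "(\<Sum>i<n. (s * f i + t * g i) * (\<Sum>j<n. jacobi a b i j * u j)) = 0" for s t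
      proof -
        have "(\<Sum>i<n. (s * f i + t * g i) * (\<Sum>j<n. jacobi a b i j * u j)) =
           (\<Sum>i<n. (s * (\<Sum>j<n. jacobi a b i j * f j) + t * (\<Sum>j<n. jacobi a b i j * g j)) * u i)"
          unfolding jacobi_self_adjoint by (simp add: algebra_simps sum.distrib sum_distrib_left)
        also have "\<dots> = (\<Sum>i<n. - t * (g i * u i))" by (intro sum.cong refl) (simp add: f g)
        also have "\<dots> = 0" unfolding sum_distrib_left[symmetric] gu by simp
        finally show ?thesis .
      qed
      have "r = 0 \<or> r = 1" using r 6 by auto
      then show "(\<Sum>i<n. z r i * (\<Sum>j<n. jacobi a b i j * u j)) = 0"
        using key[of p q] key[of p' q'] zf by auto
    qed
    then show ?thesis using that ab by blast
  qed
qed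

section \<open>Column spaces and flags\<close>

text \<open>\<open>rank\<close> sees only the set of columns, so a repeated column would leave fewer
  than \<open>nc\<close> vectors from which to take an independent family.\<close>

lemma (in vec_space) full_rank_distinct:
  assumes A: "A \<in> carrier_mat n nc" and rank: "rank A = nc"
  shows "distinct (cols A)"
proof -
  obtain S where S: "maximal S (\<lambda>T. T \<subseteq> set (cols A) \<and> lin_indpt T)"
    using maximal_exists[of "(\<lambda>T. T \<subseteq> set (cols A) \<and> lin_indpt T)" "card (set (cols A))" "{}"]
    by (meson List.finite_set card_mono empty_iff empty_subsetI finite_lin_indpt2 rev_finite_subset)
  then have "card S \<le> card (set (cols A))" by (simp add: card_mono maximal_def)
  then have "nc \<le> card (set (cols A))" using rank_card_indpt[OF A S] rank by simp
  moreover have "length (cols A) = nc" using A by simp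
  ultimately show ?thesis using card_length[of "cols A"] card_distinct[of "cols A"] by simp
qed

lemma mult_mat_unit_vec:
  fixes A :: "'a::comm_semiring_1 mat"
  assumes "A \<in> carrier_mat n k" "c < k"
  shows "A *\<^sub>v unit_vec k c = col A c"
  using assms by (intro eq_vecI) auto

lemma (in vec_space) injective_distinct:
  fixes A :: "'a mat"
  assumes A: "A \<in> carrier_mat n nc"
    and inj: "\<And>v. v \<in> carrier_vec nc \<Longrightarrow> A *\<^sub>v v = 0\<^sub>v n \<Longrightarrow> v = 0\<^sub>v nc"
  shows "distinct (cols A)"
proof (rule ccontr)
  assume "\<not> distinct (cols A)"
  then obtain i j where ij: "i < nc" "j < nc" "i \<noteq> j" "col A i = col A j"
    using A by (auto simp: distinct_conv_nth)
  let ?v = "unit_vec nc i - unit_vec nc j :: 'a vec"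
  have "A *\<^sub>v ?v = A *\<^sub>v unit_vec nc i - A *\<^sub>v unit_vec nc j"
    using A by (intro mult_minus_distrib_mat_vec) auto
  also have "\<dots> = 0\<^sub>v n" using A ij by (simp add: mult_mat_unit_vec)
  finally have "?v = 0\<^sub>v nc" by (rule inj[rotated]) simp
  then have "?v $ i = 0" using ij by simp
  then show False using ij by simp
qed

lemma (in vec_space) rank_eq_iff_injective:
  assumes A: "A \<in> carrier_mat n nc"
  shows "rank A = nc \<longleftrightarrow> (\<forall>v\<in>carrier_vec nc. A *\<^sub>v v = 0\<^sub>v n \<longrightarrow> v = 0\<^sub>v nc)"
proof
  assume rank: "rank A = nc"
  have "distinct (cols A)" using full_rank_distinct[OF A rank] .
  moreover from this have "lin_indpt (set (cols A))" using full_rank_lin_indpt[OF A rank] by blast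
  ultimately show "\<forall>v\<in>carrier_vec nc. A *\<^sub>v v = 0\<^sub>v n \<longrightarrow> v = 0\<^sub>v nc"
    using lin_depI[OF A] by blast
next
  assume inj: "\<forall>v\<in>carrier_vec nc. A *\<^sub>v v = 0\<^sub>v n \<longrightarrow> v = 0\<^sub>v nc"
  have dist: "distinct (cols A)" using injective_distinct[OF A] inj by blast
  have "lin_indpt (set (cols A))" using lin_depE[OF A _ dist] inj by metis
  then show "rank A = nc" using lin_indpt_full_rank[OF A dist] by blast
qed

lemma rank_left_inverse:
  fixes A :: "'a::field mat"
  assumes A: "A \<in> carrier_mat n k" and L: "L \<in> carrier_mat k n" and "L * A = 1\<^sub>m k"
  shows "vec_space.rank n A = k"
proof -
  have "v = 0\<^sub>v k" if v: "v \<in> carrier_vec k" "A *\<^sub>v v = 0\<^sub>v n" for v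
  proof -
    have "v = (L * A) *\<^sub>v v" using v assms by simp
    also have "\<dots> = L *\<^sub>v (A *\<^sub>v v)" using A L v by (simp add: assoc_mult_mat_vec)
    also have "\<dots> = 0\<^sub>v k" using v L by auto
    finally show ?thesis .
  qed
  then show ?thesis using vec_space.rank_eq_iff_injective[OF A] by blast
qed

lemma col_space_conv:
  fixes A :: "'a::field mat"
  assumes "A \<in> carrier_mat n k"
  shows "vec_space.col_space n A = (\<lambda>v. A *\<^sub>v v) ` carrier_vec k"
  using vec_space.col_space_eq[OF assms] assms by auto

lemma col_space_mult_subset:
  fixes A :: "'a::field mat"
  assumes A: "A \<in> carrier_mat n k" and N: "N \<in> carrier_mat k j"
  shows "vec_space.col_space n (A * N) \<subseteq> vec_space.col_space n A"
  unfolding col_space_conv[OF A] col_space_conv[OF mult_carrier_mat[OF A N]]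
  using A N by (auto simp: assoc_mult_mat_vec)

lemma col_space_mult_invertible:
  fixes A :: "'a::field mat"
  assumes A: "A \<in> carrier_mat n k" and N: "N \<in> carrier_mat k k" and det: "det N \<noteq> 0"
  shows "vec_space.col_space n (A * N) = vec_space.col_space n A"
proof
  obtain N' where N': "N' \<in> carrier_mat k k" "N * N' = 1\<^sub>m k"
    using mat_inverse_obtain[OF N det] by blast
  have "(A * N) * N' = A" using A N N' by (simp add: assoc_mult_mat[of A n k N k N' k])
  then show "vec_space.col_space n A \<subseteq> vec_space.col_space n (A * N)"
    using col_space_mult_subset[OF mult_carrier_mat[OF A N] N'(1)] by simp
qed (rule col_space_mult_subset[OF A N])

lemma col_space_eq_factor:
  fixes A B :: "'a::field mat"
  assumes A: "A \<in> carrier_mat n k" and B: "B \<in> carrier_mat n k"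
    and rank: "vec_space.rank n A = k" and eq: "vec_space.col_space n A \<subseteq> vec_space.col_space n B"
  obtains N where "N \<in> carrier_mat k k" "A = B * N" "det N \<noteq> 0"
proof -
  have "\<exists>w\<in>carrier_vec k. col A c = B *\<^sub>v w" if "c < k" for c
  proof -
    have "col A c = A *\<^sub>v unit_vec k c" using A that by (simp add: mult_mat_unit_vec)
    then have "col A c \<in> vec_space.col_space n A" unfolding col_space_conv[OF A] by auto
    then show ?thesis using eq unfolding col_space_conv[OF B] by auto
  qed
  then obtain w where w: "\<And>c. c < k \<Longrightarrow> w c \<in> carrier_vec k \<and> col A c = B *\<^sub>v w c" by metis
  define N where "N = mat k k (\<lambda>(i, c). w c $ i)"
  have N: "N \<in> carrier_mat k k" by (simp add: N_def)
  have colN: "col N c = w c" if "c < k" for c using w[OF that] that unfolding N_def by (intro eq_vecI) auto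
  have AN: "A = B * N"
  proof (rule mat_col_eqI)
    fix c assume "c < dim_col (B * N)"
    then have c: "c < k" using N by simp
    then show "col A c = col (B * N) c" using w[OF c] B N colN by (simp add: col_mult2[OF B N c])
  qed (use A B N in auto)
  have "det N \<noteq> 0"
  proof
    assume "det N = 0"
    then obtain v where v: "v \<in> carrier_vec k" "v \<noteq> 0\<^sub>v k" "N *\<^sub>v v = 0\<^sub>v k"
      using det_0_iff_vec_prod_zero_field[OF N] by blast
    have "A *\<^sub>v v = B *\<^sub>v (N *\<^sub>v v)" unfolding AN using B N v by (simp add: assoc_mult_mat_vec)
    then have "A *\<^sub>v v = 0\<^sub>v n" using v B by auto
    then show False using v rank vec_space.rank_eq_iff_injective[OF A] by blast
  qed
  then show ?thesis using that N AN by blast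
qed

lemma flag_of_conv:
  assumes A: "A \<in> carrier_mat n n" and j: "j \<le> n"
  shows "flag_of n A j = vec_space.col_space n (mat n j (\<lambda>(i, c). A $$ (i, c)))"
proof -
  have "take j (cols A) = cols (mat n j (\<lambda>(i, c). A $$ (i, c)))"
    using A j by (intro nth_equalityI) (auto intro!: eq_vecI simp: col_def)
  then show ?thesis unfolding flag_of_def vec_space.col_space_def by simp
qed

lemma flag_of_ge:
  assumes A: "A \<in> carrier_mat n n" and j: "j \<ge> n"
  shows "flag_of n A j = flag_of n A n"
  using A j unfolding flag_of_def by simp

text \<open>Every leading block of the triangular matrix of coefficients is invertible, so passing
  from \<open>B\<close> to \<open>A\<close> leaves the span of the first \<open>j\<close> columns
  unchanged for every \<open>j\<close>.\<close>

lemma flag_of_triangular: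
  fixes A B :: "complex mat"
  assumes A: "A \<in> carrier_mat n n" and B: "B \<in> carrier_mat n n"
    and eq: "\<And>i j. i < n \<Longrightarrow> j < n \<Longrightarrow> A $$ (i, j) = (\<Sum>s<Suc j. B $$ (i, s) * t s j)"
    and t: "\<And>j. j < n \<Longrightarrow> t j j \<noteq> 0"
  shows "flag_of n A = flag_of n B"
proof -
  have main: "flag_of n A j = flag_of n B j" if j: "j \<le> n" for j
  proof -
    let ?A = "mat n j (\<lambda>(i, c). A $$ (i, c))" and ?B = "mat n j (\<lambda>(i, c). B $$ (i, c))"
    let ?T = "mat j j (\<lambda>(s, c). if s \<le> c then t s c else 0)"
    have "?A = ?B * ?T"
    proof (rule eq_matI)
      fix i c assume "i < dim_row (?B * ?T)" "c < dim_col (?B * ?T)"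
      then have ic: "i < n" "c < j" by auto
      have "(?B * ?T) $$ (i, c) = (\<Sum>s<j. B $$ (i, s) * (if s \<le> c then t s c else 0))"
        using ic by (simp add: scalar_prod_def atLeast0LessThan)
      also have "\<dots> = (\<Sum>s<Suc c. B $$ (i, s) * t s c)"
        using ic by (intro sum.mono_neutral_cong_right) auto
      finally show "?A $$ (i, c) = (?B * ?T) $$ (i, c)" using ic j eq by simp
    qed auto
    moreover have "det ?T = prod_list (diag_mat ?T)"
      by (rule det_upper_triangular[of _ j]) (auto simp: upper_triangular_def)
    then have "det ?T \<noteq> 0" using t j by (auto simp: prod_list_zero_iff diag_mat_def)
    ultimately show ?thesis
      unfolding flag_of_conv[OF A j] flag_of_conv[OF B j]
      using col_space_mult_invertible[of ?B n j ?T] by simp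
  qed
  show ?thesis
  proof
    fix j show "flag_of n A j = flag_of n B j"
      using main[of j] main[of n] flag_of_ge[OF A, of j] flag_of_ge[OF B, of j] by (cases "j \<le> n") auto
  qed
qed

section \<open>Vandermonde determinants of polynomials of increasing degree\<close>

lemma poly_eq_prod_roots:
  fixes F :: "real poly"
  assumes deg: "degree F \<le> k" and root: "\<And>r. r < k \<Longrightarrow> poly F (y r) = 0" and inj: "inj_on y {..<k}"
  shows "poly F t = coeff F k * (\<Prod>r<k. t - y r)"
proof -
  let ?P = "\<Prod>r<k. [:- y r, 1:]"
  have degP: "degree ?P = k" by (subst degree_prod_eq_sum_degree) auto
  have "lead_coeff ?P = 1" by (simp add: lead_coeff_prod)
  then have coP: "coeff ?P k = 1" using degP by simp
  let ?G = "F - smult (coeff F k) ?P"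
  have "?G = 0"
  proof (rule ccontr)
    assume nz: "?G \<noteq> 0"
    have "degree ?G \<le> k" using deg degP by (intro degree_diff_le) (auto intro: order_trans[OF degree_smult_le])
    moreover have "coeff ?G k = 0" using coP by simp
    ultimately have less: "degree ?G < k" using nz by (metis leading_coeff_0_iff le_neq_implies_less)
    have "poly ?P (y r) = 0" if "r < k" for r using that by (auto simp: poly_prod)
    then have "y ` {..<k} \<subseteq> {x. poly ?G x = 0}" using root by auto
    then have "card (y ` {..<k}) \<le> degree ?G"
      using card_poly_roots_bound[OF nz] card_mono[OF poly_roots_finite[OF nz]] order_trans by blast
    then show False using less inj by (simp add: card_image)
  qed
  then have "F = smult (coeff F k) ?P" by simp
  then have "poly F t = poly (smult (coeff F k) ?P) t" by (rule arg_cong)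
  then show ?thesis by (simp add: poly_prod)
qed

text \<open>As a function of its last node the determinant is a polynomial of degree at most
  \<open>k\<close> that vanishes at the other \<open>k\<close> nodes, and its top coefficient
  contains the determinant of size \<open>k\<close>. The nodes decrease, so the \<open>k\<close>
  linear factors are negative, and the signs \<open>(-1) ^ c\<close> compensate for this.\<close>

lemma vandermonde_pos:
  fixes y :: "nat \<Rightarrow> real" and p :: "nat \<Rightarrow> real poly"
  assumes y: "\<And>i j. i < j \<Longrightarrow> j < k \<Longrightarrow> y i > y j"
    and p: "\<And>j. j < k \<Longrightarrow> degree (p j) = j \<and> lead_coeff (p j) > 0"
  shows "det (mat k k (\<lambda>(r, c). (-1) ^ c * poly (p c) (y r))) > 0"
  using assms
proof (induction k)
  case 0
  then show ?case by (simp add: det_dim_zero[OF mat_carrier])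
next
  case (Suc k)
  \<comment> \<open>The last node becomes a variable \<open>t\<close>. The cofactors along that row
    do not involve it, so they are taken at 0.\<close>
  let ?M = "\<lambda>t. mat (Suc k) (Suc k) (\<lambda>(r, c). if r < k then (-1) ^ c * poly (p c) (y r) else (-1) ^ c * poly (p c) t)"
  let ?cof = "\<lambda>c. cofactor (?M 0) k c"
  have cof: "cofactor (?M t) k c = ?cof c" if "c < Suc k" for t c
  proof -
    have "mat_delete (?M t) k c = mat_delete (?M 0) k c" unfolding mat_delete_def by (intro eq_matI) auto
    then show ?thesis by (simp add: cofactor_def)
  qed
  define F where "F = (\<Sum>c<Suc k. smult ((-1) ^ c * ?cof c) (p c))"
  have F: "poly F t = det (?M t)" for t
  proof -
    have "det (?M t) = (\<Sum>c<Suc k. ?M t $$ (k, c) * cofactor (?M t) k c)"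
      by (rule laplace_expansion_row) auto
    also have "\<dots> = (\<Sum>c<Suc k. (-1) ^ c * poly (p c) t * ?cof c)"
    proof (rule sum.cong[OF refl])
      fix c assume c: "c \<in> {..<Suc k}"
      have 1: "cofactor (?M t) k c = ?cof c" by (rule cof) (use c in simp)
      have 2: "?M t $$ (k, c) = (-1) ^ c * poly (p c) t" using c by simp
      show "?M t $$ (k, c) * cofactor (?M t) k c = (-1) ^ c * poly (p c) t * ?cof c"
        by (simp only: 1 2)
    qed
    finally show ?thesis unfolding F_def poly_sum by (simp add: mult_ac)
  qed
  have "mat_delete (?M 0) k k = mat k k (\<lambda>(r, c). (-1) ^ c * poly (p c) (y r))"
    unfolding mat_delete_def by (intro eq_matI) auto
  moreover have "det (mat k k (\<lambda>(r, c). (-1) ^ c * poly (p c) (y r))) > 0"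
    by (rule Suc.IH) (use Suc.prems less_SucI in blast)+
  ultimately have cofk: "?cof k > 0" by (simp add: cofactor_def)
  have degF: "degree F \<le> k"
    unfolding F_def using Suc.prems(2) by (intro degree_sum_le) (auto intro: order_trans[OF degree_smult_le])
  have "coeff F k = (\<Sum>c<Suc k. (-1) ^ c * ?cof c * coeff (p c) k)" unfolding F_def coeff_sum by simp
  also have "\<dots> = (-1) ^ k * ?cof k * coeff (p k) k"
    using Suc.prems(2) by (simp add: coeff_eq_0)
  finally have coF: "coeff F k = (-1) ^ k * (?cof k * lead_coeff (p k))" using Suc.prems(2)[of k] by simp
  have root: "poly F (y r) = 0" if "r < k" for r
    unfolding F by (rule det_mat_identical_rows[of r k]) (use that in auto)
  have inj: "inj_on y {..<k}"
    using Suc.prems(1) by (auto simp: inj_on_def) (metis less_irrefl less_SucI linorder_neqE_nat)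
  have "det (mat (Suc k) (Suc k) (\<lambda>(r, c). (-1) ^ c * poly (p c) (y r))) = poly F (y k)"
    unfolding F by (rule det_mat_cong) (auto simp: less_Suc_eq)
  also have "\<dots> = coeff F k * (\<Prod>r<k. y k - y r)"
    by (rule poly_eq_prod_roots[OF degF _ inj]) (rule root)
  also have "\<dots> = (?cof k * lead_coeff (p k)) * ((-1) ^ k * (\<Prod>r<k. y k - y r))"
    unfolding coF by (simp only: mult_ac)
  also have "(-1) ^ k * (\<Prod>r<k. y k - y r) = (\<Prod>r<k. y r - y k)"
  proof -
    have "(\<Prod>r<k. y r - y k) = (\<Prod>r<k. (-1) * (y k - y r))" by (intro prod.cong) auto
    also have "\<dots> = (\<Prod>r<k. -1) * (\<Prod>r<k. y k - y r)" by (rule prod.distrib)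
    finally show ?thesis by simp
  qed
  also have "(?cof k * lead_coeff (p k)) * \<dots> > 0"
  proof (intro mult_pos_pos prod_pos cofk)
    show "lead_coeff (p k) > 0" using Suc.prems(2)[of k] by blast
    fix r assume "r \<in> {..<k}"
    then show "0 < y r - y k" using Suc.prems(1)[of r k] by simp
  qed
  finally show ?case .
qed

section \<open>The twisted Vandermonde flag\<close>

lemma sum_delta_mult:
  fixes w :: "nat \<Rightarrow> 'a::semiring_1"
  assumes "s < n" shows "(\<Sum>x<n. (if s = x then 1 else 0) * w x) = w s"
proof -
  have "(\<Sum>x<n. (if s = x then 1 else 0) * w x) = (\<Sum>x<n. if x = s then w s else 0)"
    by (intro sum.cong) auto
  then show ?thesis using assms by simp
qed

text \<open>By Cauchy-Binet, positive minors of \<open>z\<close> against minors of constant sign,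
  \<open>z\<close> is injective on the first \<open>l\<close> eigenvectors. So each later
  eigenvector is congruent to a combination of them modulo the kernel. The Jacobi matrix preserves
  this congruence but multiplies its terms by distinct eigenvalues, so the combination is 0 and the
  later eigenvector lies in the kernel.\<close>

lemma stable_kernel_top_eigenspace:
  fixes U :: "nat \<Rightarrow> nat \<Rightarrow> real"
  assumes a: "\<And>i. a i > 0"
    and mono: "\<And>i j. i < j \<Longrightarrow> j < n \<Longrightarrow> \<mu> i > \<mu> j"
    and cols: "\<And>i j. i < n \<Longrightarrow> j < n \<Longrightarrow> (\<Sum>r<n. U r i * U r j) = (if i = j then 1 else 0)"
    and rows: "\<And>i j. i < n \<Longrightarrow> j < n \<Longrightarrow> (\<Sum>r<n. U i r * U j r) = (if i = j then 1 else 0)"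
    and eig: "\<And>i c. i < n \<Longrightarrow> c < n \<Longrightarrow> (\<Sum>j<n. jacobi a b i j * U j c) = \<mu> c * U i c"
    and l: "l \<le> n"
    and pos: "\<And>J. J \<in> ksets n l \<Longrightarrow> minor l (\<lambda>i r. z r i) J > 0"
    and stable: "kernel_stable n l z a b"
  shows "det (mat l l (\<lambda>(r, c). \<Sum>i<n. z r i * U i c)) \<noteq> 0"
    and "\<And>r j. r < l \<Longrightarrow> l \<le> j \<Longrightarrow> j < n \<Longrightarrow> (\<Sum>i<n. z r i * U i j) = 0"
    and "\<And>r i. r < l \<Longrightarrow> i < n \<Longrightarrow> z r i = (\<Sum>c<l. (\<Sum>x<n. z r x * U x c) * U i c)"
proof -
  let ?p = "\<lambda>r c. \<Sum>i<n. z r i * U i c"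
  let ?P = "mat l l (\<lambda>(r, c). ?p r c)"
  obtain \<epsilon> :: real where eps: "\<epsilon> = 1 \<or> \<epsilon> = - 1" "\<And>I. I \<in> ksets n l \<Longrightarrow> \<epsilon> * minor l U I > 0"
    by (rule perron_minors[of a n \<mu> U b l]) (use assms in auto)
  have "det ?P = (\<Sum>I\<in>ksets n l. minor l (\<lambda>i r. z r i) I * minor l U I)" by (rule cauchy_binet)
  then have "\<epsilon> * det ?P = (\<Sum>I\<in>ksets n l. minor l (\<lambda>i r. z r i) I * (\<epsilon> * minor l U I))"
    by (simp add: sum_distrib_left mult_ac)
  also have "\<dots> > 0"
  proof (rule sum_pos[OF finite_ksets])
    show "ksets n l \<noteq> {}" using lessThan_in_ksets[OF l] by blast
    fix I assume "I \<in> ksets n l"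
    then show "0 < minor l (\<lambda>i r. z r i) I * (\<epsilon> * minor l U I)"
      by (intro mult_pos_pos pos eps(2))
  qed
  finally show detP: "det ?P \<noteq> 0" by auto
  have P: "?P \<in> carrier_mat l l" by simp
  obtain R where R: "R \<in> carrier_mat l l" "?P * R = 1\<^sub>m l" "R * ?P = 1\<^sub>m l"
    using mat_inverse_obtain[OF P detP] by blast
  have PR: "(\<Sum>s<l. ?p r s * R $$ (s, x)) = (if r = x then 1 else 0)" if "r < l" "x < l" for r x
    using arg_cong[OF R(2), of "\<lambda>A. A $$ (r, x)"] that R(1) by (simp add: scalar_prod_def atLeast0LessThan)
  have RP: "(\<Sum>r<l. R $$ (s, r) * ?p r x) = (if s = x then 1 else 0)" if "s < l" "x < l" for s x
    using arg_cong[OF R(3), of "\<lambda>A. A $$ (s, x)"] that R(1) by (simp add: scalar_prod_def atLeast0LessThan)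
  have inj: "w s = 0" if w: "\<And>r. r < l \<Longrightarrow> (\<Sum>x<l. ?p r x * w x) = 0" and s: "s < l" for w s
  proof -
    have "w s = (\<Sum>x<l. (\<Sum>r<l. R $$ (s, r) * ?p r x) * w x)"
      using s by (simp add: RP sum_delta_mult)
    also have "\<dots> = (\<Sum>r<l. R $$ (s, r) * (\<Sum>x<l. ?p r x * w x))"
      unfolding sum_distrib_right[where r = "w _"] sum_distrib_left[where r = "R $$ _"]
      by (subst sum.swap) (simp only: mult.assoc)
    also have "\<dots> = 0" using w by simp
    finally show ?thesis .
  qed
  show high: "?p r j = 0" if r: "r < l" and j: "l \<le> j" "j < n" for r j
  proof -
    \<comment> \<open>The coefficients that express the image of eigenvector \<open>j\<close> under
      \<open>z\<close> by the images of the first \<open>l\<close> eigenvectors.\<close>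
    define c where "c s = (\<Sum>x<l. R $$ (s, x) * ?p x j)" for s
    have pc: "(\<Sum>s<l. ?p r s * c s) = ?p r j" if "r < l" for r
    proof -
      have "(\<Sum>s<l. ?p r s * c s) = (\<Sum>x<l. (\<Sum>s<l. ?p r s * R $$ (s, x)) * ?p x j)"
        unfolding c_def sum_distrib_left[where r = "?p r _"] sum_distrib_right[where r = "?p _ j"]
        by (subst sum.swap) (simp only: mult.assoc)
      then show ?thesis using that by (simp add: PR sum_delta_mult)
    qed
    define u where "u i = U i j - (\<Sum>s<l. c s * U i s)" for i
    have zu: "(\<Sum>i<n. z r i * (\<alpha> * U i j - (\<Sum>s<l. w s * c s * U i s))) = \<alpha> * ?p r j - (\<Sum>s<l. ?p r s * (w s * c s))"
      for r \<alpha> w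
    proof -
      have "(\<Sum>i<n. z r i * (\<Sum>s<l. w s * c s * U i s)) = (\<Sum>s<l. ?p r s * (w s * c s))"
        unfolding sum_distrib_left sum_distrib_right by (subst sum.swap) (simp add: mult_ac)
      then show ?thesis by (simp add: right_diff_distrib sum_subtractf sum_distrib_left mult_ac)
    qed
    have ker: "(\<Sum>i<n. z r i * u i) = 0" if "r < l" for r
      using zu[of r 1 "\<lambda>_. 1"] pc[OF that] by (simp add: u_def)
    have Au: "(\<Sum>x<n. jacobi a b i x * u x) = \<mu> j * U i j - (\<Sum>s<l. \<mu> s * c s * U i s)" if i: "i < n" for i
    proof -
      have "(\<Sum>x<n. jacobi a b i x * u x) = (\<Sum>x<n. jacobi a b i x * U x j) - (\<Sum>s<l. c s * (\<Sum>x<n. jacobi a b i x * U x s))"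
        unfolding u_def right_diff_distrib sum_subtractf sum_distrib_left
        by (subst sum.swap) (simp add: mult_ac)
      also have "(\<Sum>s<l. c s * (\<Sum>x<n. jacobi a b i x * U x s)) = (\<Sum>s<l. \<mu> s * c s * U i s)"
      proof (rule sum.cong[OF refl])
        fix s assume "s \<in> {..<l}"
        then have "(\<Sum>x<n. jacobi a b i x * U x s) = \<mu> s * U i s" using l by (intro eig i) auto
        then show "c s * (\<Sum>x<n. jacobi a b i x * U x s) = \<mu> s * c s * U i s" by simp
      qed
      finally show ?thesis by (simp add: eig[OF i j(2)])
    qed
    have "\<mu> j * ?p r j - (\<Sum>s<l. ?p r s * (\<mu> s * c s)) = 0" if r: "r < l" for r
    proof -
      have "(\<Sum>i<n. z r i * (\<Sum>x<n. jacobi a b i x * u x)) = 0"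
        using stable ker r unfolding kernel_stable_def by blast
      moreover have "(\<Sum>i<n. z r i * (\<Sum>x<n. jacobi a b i x * u x)) =
          (\<Sum>i<n. z r i * (\<mu> j * U i j - (\<Sum>s<l. \<mu> s * c s * U i s)))"
        by (intro sum.cong refl) (simp only: Au lessThan_iff)
      ultimately show ?thesis using zu[of r "\<mu> j" \<mu>] by simp
    qed
    \<comment> \<open>The relations for \<open>u\<close> and for its image under the Jacobi matrix
      are combined so that eigenvector \<open>j\<close> drops out. The factors
      \<open>\<mu> j - \<mu> s\<close> are nonzero, which leaves \<open>c s = 0\<close>.\<close>
    have "(\<Sum>s<l. ?p r s * ((\<mu> j - \<mu> s) * c s)) = 0" if "r < l" for r
    proof -
      have "(\<Sum>s<l. q s * ((\<mu> j - \<mu> s) * c s)) = \<mu> j * (\<Sum>s<l. q s * c s) - (\<Sum>s<l. q s * (\<mu> s * c s))"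
        for q :: "nat \<Rightarrow> real"
        by (simp add: left_diff_distrib right_diff_distrib sum_subtractf sum_distrib_left mult_ac)
      from this[of "?p r"] show ?thesis
        using \<open>\<And>r. r < l \<Longrightarrow> \<mu> j * ?p r j - (\<Sum>s<l. ?p r s * (\<mu> s * c s)) = 0\<close>[OF that]
        unfolding pc[OF that] by simp
    qed
    then have "(\<mu> j - \<mu> s) * c s = 0" if "s < l" for s by (rule inj) (use that in auto)
    moreover have "\<mu> s > \<mu> j" if "s < l" for s using mono[of s j] that j by simp
    ultimately have "c s = 0" if "s < l" for s using that by (metis eq_iff_diff_eq_0 less_irrefl mult_eq_0_iff)
    then show ?thesis using pc[OF r] by simp
  qed
  show "z r i = (\<Sum>c<l. ?p r c * U i c)" if r: "r < l" and i: "i < n" for r i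
  proof -
    have "z r i = (\<Sum>x<n. z r x * (\<Sum>c<n. U x c * U i c))" using i by (simp add: rows if_distrib cong: if_cong)
    also have "\<dots> = (\<Sum>c<n. ?p r c * U i c)"
      unfolding sum_distrib_left sum_distrib_right by (subst sum.swap) (simp add: mult_ac)
    also have "\<dots> = (\<Sum>c<l. ?p r c * U i c)"
      using l high[OF r] by (intro sum.mono_neutral_right) auto
    finally show ?thesis .
  qed
qed

text \<open>Column \<open>j\<close> of \<open>h\<close> lies in the span of the first
  \<open>Suc j\<close> columns of \<open>g\<close>, to which column \<open>i\<close> of
  \<open>g\<close> is orthogonal. The span is complex, so the sum is computed there and brought back
  to the reals by injectivity.\<close>

lemma orthogonal_flag_triangular:
  fixes g h :: "real mat"
  assumes g: "g \<in> carrier_mat n n" "transpose_mat g * g = 1\<^sub>m n" and h: "h \<in> carrier_mat n n"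
    and flag: "flag_of n (complex_mat h) = flag_of n (complex_mat g)" and ij: "j < i" "i < n"
  shows "(\<Sum>x<n. g $$ (x, i) * h $$ (x, j)) = 0"
proof -
  let ?G = "mat n (Suc j) (\<lambda>(x, c). complex_mat g $$ (x, c))" and ?H = "mat n (Suc j) (\<lambda>(x, c). complex_mat h $$ (x, c))"
  have gg: "(\<Sum>x<n. g $$ (x, i) * g $$ (x, s)) = (if i = s then 1 else 0)" if "s < n" for s
    using arg_cong[OF g(2), of "\<lambda>A. A $$ (i, s)"] ij that g(1) by (simp add: scalar_prod_def atLeast0LessThan)
  have "vec_space.col_space n ?H = vec_space.col_space n ?G"
    using flag_of_conv[of "complex_mat h" n "Suc j"] flag_of_conv[of "complex_mat g" n "Suc j"] flag g h ij by simp
  moreover have "col ?H j \<in> vec_space.col_space n ?H"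
  proof -
    have H: "?H \<in> carrier_mat n (Suc j)" by simp
    have "col ?H j = ?H *\<^sub>v unit_vec (Suc j) j" by (rule mult_mat_unit_vec[OF H, symmetric]) simp
    then show ?thesis unfolding col_space_conv[OF H] by auto
  qed
  moreover have G: "?G \<in> carrier_mat n (Suc j)" by simp
  ultimately have "col ?H j \<in> (\<lambda>v. ?G *\<^sub>v v) ` carrier_vec (Suc j)"
    by (metis col_space_conv[OF G])
  then obtain t where t: "t \<in> carrier_vec (Suc j)" "col ?H j = ?G *\<^sub>v t" by blast
  have hx: "complex_of_real (h $$ (x, j)) = (\<Sum>s<Suc j. complex_of_real (g $$ (x, s)) * t $ s)" if x: "x < n" for x
  proof -
    have "col ?H j $ x = (?G *\<^sub>v t) $ x" using t(2) by simp
    then show ?thesis using x ij g h t(1) by (simp add: scalar_prod_def atLeast0LessThan del: sum.lessThan_Suc sum.op_ivl_Suc)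
  qed
  have "complex_of_real (\<Sum>x<n. g $$ (x, i) * h $$ (x, j)) =
      (\<Sum>x<n. complex_of_real (g $$ (x, i)) * (\<Sum>s<Suc j. complex_of_real (g $$ (x, s)) * t $ s))"
    unfolding of_real_sum of_real_mult by (intro sum.cong refl) (simp only: hx lessThan_iff)
  also have "\<dots> = (\<Sum>s<Suc j. complex_of_real (\<Sum>x<n. g $$ (x, i) * g $$ (x, s)) * t $ s)"
    unfolding sum_distrib_left of_real_sum sum_distrib_right by (subst sum.swap) (simp add: mult_ac del: sum.lessThan_Suc)
  also have "\<dots> = 0"
    using ij gg by (intro sum.neutral) auto
  finally show ?thesis by (simp only: of_real_eq_0_iff)
qed

text \<open>The product of the transpose of \<open>g\<close> with \<open>h\<close> is triangular in
  both directions, hence diagonal, with entries 1 or -1. Comparing the leading minors makes all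
  products of initial diagonal entries positive, so each entry is 1.\<close>

lemma nonneg_orthogonal_rep_unique:
  assumes g: "nonneg_orthogonal_rep n V g" and h: "nonneg_orthogonal_rep n V h"
    and pos: "\<And>j. j \<le> n \<Longrightarrow> minor j (\<lambda>i c. g $$ (i, c)) {..<j} > 0"
  shows "h = g"
proof -
  have gc: "g \<in> carrier_mat n n" "transpose_mat g * g = 1\<^sub>m n" and hc: "h \<in> carrier_mat n n" "transpose_mat h * h = 1\<^sub>m n"
    and flag: "flag_of n (complex_mat h) = flag_of n (complex_mat g)"
    using g h by (auto simp: nonneg_orthogonal_rep_def)
  let ?R = "\<lambda>i j. \<Sum>x<n. g $$ (x, i) * h $$ (x, j)"
  have off: "?R i j = 0" if "i < n" "j < n" "i \<noteq> j" for i j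
  proof (cases "j < i")
    case True
    then show ?thesis using orthogonal_flag_triangular[OF gc hc(1) flag] that by simp
  next
    case False
    then have "(\<Sum>x<n. h $$ (x, j) * g $$ (x, i)) = 0"
      using orthogonal_flag_triangular[OF hc gc(1) flag[symmetric]] that by simp
    then show ?thesis by (simp add: mult.commute)
  qed
  have "g * transpose_mat g = 1\<^sub>m n" using mat_mult_left_right_inverse[OF _ gc(1) gc(2)] gc(1) by simp
  note ggT1 = this
  have ggT: "(\<Sum>i<n. g $$ (x, i) * g $$ (y, i)) = (if x = y then 1 else 0)" if "x < n" "y < n" for x y
    using arg_cong[OF ggT1, of "\<lambda>A. A $$ (x, y)"] that gc(1) by (simp add: scalar_prod_def atLeast0LessThan)
  have hx: "h $$ (x, j) = g $$ (x, j) * ?R j j" if xj: "x < n" "j < n" for x j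
  proof -
    have "h $$ (x, j) = (\<Sum>y<n. (\<Sum>i<n. g $$ (x, i) * g $$ (y, i)) * h $$ (y, j))"
      using xj by (simp add: ggT sum_delta_mult)
    also have "\<dots> = (\<Sum>i<n. g $$ (x, i) * ?R i j)"
      unfolding sum_distrib_left sum_distrib_right by (subst sum.swap) (simp add: mult_ac)
    also have "\<dots> = (\<Sum>i<n. if i = j then g $$ (x, j) * ?R j j else 0)"
      using off xj by (intro sum.cong) auto
    finally show ?thesis using xj by simp
  qed
  have R2: "?R j j * ?R j j = 1" if j: "j < n" for j
  proof -
    have "1 = (\<Sum>x<n. h $$ (x, j) * h $$ (x, j))"
      using arg_cong[OF hc(2), of "\<lambda>A. A $$ (j, j)"] j hc(1) by (simp add: scalar_prod_def atLeast0LessThan)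
    also have "\<dots> = (\<Sum>x<n. (g $$ (x, j) * h $$ (x, j)) * ?R j j)"
    proof (rule sum.cong[OF refl])
      fix x assume "x \<in> {..<n}"
      then have "h $$ (x, j) * h $$ (x, j) = (g $$ (x, j) * ?R j j) * h $$ (x, j)"
        using arg_cong[OF hx, of x j "\<lambda>t. t * h $$ (x, j)"] j by simp
      then show "h $$ (x, j) * h $$ (x, j) = (g $$ (x, j) * h $$ (x, j)) * ?R j j"
        by (simp only: mult_ac)
    qed
    also have "\<dots> = ?R j j * ?R j j" by (rule sum_distrib_right[symmetric])
    finally show ?thesis by simp
  qed
  have prod_pos: "(\<Prod>i<j. ?R i i) > 0" if j: "j \<le> n" for j
  proof -
    have I: "{..<j} \<in> ksets n j" using j by auto
    have "minor j (\<lambda>i c. h $$ (i, c)) {..<j} = det (mat j j (\<lambda>(i, c). ?R c c * g $$ (i, c)))"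
      unfolding minor_lessThan by (intro det_mat_cong trans[OF hx mult.commute]) (use j in auto)
    also have "\<dots> = (\<Prod>i<j. ?R i i) * minor j (\<lambda>i c. g $$ (i, c)) {..<j}"
      unfolding minor_lessThan by (rule det_mat_col_scale)
    finally have eq: "minor j (\<lambda>i c. h $$ (i, c)) {..<j} = (\<Prod>i<j. ?R i i) * minor j (\<lambda>i c. g $$ (i, c)) {..<j}" .
    have "det (submatrix h {..<j} {..<card {..<j}}) \<ge> 0"
      using h j unfolding nonneg_orthogonal_rep_def by blast
    moreover have "det (submatrix h {..<j} {..<j}) = minor j (\<lambda>i c. h $$ (i, c)) {..<j}"
    proof -
      have "submatrix h {..<j} {..<j} = mat j j (\<lambda>(i, c). h $$ (i, c))"
      proof -
        have "{i. i < n \<and> i \<in> {..<j}} = {..<j}" using j by auto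
        then show ?thesis unfolding submatrix_def using hc(1) by (intro eq_matI) (auto simp: pick_lessThan)
      qed
      then show ?thesis unfolding minor_lessThan by simp
    qed
    ultimately have "(\<Prod>i<j. ?R i i) * minor j (\<lambda>i c. g $$ (i, c)) {..<j} \<ge> 0" using eq by simp
    then have "(\<Prod>i<j. ?R i i) \<ge> 0" using pos[OF j] by (simp add: zero_le_mult_iff)
    moreover have "?R i i \<noteq> 0" if "i < j" for i using R2[of i] that j by auto
    then have "(\<Prod>i<j. ?R i i) \<noteq> 0" by simp
    ultimately show ?thesis by linarith
  qed
  have R1: "?R j j = 1" if j: "j < n" for j
  proof -
    have "(\<Prod>i<j. ?R i i) * ?R j j > 0" using prod_pos[of "Suc j"] j by simp
    then have "?R j j > 0" using prod_pos[of j] j by (simp add: zero_less_mult_iff)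
    moreover have "?R j j = 1 \<or> ?R j j = - 1" using R2[OF j] by (simp add: square_eq_1_iff)
    ultimately show ?thesis by linarith
  qed
  have "h $$ (x, j) = g $$ (x, j)" if "x < n" "j < n" for x j
    using hx[OF that] unfolding R1[OF that(2)] by simp
  then show "h = g" by (intro eq_matI) (use gc(1) hc(1) in auto)
qed

text \<open>The representative \<open>g\<close> is the transpose of \<open>U\<close> with
  alternating column signs: it is orthogonal, differs from the Vandermonde matrix by a triangular
  factor, and has positive left-justified minors. Its inverse is its transpose, so conjugating the
  inverse by the alternating diagonal gives \<open>U\<close> up to column signs, which a flag
  ignores.\<close>

lemma twist_vandermonde:
  fixes U :: "nat \<Rightarrow> nat \<Rightarrow> real"
  assumes a: "\<And>i. a i > 0"
    and mono: "\<And>i j. i < j \<Longrightarrow> j < n \<Longrightarrow> \<mu> i > \<mu> j"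
    and cols: "\<And>i j. i < n \<Longrightarrow> j < n \<Longrightarrow> (\<Sum>r<n. U r i * U r j) = (if i = j then 1 else 0)"
    and rows: "\<And>i j. i < n \<Longrightarrow> j < n \<Longrightarrow> (\<Sum>r<n. U i r * U j r) = (if i = j then 1 else 0)"
    and U0: "\<And>c. c < n \<Longrightarrow> U 0 c > 0"
    and Uq: "\<And>j c. j < n \<Longrightarrow> c < n \<Longrightarrow> U j c = U 0 c * poly (rec_poly a b j) (\<mu> c)"
  shows "twist n (flag_of n (complex_mat (mat n n (\<lambda>(i, j). \<mu> i ^ j * U 0 i)))) =
    flag_of n (complex_mat (mat n n (\<lambda>(i, j). U i j)))"
proof -
  define g where "g = mat n n (\<lambda>(i, j). (-1) ^ j * U j i)"
  let ?W = "mat n n (\<lambda>(i, j). \<mu> i ^ j * U 0 i)"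
  let ?V = "flag_of n (complex_mat ?W)"
  have g: "g \<in> carrier_mat n n" by (simp add: g_def)
  have sgn: "(-1) ^ j * ((-1) ^ j * x) = (x::real)" for j x by (simp flip: mult.assoc power_mult_distrib)
  have orth: "transpose_mat g * g = 1\<^sub>m n"
  proof (rule eq_matI)
    fix i j assume "i < dim_row (1\<^sub>m n :: real mat)" "j < dim_col (1\<^sub>m n :: real mat)"
    then have ij: "i < n" "j < n" by auto
    have "(transpose_mat g * g) $$ (i, j) = (\<Sum>r<n. ((-1) ^ i * U i r) * ((-1) ^ j * U j r))"
      using ij by (simp add: g_def scalar_prod_def atLeast0LessThan)
    also have "\<dots> = (-1) ^ i * ((-1) ^ j * (\<Sum>r<n. U i r * U j r))"
      by (simp add: sum_distrib_left mult_ac)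
    finally show "(transpose_mat g * g) $$ (i, j) = (1\<^sub>m n) $$ (i, j)" using ij by (simp add: rows sgn)
  qed (use g in auto)
  have nz: "a i \<noteq> 0" for i using a[of i] by simp
  have deg: "degree (rec_poly a b j) = j" "lead_coeff (rec_poly a b j) > 0" for j
    using rec_poly_degree[where a = a and b = b and j = j, OF nz] a by (auto intro!: prod_pos)
  \<comment> \<open>The triangular factor consists of the signed coefficients of the polynomials
    \<open>rec_poly\<close>, and \<open>rec_poly a b j\<close> has degree exactly
    \<open>j\<close>.\<close>
  have flag: "flag_of n (complex_mat g) = ?V"
  proof (rule flag_of_triangular[where t = "\<lambda>s j. complex_of_real ((-1) ^ j * coeff (rec_poly a b j) s)"])
    fix i j assume ij: "i < n" "j < n"
    have "g $$ (i, j) = (-1) ^ j * (U 0 i * poly (rec_poly a b j) (\<mu> i))"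
      using ij Uq[of j i] by (simp add: g_def)
    also have "poly (rec_poly a b j) (\<mu> i) = (\<Sum>s<Suc j. coeff (rec_poly a b j) s * \<mu> i ^ s)"
      unfolding poly_altdef deg lessThan_Suc_atMost ..
    finally have "g $$ (i, j) = (\<Sum>s<Suc j. ?W $$ (i, s) * ((-1) ^ j * coeff (rec_poly a b j) s))"
      using ij by (simp add: sum_distrib_left mult_ac del: sum.lessThan_Suc)
    then have "complex_of_real (g $$ (i, j)) = (\<Sum>s<Suc j. complex_of_real (?W $$ (i, s)) * complex_of_real ((-1) ^ j * coeff (rec_poly a b j) s))"
      by (simp only: of_real_sum of_real_mult)
    also have "\<dots> = (\<Sum>s<Suc j. complex_mat ?W $$ (i, s) * complex_of_real ((-1) ^ j * coeff (rec_poly a b j) s))"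
      using ij by (intro sum.cong refl) simp
    finally show "complex_mat g $$ (i, j) = (\<Sum>s<Suc j. complex_mat ?W $$ (i, s) * complex_of_real ((-1) ^ j * coeff (rec_poly a b j) s))"
      using ij g by simp
  next
    fix j show "complex_of_real ((-1) ^ j * coeff (rec_poly a b j) j) \<noteq> 0" using deg[of j] by simp
  qed (use g in auto)
  have minor_pos: "minor j (\<lambda>i c. g $$ (i, c)) I > 0" if I: "I \<in> ksets n j" for I j
  proof -
    have jn: "j \<le> n" using I card_mono[of "{..<n}" I] by auto
    have pn: "pick I r < n" if "r < j" for r using ksetsD(4)[OF I that] .
    have "minor j (\<lambda>i c. g $$ (i, c)) I = det (mat j j (\<lambda>(r, c). U 0 (pick I r) * ((-1) ^ c * poly (rec_poly a b c) (\<mu> (pick I r)))))"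
      unfolding minor_def
    proof (rule det_mat_cong)
      fix r c assume rc: "r < j" "c < j"
      have "U c (pick I r) = U 0 (pick I r) * poly (rec_poly a b c) (\<mu> (pick I r))"
        by (rule Uq) (use rc jn pn in auto)
      then show "g $$ (pick I r, c) = U 0 (pick I r) * ((-1) ^ c * poly (rec_poly a b c) (\<mu> (pick I r)))"
        using rc jn pn[OF rc(1)] by (simp add: g_def)
    qed
    also have "\<dots> = (\<Prod>r<j. U 0 (pick I r)) * det (mat j j (\<lambda>(r, c). (-1) ^ c * poly (rec_poly a b c) (\<mu> (pick I r))))"
      by (rule det_mat_row_scale)
    also have "\<dots> > 0"
    proof (intro mult_pos_pos prod_pos vandermonde_pos)
      fix r s assume "r < s" "s < j"
      then show "\<mu> (pick I s) < \<mu> (pick I r)" using pick_strict_mono[of r s I] I pn by (intro mono) auto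
    qed (use U0 pn deg in auto)
    finally show ?thesis .
  qed
  have rep: "nonneg_orthogonal_rep n ?V g"
    unfolding nonneg_orthogonal_rep_def
  proof (intro conjI allI impI g orth flag)
    fix I assume I: "I \<subseteq> {..<n}"
    then have k: "I \<in> ksets n (card I)" by simp
    have "card I \<le> n" using I card_mono[of "{..<n}" I] by auto
    then have e: "{i. i < n \<and> i \<in> I} = I" "{j. j < n \<and> j \<in> {..<card I}} = {..<card I}" using I by auto
    have "det (submatrix g I {..<card I}) = minor (card I) (\<lambda>i c. g $$ (i, c)) I"
      unfolding submatrix_def minor_def using g e
      by (intro arg_cong[where f = det] eq_matI) (auto simp: pick_lessThan)
    then show "det (submatrix g I {..<card I}) \<ge> 0" using minor_pos[OF k] by simp
  qed
  have the: "(THE h. nonneg_orthogonal_rep n ?V h) = g"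
    using rep nonneg_orthogonal_rep_unique[OF rep] minor_pos lessThan_in_ksets by (intro the_equality) blast+
  have ggT: "g * transpose_mat g = 1\<^sub>m n" using mat_mult_left_right_inverse[OF _ g orth] g by simp
  obtain B where B: "mat_inverse g = Some B"
  proof (cases "mat_inverse g")
    case None
    then have "g \<notin> Units (ring_mat TYPE(real) n ())" by (rule mat_inverse(1)[OF g])
    moreover have "g \<in> Units (ring_mat TYPE(real) n ())"
      using g orth ggT unfolding Units_def ring_mat_simps by (auto intro!: bexI[of _ "transpose_mat g"])
    ultimately show ?thesis by blast
  qed (use that in auto)
  have B': "g * B = 1\<^sub>m n" "B * g = 1\<^sub>m n" "B \<in> carrier_mat n n" using mat_inverse(2)[OF g B] by auto
  have "B = B * (g * transpose_mat g)" using B'(3) ggT by simp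
  also have "\<dots> = (B * g) * transpose_mat g"
    by (rule assoc_mult_mat[symmetric, OF B'(3) g, of _ n]) (use g in auto)
  also have "\<dots> = transpose_mat g" using B'(2) g by simp
  finally have BT: "B = transpose_mat g" .
  let ?\<delta> = "mat_diag n (\<lambda>i. (-1) ^ i) :: real mat"
  have "?\<delta> * transpose_mat g * ?\<delta> = mat n n (\<lambda>(i, j). (-1) ^ j * U i j)"
  proof -
    have "?\<delta> * transpose_mat g = mat n n (\<lambda>(i, j). (-1) ^ i * transpose_mat g $$ (i, j))"
      by (rule mat_diag_mult_left) (use g in auto)
    also have "\<dots> = mat n n (\<lambda>(i, j). U i j)" by (intro eq_matI) (auto simp: g_def sgn)
    finally have 1: "?\<delta> * transpose_mat g = mat n n (\<lambda>(i, j). U i j)" .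
    have "mat n n (\<lambda>(i, j). U i j) * ?\<delta> = mat n n (\<lambda>(i, j). mat n n (\<lambda>(i, j). U i j) $$ (i, j) * (-1) ^ j)"
      by (rule mat_diag_mult_right) simp
    then show ?thesis unfolding 1 by (auto simp: mult.commute intro!: eq_matI)
  qed
  then have "twist n ?V = flag_of n (complex_mat (mat n n (\<lambda>(i, j). (-1) ^ j * U i j)))"
    unfolding twist_def the Let_def B BT by simp
  also have "\<dots> = flag_of n (complex_mat (mat n n (\<lambda>(i, j). U i j)))"
  proof (rule flag_of_triangular[where t = "\<lambda>s j. if s = j then (-1) ^ j else 0"])
    fix i j assume ij: "i < n" "j < n"
    have "(\<Sum>s<Suc j. complex_mat (mat n n (\<lambda>(i, j). U i j)) $$ (i, s) * (if s = j then (-1) ^ j else 0)) =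
      complex_mat (mat n n (\<lambda>(i, j). U i j)) $$ (i, j) * (-1) ^ j"
      by (simp add: if_distrib cong: if_cong)
    then show "complex_mat (mat n n (\<lambda>(i, j). (-1) ^ j * U i j)) $$ (i, j) =
      (\<Sum>s<Suc j. complex_mat (mat n n (\<lambda>(i, j). U i j)) $$ (i, s) * (if s = j then (-1) ^ j else 0))"
      using ij by (simp add: mult.commute del: sum.lessThan_Suc)
  qed auto
  finally show ?thesis .
qed

definition jacobi_eigensystem ::
    "nat \<Rightarrow> (nat \<Rightarrow> real) \<Rightarrow> (nat \<Rightarrow> real) \<Rightarrow> (nat \<Rightarrow> real) \<Rightarrow> (nat \<Rightarrow> nat \<Rightarrow> real) \<Rightarrow> bool" where
  "jacobi_eigensystem n a b \<mu> U \<longleftrightarrow>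
     (\<forall>i j. i < j \<longrightarrow> j < n \<longrightarrow> \<mu> i > \<mu> j) \<and>
     (\<forall>i<n. \<forall>j<n. (\<Sum>r<n. U r i * U r j) = (if i = j then 1 else 0)) \<and>
     (\<forall>i<n. \<forall>j<n. (\<Sum>r<n. U i r * U j r) = (if i = j then 1 else 0)) \<and>
     (\<forall>i<n. \<forall>c<n. (\<Sum>j<n. jacobi a b i j * U j c) = \<mu> c * U i c) \<and>
     (\<forall>c<n. U 0 c > 0) \<and> (\<forall>j<n. \<forall>c<n. U j c = U 0 c * poly (rec_poly a b j) (\<mu> c))"

lemma exists_jacobi_eigensystem:
  assumes a: "\<And>i. a i > 0"
  shows "\<exists>\<mu> U. jacobi_eigensystem n a b \<mu> U"
proof (rule jacobi_spectral[where a = a and b = b and n = n, OF a])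
  fix \<mu> U
  assume f: "\<And>i j. i < j \<Longrightarrow> j < n \<Longrightarrow> \<mu> i > \<mu> j"
    "\<And>i j. i < n \<Longrightarrow> j < n \<Longrightarrow> (\<Sum>r<n. U r i * U r j) = (if i = j then 1 else 0)"
    "\<And>i j. i < n \<Longrightarrow> j < n \<Longrightarrow> (\<Sum>r<n. U i r * U j r) = (if i = j then 1 else 0)"
    "\<And>i c. i < n \<Longrightarrow> c < n \<Longrightarrow> (\<Sum>j<n. jacobi a b i j * U j c) = \<mu> c * U i c"
    "\<And>c. c < n \<Longrightarrow> U 0 c > 0"
    "\<And>j c. j < n \<Longrightarrow> c < n \<Longrightarrow> U j c = U 0 c * poly (rec_poly a b j) (\<mu> c)"
  have "jacobi_eigensystem n a b \<mu> U" unfolding jacobi_eigensystem_def by (intro conjI allI impI f)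
  then show ?thesis by blast
qed

lemma jacobi_eigensystemD:
  assumes "jacobi_eigensystem n a b \<mu> U"
  shows "\<And>i j. i < j \<Longrightarrow> j < n \<Longrightarrow> \<mu> i > \<mu> j"
    and "\<And>i j. i < n \<Longrightarrow> j < n \<Longrightarrow> (\<Sum>r<n. U r i * U r j) = (if i = j then 1 else 0)"
    and "\<And>i j. i < n \<Longrightarrow> j < n \<Longrightarrow> (\<Sum>r<n. U i r * U j r) = (if i = j then 1 else 0)"
    and "\<And>i c. i < n \<Longrightarrow> c < n \<Longrightarrow> (\<Sum>j<n. jacobi a b i j * U j c) = \<mu> c * U i c"
    and "\<And>c. c < n \<Longrightarrow> U 0 c > 0"
    and "\<And>j c. j < n \<Longrightarrow> c < n \<Longrightarrow> U j c = U 0 c * poly (rec_poly a b j) (\<mu> c)"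
proof -
  note eqs = assms[unfolded jacobi_eigensystem_def]
  show "\<And>i j. i < j \<Longrightarrow> j < n \<Longrightarrow> \<mu> i > \<mu> j"
    by (rule eqs[THEN conjunct1, rule_format])
  show "\<And>i j. i < n \<Longrightarrow> j < n \<Longrightarrow> (\<Sum>r<n. U r i * U r j) = (if i = j then 1 else 0)"
    by (rule eqs[THEN conjunct2, THEN conjunct1, rule_format])
  show "\<And>i j. i < n \<Longrightarrow> j < n \<Longrightarrow> (\<Sum>r<n. U i r * U j r) = (if i = j then 1 else 0)"
    by (rule eqs[THEN conjunct2, THEN conjunct2, THEN conjunct1, rule_format])
  show "\<And>i c. i < n \<Longrightarrow> c < n \<Longrightarrow> (\<Sum>j<n. jacobi a b i j * U j c) = \<mu> c * U i c"
    by (rule eqs[THEN conjunct2, THEN conjunct2, THEN conjunct2, THEN conjunct1, rule_format])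
  show "\<And>c. c < n \<Longrightarrow> U 0 c > 0"
    by (rule eqs[THEN conjunct2, THEN conjunct2, THEN conjunct2, THEN conjunct2, THEN conjunct1, rule_format])
  show "\<And>j c. j < n \<Longrightarrow> c < n \<Longrightarrow> U j c = U 0 c * poly (rec_poly a b j) (\<mu> c)"
    by (rule eqs[THEN conjunct2, THEN conjunct2, THEN conjunct2, THEN conjunct2, THEN conjunct2, rule_format])
qed

lemma (in vec_space) col_space_basis:
  fixes A :: "'a mat"
  assumes A: "A \<in> carrier_mat n k" and rank: "rank A = k"
  shows "distinct (cols A)" and "vectorspace.basis class_ring (V\<lparr>carrier := col_space A\<rparr>) (set (cols A))"
proof -
  show dist: "distinct (cols A)" by (rule full_rank_distinct[OF A rank])
  have li: "lin_indpt (set (cols A))" by (rule full_rank_lin_indpt[OF A rank dist])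
  have sub: "set (cols A) \<subseteq> carrier_vec n" using A cols_dim by blast
  let ?W = "span (set (cols A))"
  have W: "subspace class_ring ?W V" using span_is_subspace sub by auto
  then have subm: "submodule class_ring ?W V" by (simp add: subspace_def)
  have in_W: "set (cols A) \<subseteq> ?W" using in_own_span[of "set (cols A)"] sub by auto
  interpret W: vectorspace class_ring "vs ?W" using W by (rule subspace_is_vs)
  have "W.basis (set (cols A))"
    unfolding W.basis_def
    using span_li_not_depend(1)[OF in_W subm] span_li_not_depend(2)[OF in_W subm] li in_W by simp
  then show "vectorspace.basis class_ring (V\<lparr>carrier := col_space A\<rparr>) (set (cols A))"
    unfolding col_space_def .
qed

text \<open>The rows of \<open>Z\<close> are an invertible combination of the first
  \<open>k + m\<close> eigenvectors, and these span the corresponding subspace of the twist of the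
  Vandermonde flag with nodes \<open>\<mu>\<close> and weights \<open>U 0\<close>.\<close>

theorem twisted_vandermonde_of_stable:
  assumes Z: "Z \<in> carrier_mat (k + m) n" and l: "k + m \<le> n"
    and pos: "\<And>J. J \<in> ksets n (k + m) \<Longrightarrow> minor (k + m) (\<lambda>i r. Z $$ (r, i)) J > 0"
    and a: "\<And>i. a i > 0" and stable: "kernel_stable n (k + m) (\<lambda>r i. Z $$ (r, i)) a b"
  shows "twisted_vandermonde n k m Z"
proof -
  let ?l = "k + m"
  obtain \<mu> U where "jacobi_eigensystem n a b \<mu> U"
    using exists_jacobi_eigensystem[of a n b] a by blast
  note mono = jacobi_eigensystemD(1)[OF this] and cols = jacobi_eigensystemD(2)[OF this]
    and rows = jacobi_eigensystemD(3)[OF this] and eig = jacobi_eigensystemD(4)[OF this]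
    and U0 = jacobi_eigensystemD(5)[OF this] and Uq = jacobi_eigensystemD(6)[OF this]
  let ?z = "\<lambda>r i. Z $$ (r, i)"
  let ?P = "mat ?l ?l (\<lambda>(r, c). \<Sum>i<n. ?z r i * U i c)"
  have detP: "det ?P \<noteq> 0"
    by (rule stable_kernel_top_eigenspace(1)[OF a mono cols rows eig l pos stable])
  have zP: "?z r i = (\<Sum>c<?l. (\<Sum>x<n. ?z r x * U x c) * U i c)" if "r < ?l" "i < n" for r i
    by (rule stable_kernel_top_eigenspace(3)[OF a mono cols rows eig l pos stable that])
  define x where "x i = (if i < n then U 0 i else 1)" for i
  define V where "V = flag_of n (complex_mat (mat n n (\<lambda>(i, j). \<mu> i ^ j * x i)))"
  have V: "V \<in> positive_vandermonde_flags n"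
    unfolding positive_vandermonde_flags_def V_def
    by (intro CollectI exI[of _ \<mu>] exI[of _ x] conjI refl allI impI) (use mono U0 in \<open>auto simp: x_def\<close>)
  have "mat n n (\<lambda>(i, j). \<mu> i ^ j * x i) = mat n n (\<lambda>(i, j). \<mu> i ^ j * U 0 i)"
    by (intro eq_matI) (auto simp: x_def)
  then have tw: "twist n V = flag_of n (complex_mat (mat n n (\<lambda>(i, j). U i j)))"
    unfolding V_def using twist_vandermonde[OF a mono cols rows U0 Uq] by simp
  let ?U = "mat n ?l (\<lambda>(i, c). complex_of_real (U i c))"
  let ?Zt = "transpose_mat (complex_mat Z)" and ?Pt = "transpose_mat (complex_mat ?P)"
  have Uc: "?U \<in> carrier_mat n ?l" and Pt: "?Pt \<in> carrier_mat ?l ?l" and Zt: "?Zt \<in> carrier_mat n ?l" using Z by auto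
  have "det (complex_mat ?P) = complex_of_real (det ?P)" by (rule of_real_hom.hom_det)
  then have "det ?Pt \<noteq> 0" using detP det_transpose[of "complex_mat ?P" ?l] by simp
  have ZUP: "?Zt = ?U * ?Pt"
  proof (rule eq_matI)
    fix i r assume "i < dim_row (?U * ?Pt)" "r < dim_col (?U * ?Pt)"
    then have ir: "i < n" "r < ?l" by auto
    have "(?U * ?Pt) $$ (i, r) = (\<Sum>c<?l. complex_of_real (U i c) * complex_of_real (\<Sum>x<n. ?z r x * U x c))"
      using ir by (simp add: scalar_prod_def atLeast0LessThan)
    also have "\<dots> = complex_of_real (?z r i)"
      unfolding zP[OF ir(2,1)] by (simp add: mult.commute)
    finally show "?Zt $$ (i, r) = (?U * ?Pt) $$ (i, r)" using ir Z by simp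
  qed (use Z in auto)
  have "twist n V ?l = vec_space.col_space n ?U"
  proof -
    have "mat n ?l (\<lambda>(i, c). complex_mat (mat n n (\<lambda>(i, j). U i j)) $$ (i, c)) = ?U"
      using l by (intro eq_matI) auto
    then show ?thesis unfolding tw using flag_of_conv[of "complex_mat (mat n n (\<lambda>(i, j). U i j))" n ?l] l by simp
  qed
  also have "\<dots> = vec_space.col_space n ?Zt"
    unfolding ZUP by (rule col_space_mult_invertible[symmetric, OF Uc Pt \<open>det ?Pt \<noteq> 0\<close>])
  finally have space: "twist n V ?l = vec_space.col_space n ?Zt" .
  have rank: "vec_space.rank n ?Zt = ?l"
  proof -
    obtain R where R: "R \<in> carrier_mat ?l ?l" "R * ?Pt = 1\<^sub>m ?l"
      using mat_inverse_obtain[OF Pt \<open>det ?Pt \<noteq> 0\<close>] by blast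
    have UU: "transpose_mat ?U * ?U = 1\<^sub>m ?l"
    proof (rule eq_matI)
      fix i j assume "i < dim_row (1\<^sub>m ?l :: complex mat)" "j < dim_col (1\<^sub>m ?l :: complex mat)"
      then have ij: "i < ?l" "j < ?l" by auto
      have "(transpose_mat ?U * ?U) $$ (i, j) = complex_of_real (\<Sum>r<n. U r i * U r j)"
        using ij by (simp add: scalar_prod_def atLeast0LessThan)
      then show "(transpose_mat ?U * ?U) $$ (i, j) = (1\<^sub>m ?l) $$ (i, j)"
        using ij l cols[of i j] by simp
    qed auto
    have "(R * transpose_mat ?U) * ?Zt = R * (transpose_mat ?U * (?U * ?Pt))"
      unfolding ZUP using R Uc Pt by (intro assoc_mult_mat[of _ ?l ?l _ n _ ?l]) auto
    also have "transpose_mat ?U * (?U * ?Pt) = (transpose_mat ?U * ?U) * ?Pt"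
      using Uc Pt by (intro assoc_mult_mat[symmetric, of _ ?l n _ ?l _ ?l]) auto
    also have "R * \<dots> = 1\<^sub>m ?l" unfolding UU using R Pt by simp
    finally have "(R * transpose_mat ?U) * ?Zt = 1\<^sub>m ?l" .
    then show ?thesis using R Uc by (intro rank_left_inverse[OF Zt, of "R * transpose_mat ?U"]) auto
  qed
  have rc: "rows (complex_mat Z) = Matrix.cols ?Zt" by simp
  show ?thesis
    unfolding twisted_vandermonde_def
  proof (intro bexI[OF _ V] conjI)
    show "distinct (rows (complex_mat Z))"
      unfolding rc by (rule vec_space.col_space_basis(1)[OF Zt rank])
    show "vectorspace.basis class_ring ((module_vec TYPE(complex) n)\<lparr>carrier := twist n V ?l\<rparr>)
        (set (rows (complex_mat Z)))"
      unfolding rc space by (rule vec_space.col_space_basis(2)[OF Zt rank])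
  qed
qed

section \<open>Compact sets contracted by anisotropic dilations\<close>

definition fin_supp :: "nat \<Rightarrow> (nat \<Rightarrow> real) set" where
  "fin_supp d = {x. \<forall>i\<ge>d. x i = 0}"

lemma Euclidean_space_eq: "Euclidean_space d = top_of_set (fin_supp d)"
  unfolding Euclidean_space_def fin_supp_def euclidean_product_topology ..

lemma closed_fin_supp: "closed (fin_supp d)"
proof -
  have "fin_supp d = (\<Inter>i\<in>{d..}. {x. x i = 0})" by (auto simp: fin_supp_def)
  moreover have "closed {x :: nat \<Rightarrow> real. x i = 0}" for i
    by (rule closed_Collect_eq) (auto intro!: continuous_intros)
  ultimately show ?thesis by auto
qed

lemma compact_box_fun:
  fixes K :: "nat \<Rightarrow> real set"
  assumes "\<And>i. compact (K i)" shows "compact {x. \<forall>i. x i \<in> K i}"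
proof -
  have "compactin (product_topology (\<lambda>_. euclidean) UNIV) (PiE UNIV K)"
    unfolding compactin_PiE using assms by simp
  then show ?thesis unfolding euclidean_product_topology compactin_euclidean_iff
    by (simp add: PiE_UNIV_domain Pi_def)
qed

lemma continuous_on_apply: "continuous_on S (\<lambda>x :: nat \<Rightarrow> real. x i)"
  by (rule continuous_on_subset[OF continuous_on_product_coordinates]) auto

lemma tendsto_fun:
  fixes f :: "'a \<Rightarrow> nat \<Rightarrow> real"
  assumes "\<And>i. ((\<lambda>s. f s i) \<longlongrightarrow> l i) F" shows "(f \<longlongrightarrow> l) F"
proof -
  have "limitin (product_topology (\<lambda>_. euclidean) UNIV) f l F"
    unfolding limitin_componentwise using assms by (simp add: limitin_canonical_iff)
  then show ?thesis unfolding euclidean_product_topology limitin_canonical_iff .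
qed

lemma compact_coord_bound:
  fixes Q :: "(nat \<Rightarrow> real) set"
  assumes "compact Q" obtains B where "\<And>x. x \<in> Q \<Longrightarrow> \<bar>x i\<bar> \<le> B"
proof -
  have "compact ((\<lambda>x. x i) ` Q)"
    by (rule compact_continuous_image[OF continuous_on_apply assms])
  then obtain B where "\<And>y. y \<in> (\<lambda>x. x i) ` Q \<Longrightarrow> \<bar>y\<bar> \<le> B"
    using compact_imp_bounded bounded_iff by (metis real_norm_def)
  then show ?thesis using that by blast
qed

definition dil :: "(nat \<Rightarrow> real) \<Rightarrow> real \<Rightarrow> (nat \<Rightarrow> real) \<Rightarrow> nat \<Rightarrow> real" where
  "dil c s x = (\<lambda>i. s powr c i * x i)"

lemma dil_fin_supp: "x \<in> fin_supp d \<Longrightarrow> dil c s x \<in> fin_supp d"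
  by (simp add: fin_supp_def dil_def)

lemma dil_dil: "s > 0 \<Longrightarrow> t > 0 \<Longrightarrow> dil c s (dil c t x) = dil c (s * t) x"
  by (simp add: dil_def powr_mult fun_eq_iff)

lemma dil_1: "dil c 1 x = x"
  by (simp add: dil_def fun_eq_iff)

lemma dil_zero: "dil c s (\<lambda>_. 0) = (\<lambda>_. 0)"
  by (simp add: dil_def)

lemma continuous_on_fun:
  fixes f :: "'a::topological_space \<Rightarrow> nat \<Rightarrow> real"
  assumes "\<And>i. continuous_on S (\<lambda>x. f x i)" shows "continuous_on S f"
  using assms by (rule continuous_on_coordinatewise_then_product)

lemma continuous_on_dil: "continuous_on S (dil c s)"
  unfolding dil_def by (intro continuous_on_fun continuous_intros continuous_on_apply)

text \<open>The curves along which \<open>s\<close> varies in \<open>dil c s x\<close> replace the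
  rays of a convex body; by \<open>shrink\<close>, each of them meets the boundary at most
  once.\<close>

locale dilation_body =
  fixes d :: nat and c :: "nat \<Rightarrow> real" and Q :: "(nat \<Rightarrow> real) set"
  assumes c_pos: "\<And>i. i < d \<Longrightarrow> c i > 0"
    and comp: "compact Q" and sub: "Q \<subseteq> fin_supp d" and ne: "Q \<noteq> {}"
    and shrink: "\<And>s x. 0 < s \<Longrightarrow> s < 1 \<Longrightarrow> x \<in> Q \<Longrightarrow>
      dil c s x \<in> top_of_set (fin_supp d) interior_of Q"
begin

abbreviation "E \<equiv> fin_supp d"
abbreviation "IQ \<equiv> top_of_set E interior_of Q"

lemma IQ_sub: "IQ \<subseteq> Q" by (rule interior_of_subset)

lemma closedQ: "closed Q" using comp compact_imp_closed by blast

lemma open_IQ: obtains O' where "open O'" "IQ = E \<inter> O'"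
  using openin_interior_of[of "top_of_set E" Q] openin_open by metis

lemma dil_tendsto_0:
  assumes "x \<in> E" shows "((\<lambda>s. dil c (1 / s) x) \<longlongrightarrow> (\<lambda>_. 0)) at_top"
proof (rule tendsto_fun)
  fix i show "((\<lambda>s. dil c (1 / s) x i) \<longlongrightarrow> 0) at_top"
  proof (cases "i < d")
    case True
    have "((\<lambda>s. s powr (- c i)) \<longlongrightarrow> 0) at_top"
      by (rule tendsto_neg_powr) (use c_pos[OF True] filterlim_ident in auto)
    then have "((\<lambda>s. s powr (- c i) * x i) \<longlongrightarrow> 0) at_top" by (rule tendsto_mult_left_zero)
    then show ?thesis
    proof (rule Lim_transform_eventually)
      show "\<forall>\<^sub>F s in at_top. s powr (- c i) * x i = dil c (1 / s) x i"
        using eventually_gt_at_top[of "0::real"]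
        by eventually_elim (simp add: dil_def powr_minus powr_divide divide_simps)
    qed
  next
    case False
    then have "x i = 0" using assms by (simp add: fin_supp_def)
    then show ?thesis by (simp add: dil_def)
  qed
qed

text \<open>The dilates of any point of \<open>Q\<close> stay in \<open>Q\<close> and tend to 0, so
  0 belongs to the closed set \<open>Q\<close>. Dilations fix 0, and \<open>shrink\<close> puts it
  into the interior.\<close>

lemma zero_in_IQ: "(\<lambda>_. 0) \<in> IQ"
proof -
  obtain q where q: "q \<in> Q" using ne by blast
  have "(\<lambda>_. 0) \<in> Q"
  proof (rule Lim_in_closed_set[OF closedQ])
    show "\<forall>\<^sub>F s in at_top. dil c (1 / s) q \<in> Q"
      using eventually_gt_at_top[of "1::real"]
    proof eventually_elim
      case (elim s)
      then show ?case using shrink[of "1 / s" q] q IQ_sub by auto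
    qed
    show "((\<lambda>s. dil c (1 / s) q) \<longlongrightarrow> (\<lambda>_. 0)) at_top" using dil_tendsto_0 q sub by blast
  qed auto
  from shrink[OF _ _ this, of "1 / 2"] show ?thesis by (simp add: dil_zero)
qed

text \<open>The Minkowski functional of \<open>Q\<close> for the dilations \<open>dil\<close>.\<close>

definition gauge where "gauge x = Inf {s. s > 0 \<and> dil c (1 / s) x \<in> Q}"

lemma absorb:
  assumes "x \<in> E" obtains s where "s > 0" "dil c (1 / s) x \<in> Q"
proof -
  obtain O' where O': "open O'" "IQ = E \<inter> O'" by (rule open_IQ)
  have "\<forall>\<^sub>F s in at_top. dil c (1 / s) x \<in> O'"
    using topological_tendstoD[OF dil_tendsto_0[OF assms] O'(1)] zero_in_IQ O'(2) by auto
  then have "\<forall>\<^sub>F s in at_top. dil c (1 / s) x \<in> O' \<and> s > (0::real)"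
    using eventually_gt_at_top eventually_conj by blast
  then obtain s where "dil c (1 / s) x \<in> O'" "s > (0::real)"
    using eventually_happens'[OF trivial_limit_at_top_linorder] by fastforce
  then show ?thesis using that O'(2) IQ_sub dil_fin_supp[OF assms] by blast
qed

lemma gauge_lessD:
  assumes "x \<in> E" "gauge x < r"
  shows "\<exists>s>0. s < r \<and> dil c (1 / s) x \<in> Q"
proof -
  let ?S = "{s. s > 0 \<and> dil c (1 / s) x \<in> Q}"
  obtain s where "s > 0" "dil c (1 / s) x \<in> Q" by (rule absorb[OF assms(1)])
  then have "?S \<noteq> {}" by blast
  from cInf_lessD[OF this] assms(2) show ?thesis unfolding gauge_def by auto
qed

lemma bdd_gauge: "bdd_below {s. s > 0 \<and> dil c (1 / s) x \<in> Q}"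
  by (rule bdd_belowI[of _ 0]) auto

lemma gauge_nonneg: "x \<in> E \<Longrightarrow> gauge x \<ge> 0"
  unfolding gauge_def using absorb[of x] by (intro cInf_greatest) auto

lemma scaled_in_IQ:
  assumes "0 < s" "s < r" "dil c (1 / s) x \<in> Q" shows "dil c (1 / r) x \<in> IQ"
  using shrink[of "s / r" "dil c (1 / s) x"] assms by (simp add: dil_dil)

text \<open>The infimum is attained: every \<open>s > r\<close> is admissible, and \<open>Q\<close>
  is closed, so \<open>s\<close> may decrease to \<open>r\<close>.\<close>

lemma gauge_le_iff:
  assumes x: "x \<in> E" and r: "r > 0" shows "gauge x \<le> r \<longleftrightarrow> dil c (1 / r) x \<in> Q"
proof
  assume "dil c (1 / r) x \<in> Q"
  then show "gauge x \<le> r" unfolding gauge_def using r bdd_gauge by (intro cInf_lower) auto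
next
  assume le: "gauge x \<le> r"
  have gt: "dil c (1 / s) x \<in> Q" if s: "s > r" for s
  proof -
    have "gauge x < s" using le s by linarith
    then obtain s' where "s' > 0" "s' < s" "dil c (1 / s') x \<in> Q" using gauge_lessD[OF x] by blast
    then have "dil c (1 / s) x \<in> IQ" by (rule scaled_in_IQ)
    then show ?thesis using IQ_sub by blast
  qed
  show "dil c (1 / r) x \<in> Q"
  proof (rule Lim_in_closed_set[OF closedQ])
    show "((\<lambda>s. dil c (1 / s) x) \<longlongrightarrow> dil c (1 / r) x) (at_right r)"
    proof (rule tendsto_fun)
      fix i show "((\<lambda>s. dil c (1 / s) x i) \<longlongrightarrow> dil c (1 / r) x i) (at_right r)"
        unfolding dil_def using r by (auto intro!: tendsto_intros)
    qed
    show "\<forall>\<^sub>F s in at_right r. dil c (1 / s) x \<in> Q"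
      using eventually_at_right_less[of r] by eventually_elim (rule gt)
  qed auto
qed

text \<open>The counterpart for the interior: it is relatively open, so \<open>r\<close> may be
  lowered a little without leaving \<open>Q\<close>.\<close>

lemma gauge_less_iff:
  assumes x: "x \<in> E" and r: "r > 0" shows "gauge x < r \<longleftrightarrow> dil c (1 / r) x \<in> IQ"
proof
  assume "gauge x < r"
  then obtain s where "s > 0" "s < r" "dil c (1 / s) x \<in> Q" using gauge_lessD[OF x] by blast
  then show "dil c (1 / r) x \<in> IQ" by (rule scaled_in_IQ)
next
  assume in_IQ: "dil c (1 / r) x \<in> IQ"
  obtain O' where O': "open O'" "IQ = E \<inter> O'" by (rule open_IQ)
  have "((\<lambda>s. dil c (1 / s) x) \<longlongrightarrow> dil c (1 / r) x) (at_left r)"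
  proof (rule tendsto_fun)
    fix i show "((\<lambda>s. dil c (1 / s) x i) \<longlongrightarrow> dil c (1 / r) x i) (at_left r)"
      unfolding dil_def using r by (auto intro!: tendsto_intros)
  qed
  then have "\<forall>\<^sub>F s in at_left r. dil c (1 / s) x \<in> O'"
    using topological_tendstoD[OF _ O'(1)] in_IQ O'(2) by auto
  moreover have "\<forall>\<^sub>F s in at_left r. s \<in> {0<..<r}" using eventually_at_left_real[OF r] .
  ultimately have "\<forall>\<^sub>F s in at_left r. dil c (1 / s) x \<in> O' \<and> s \<in> {0<..<r}" by (rule eventually_conj)
  then obtain s where s: "dil c (1 / s) x \<in> O'" "0 < s" "s < r"
    using eventually_happens'[OF trivial_limit_at_left_real] by fastforce
  then have "dil c (1 / s) x \<in> Q" using O'(2) IQ_sub dil_fin_supp[OF x] by blast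
  then show "gauge x < r" using gauge_le_iff[OF x s(2)] s(3) by linarith
qed

lemma Q_eq: "Q = {x \<in> E. gauge x \<le> 1}"
  using sub gauge_le_iff[of _ 1] by (auto simp: dil_1)

lemma IQ_eq: "IQ = {x \<in> E. gauge x < 1}"
  using sub IQ_sub gauge_less_iff[of _ 1] by (auto simp: dil_1)

lemma gauge_dil:
  assumes x: "x \<in> E" and s: "s > 0" shows "gauge (dil c s x) = s * gauge x"
proof -
  have iff: "gauge (dil c s x) \<le> r \<longleftrightarrow> s * gauge x \<le> r" if r: "r > 0" for r
  proof -
    have "gauge (dil c s x) \<le> r \<longleftrightarrow> dil c (1 / (r / s)) x \<in> Q"
      using gauge_le_iff[OF dil_fin_supp[OF x] r] r s by (simp add: dil_dil)
    also have "\<dots> \<longleftrightarrow> gauge x \<le> r / s" using gauge_le_iff[OF x, of "r / s"] r s by simp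
    finally show ?thesis using s by (simp add: pos_le_divide_eq mult.commute)
  qed
  have nn: "gauge (dil c s x) \<ge> 0" "s * gauge x \<ge> 0"
    using gauge_nonneg x dil_fin_supp s by (auto intro!: mult_nonneg_nonneg)
  show ?thesis
  proof (rule antisym; rule field_le_epsilon)
    fix e :: real assume e: "e > 0"
    show "gauge (dil c s x) \<le> s * gauge x + e" using iff[of "s * gauge x + e"] nn e by simp
    show "s * gauge x \<le> gauge (dil c s x) + e" using iff[of "gauge (dil c s x) + e"] nn e by simp
  qed
qed

lemma gauge_zero: "gauge (\<lambda>_. 0) = 0"
proof -
  have z: "(\<lambda>_. 0) \<in> E" using zero_in_IQ IQ_sub sub by blast
  have "gauge (\<lambda>_. 0) = 2 * gauge (\<lambda>_. 0)" using gauge_dil[OF z, of 2] by (simp add: dil_zero)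
  then show ?thesis by simp
qed

lemma gauge_eq_0_iff:
  assumes x: "x \<in> E" shows "gauge x = 0 \<longleftrightarrow> x = (\<lambda>_. 0)"
proof
  assume g: "gauge x = 0"
  show "x = (\<lambda>_. 0)"
  proof (rule ext, rule ccontr)
    fix i assume xi: "x i \<noteq> 0"
    have i: "i < d" using x xi unfolding fin_supp_def by (metis (mono_tags, lifting) mem_Collect_eq not_less)
    obtain B where B: "\<And>y. y \<in> Q \<Longrightarrow> \<bar>y i\<bar> \<le> B" using compact_coord_bound[OF comp] by blast
    have B0: "B \<ge> 0" using B[of "\<lambda>_. 0"] zero_in_IQ IQ_sub by auto
    \<comment> \<open>Chosen so that coordinate \<open>i\<close> of \<open>dil c s x\<close> has
      absolute value \<open>B + 1\<close>, beyond the bound for \<open>Q\<close>.\<close>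
    define s where "s = ((B + 1) / \<bar>x i\<bar>) powr (1 / c i)"
    have s: "s > 0" using xi B0 by (simp add: s_def)
    have sc: "s powr c i = (B + 1) / \<bar>x i\<bar>"
      using c_pos[OF i] xi B0 by (simp add: s_def powr_powr)
    have "gauge x \<le> 1 / s" using g s by simp
    then have "dil c s x \<in> Q" using gauge_le_iff[OF x, of "1 / s"] s by simp
    then have "\<bar>s powr c i * x i\<bar> \<le> B" using B by (fastforce simp: dil_def)
    then show False using xi B0 by (simp add: abs_mult sc)
  qed
qed (use gauge_zero in simp)

lemma gauge_pos: "x \<in> E \<Longrightarrow> x \<noteq> (\<lambda>_. 0) \<Longrightarrow> gauge x > 0"
  using gauge_nonneg gauge_eq_0_iff by (metis less_eq_real_def)

text \<open>For positive \<open>a\<close> the strict and weak sublevel sets are preimages of the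
  interior and of \<open>Q\<close> under one dilation, hence open and closed; for other
  \<open>a\<close> they contain at most the origin.\<close>

lemma continuous_gauge: "continuous_on E gauge"
proof -
  have "continuous_map (top_of_set E) euclideanreal gauge"
    unfolding continuous_map_upper_lower_semicontinuous_lte
  proof (intro conjI allI)
    fix a
    show "openin (top_of_set E) {x \<in> topspace (top_of_set E). gauge x < a}"
    proof (cases "a > 0")
      case True
      have "{x \<in> topspace (top_of_set E). gauge x < a} = E \<inter> dil c (1 / a) -` IQ"
        using gauge_less_iff[OF _ True] by auto
      moreover obtain O' where O': "open O'" "IQ = E \<inter> O'" by (rule open_IQ)
      moreover have "E \<inter> dil c (1 / a) -` IQ = E \<inter> dil c (1 / a) -` O'" using O' dil_fin_supp by auto
      ultimately show ?thesis
        using continuous_openin_preimage_gen[OF continuous_on_dil[of E c "1 / a"]] by simp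
    next
      case False
      then have eq: "{x \<in> topspace (top_of_set E). gauge x < a} = {}" using gauge_nonneg by fastforce
      show ?thesis unfolding eq by simp
    qed
    show "closedin (top_of_set E) {x \<in> topspace (top_of_set E). gauge x \<le> a}"
    proof (cases "a > 0")
      case True
      have "{x \<in> topspace (top_of_set E). gauge x \<le> a} = E \<inter> dil c (1 / a) -` Q"
        using gauge_le_iff[OF _ True] by auto
      then show ?thesis
        using continuous_closedin_preimage[OF continuous_on_dil[of E c "1 / a"] closedQ] by simp
    next
      case False
      have "{x \<in> topspace (top_of_set E). gauge x \<le> a} \<subseteq> {\<lambda>_. 0}"
        using gauge_nonneg gauge_eq_0_iff False by fastforce
      then have fin: "finite {x \<in> topspace (top_of_set E). gauge x \<le> a}" using finite_subset by blast
      then show ?thesis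
        by (intro closed_subset finite_imp_closed) auto
    qed
  qed
  then show ?thesis by simp
qed

end

section \<open>Comparing the gauges of two bodies\<close>

locale two_bodies = P: dilation_body d c Q + P': dilation_body d c Q' for d c Q Q'
begin

text \<open>Moves \<open>x\<close> along its own dilation orbit to the point whose gauge for
  \<open>Q'\<close> equals the gauge of \<open>x\<close> for \<open>Q\<close>. At the origin the
  ratio is \<open>0 / 0 = 0\<close>, and the origin stays fixed.\<close>

definition rescale where "rescale x = dil c (P.gauge x / P'.gauge x) x"

lemma rescale_in: "x \<in> fin_supp d \<Longrightarrow> rescale x \<in> fin_supp d"
  by (simp add: rescale_def dil_fin_supp)

lemma rescale_zero: "rescale (\<lambda>_. 0) = (\<lambda>_. 0)"
  by (simp add: rescale_def dil_zero)

lemma gauge_rescale: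
  assumes x: "x \<in> fin_supp d" shows "P'.gauge (rescale x) = P.gauge x"
proof (cases "x = (\<lambda>_. 0)")
  case False
  then have "P'.gauge x > 0" "P.gauge x > 0" using P.gauge_pos P'.gauge_pos x by auto
  then show ?thesis unfolding rescale_def by (simp add: P'.gauge_dil[OF x])
qed (simp add: rescale_zero P.gauge_zero P'.gauge_zero)

lemma gauge_rescale':
  assumes x: "x \<in> fin_supp d"  "x \<noteq> (\<lambda>_. 0)"
  shows "P.gauge (rescale x) = P.gauge x / P'.gauge x * P.gauge x"
  using P.gauge_pos[OF x] P'.gauge_pos[OF x] P.gauge_dil[OF x(1)] unfolding rescale_def by simp

text \<open>The ratio is invariant under dilations, so it is bounded by the maximum of one gauge on
  the other, compact body. This is what continuity of \<open>rescale\<close> at the origin rests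
  on.\<close>

lemma gauge_ratio_bound: obtains C where "\<And>x. x \<in> fin_supp d \<Longrightarrow> P.gauge x / P'.gauge x \<le> C"
proof -
  have "compact (P.gauge ` Q')"
    using P'.comp P.continuous_gauge P'.sub continuous_on_subset compact_continuous_image by metis
  then obtain C where C: "\<And>y. y \<in> Q' \<Longrightarrow> P.gauge y \<le> C"
    using compact_imp_bounded bounded_iff by (metis abs_le_D1 image_eqI real_norm_def)
  have "P.gauge x / P'.gauge x \<le> \<bar>C\<bar>" if x: "x \<in> fin_supp d" for x
  proof (cases "x = (\<lambda>_. 0)")
    case False
    then have p: "P'.gauge x > 0" using P'.gauge_pos x by auto
    then have "dil c (1 / P'.gauge x) x \<in> Q'" using P'.gauge_le_iff[OF x p] by simp
    then have "P.gauge (dil c (1 / P'.gauge x) x) \<le> C" by (rule C)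
    then show ?thesis using P.gauge_dil[OF x, of "1 / P'.gauge x"] p by simp
  qed (simp add: P.gauge_zero)
  then show ?thesis using that by blast
qed

lemma continuous_rescale: "continuous_on (fin_supp d) rescale"
proof (rule continuous_on_fun)
  fix i
  let ?E = "fin_supp d"
  show "continuous_on ?E (\<lambda>x. rescale x i)"
    unfolding continuous_on_def
  proof
    fix x assume x: "x \<in> ?E"
    have gt: "(P.gauge \<longlongrightarrow> P.gauge x) (at x within ?E)" "(P'.gauge \<longlongrightarrow> P'.gauge x) (at x within ?E)"
      using P.continuous_gauge P'.continuous_gauge x by (auto simp: continuous_on_def)
    have ct: "((\<lambda>y. y i) \<longlongrightarrow> x i) (at x within ?E)"
      using continuous_on_apply[of ?E i] x by (auto simp: continuous_on_def)
    show "((\<lambda>x. rescale x i) \<longlongrightarrow> rescale x i) (at x within ?E)"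
    proof (cases "x = (\<lambda>_. 0)")
      case False
      then have "P.gauge x > 0" "P'.gauge x > 0" using P.gauge_pos P'.gauge_pos x by auto
      then show ?thesis unfolding rescale_def dil_def
        by (intro tendsto_intros gt ct) auto
    next
      case True
      show ?thesis
      proof (cases "i < d")
        case i: True
        obtain C where C: "\<And>x. x \<in> ?E \<Longrightarrow> P.gauge x / P'.gauge x \<le> C" by (rule gauge_ratio_bound) blast
        \<comment> \<open>The gauge ratio need not converge at the origin, but being bounded it
          cannot prevent the coordinate from tending to 0.\<close>
        have bound: "norm (rescale y i) \<le> C powr c i * \<bar>y i\<bar>" if y: "y \<in> ?E" for y
        proof -
          have "0 \<le> P.gauge y / P'.gauge y" using P.gauge_nonneg P'.gauge_nonneg y by simp
          then have "(P.gauge y / P'.gauge y) powr c i \<le> C powr c i"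
            using C[OF y] P.c_pos[OF i] by (intro powr_mono2) auto
          then show ?thesis unfolding rescale_def dil_def by (simp add: abs_mult mult_right_mono)
        qed
        have "((\<lambda>y. C powr c i * \<bar>y i\<bar>) \<longlongrightarrow> C powr c i * \<bar>x i\<bar>) (at x within ?E)"
          by (intro tendsto_intros ct)
        then have "((\<lambda>y. C powr c i * \<bar>y i\<bar>) \<longlongrightarrow> 0) (at x within ?E)" using True by simp
        then have "((\<lambda>y. rescale y i) \<longlongrightarrow> 0) (at x within ?E)"
          by (rule Lim_null_comparison[rotated])
             (use bound in \<open>auto simp: eventually_at_filter intro!: always_eventually\<close>)
        then show ?thesis using True by (simp add: rescale_zero)
      next
        case False
        then have "rescale y i = 0" if "y \<in> ?E" for y using rescale_in[OF that] by (simp add: fin_supp_def)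
        then show ?thesis using x
          by (intro tendsto_eventually) (auto simp: eventually_at_filter)
      qed
    qed
  qed
qed

end

text \<open>Both maps move a point along the same orbit, and the two scaling factors are inverse to
  each other. The statement stands outside the locale because it needs both orders of the two
  bodies.\<close>

lemma rescale_inverse:
  assumes "two_bodies d c Q Q'" and x: "x \<in> fin_supp d"
  shows "two_bodies.rescale c Q' Q (two_bodies.rescale c Q Q' x) = x"
proof -
  interpret A: two_bodies d c Q Q' by fact
  interpret B: two_bodies d c Q' Q
    by (intro two_bodies.intro A.P.dilation_body_axioms A.P'.dilation_body_axioms)
  show ?thesis
  proof (cases "x = (\<lambda>_. 0)")
    case False
    then have p: "A.P.gauge x > 0" "A.P'.gauge x > 0" using A.P.gauge_pos A.P'.gauge_pos x by auto
    have "B.rescale (A.rescale x) = dil c (A.P'.gauge (A.rescale x) / A.P.gauge (A.rescale x)) (A.rescale x)"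
      by (rule B.rescale_def)
    also have "\<dots> = dil c (A.P'.gauge x / A.P.gauge x) (dil c (A.P.gauge x / A.P'.gauge x) x)"
      unfolding A.gauge_rescale[OF x] A.gauge_rescale'[OF x False] using p by (simp add: A.rescale_def)
    also have "\<dots> = x" using p by (simp add: dil_dil dil_1)
    finally show ?thesis .
  qed (simp add: A.rescale_zero B.rescale_zero)
qed

text \<open>All weights are positive, so a dilation with \<open>s < 1\<close> brings every nonzero
  coordinate closer to 0. The second claim is kept to identify the interior of the ball
  later.\<close>

lemma dilation_body_ball:
  assumes c: "\<And>i. i < d \<Longrightarrow> c i > 0"
  shows "dilation_body d c {x \<in> fin_supp d. (\<Sum>i<d. (x i)\<^sup>2) \<le> 1}"
    and "\<And>s x. 0 < s \<Longrightarrow> s < 1 \<Longrightarrow> x \<in> fin_supp d \<Longrightarrow> (\<Sum>i<d. (x i)\<^sup>2) \<le> 1 \<Longrightarrow> (\<Sum>i<d. (dil c s x i)\<^sup>2) < 1"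
proof -
  let ?B = "{x \<in> fin_supp d. (\<Sum>i<d. (x i)\<^sup>2) \<le> 1}"
  show shr: "(\<Sum>i<d. (dil c s x i)\<^sup>2) < 1"
    if s: "0 < s" "s < 1" and x: "x \<in> fin_supp d" "(\<Sum>i<d. (x i)\<^sup>2) \<le> 1" for s x
  proof (cases "\<exists>i<d. x i \<noteq> 0")
    case True
    have sc: "s powr c i < 1" if "i < d" for i using powr_less_mono'[of s 0 "c i"] s c[OF that] by simp
    have sq: "(dil c s x i)\<^sup>2 = (s powr c i)\<^sup>2 * (x i)\<^sup>2" for i by (simp add: dil_def power_mult_distrib)
    have sc2: "(s powr c i)\<^sup>2 < 1" if "i < d" for i
      using power_strict_mono[OF sc[OF that], of 2] by simp
    have "(\<Sum>i<d. (dil c s x i)\<^sup>2) < (\<Sum>i<d. (x i)\<^sup>2)"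
    proof (rule sum_strict_mono_ex1)
      show "\<forall>i\<in>{..<d}. (dil c s x i)\<^sup>2 \<le> (x i)\<^sup>2"
        unfolding sq using sc2 by (auto simp: less_imp_le intro!: mult_left_le_one_le)
      obtain i where i: "i < d" "x i \<noteq> 0" using True by blast
      then have "(s powr c i)\<^sup>2 * (x i)\<^sup>2 < 1 * (x i)\<^sup>2"
        using sc2[OF i(1)] by (intro mult_strict_right_mono) auto
      then show "\<exists>i\<in>{..<d}. (dil c s x i)\<^sup>2 < (x i)\<^sup>2"
        unfolding sq using i by (intro bexI[of _ i]) auto
    qed simp
    then show ?thesis using x by linarith
  qed (simp add: dil_def)
  have cont: "continuous_on UNIV (\<lambda>x :: nat \<Rightarrow> real. \<Sum>i<d. (x i)\<^sup>2)"
    by (intro continuous_intros continuous_on_apply)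
  have cl: "closed {x :: nat \<Rightarrow> real. (\<Sum>i<d. (x i)\<^sup>2) \<le> 1}"
    by (rule closed_Collect_le[OF cont]) (intro continuous_intros)
  have op: "open {x :: nat \<Rightarrow> real. (\<Sum>i<d. (x i)\<^sup>2) < 1}"
    by (rule open_Collect_less[OF cont]) (intro continuous_intros)
  have "?B = (fin_supp d \<inter> {x. (\<Sum>i<d. (x i)\<^sup>2) \<le> 1}) \<inter> {x. \<forall>i. x i \<in> {-1..1}}"
  proof -
    have "\<bar>x i\<bar> \<le> 1" if "x \<in> ?B" for x i
    proof (cases "i < d")
      case True
      have "(x i)\<^sup>2 \<le> (\<Sum>i<d. (x i)\<^sup>2)" using True by (intro member_le_sum) auto
      then have "(x i)\<^sup>2 \<le> 1" using that by simp
      then show ?thesis by (simp add: abs_square_le_1)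
    qed (use that in \<open>simp add: fin_supp_def\<close>)
    then show ?thesis by (auto simp: abs_le_iff minus_le_iff)
  qed
  then have comp: "compact ?B"
    using closed_Int_compact[OF closed_Int[OF closed_fin_supp cl] compact_box_fun[of "\<lambda>_. {-1..1}"]] by simp
  show "dilation_body d c ?B"
  proof
    fix s :: real and x assume s: "0 < s" "s < 1" and x: "x \<in> ?B"
    have "openin (top_of_set (fin_supp d)) (fin_supp d \<inter> {x. (\<Sum>i<d. (x i)\<^sup>2) < 1})"
      using op by (rule openin_open_Int)
    moreover have "dil c s x \<in> fin_supp d \<inter> {x. (\<Sum>i<d. (x i)\<^sup>2) < 1}"
      using shr[OF s] x dil_fin_supp by auto
    ultimately show "dil c s x \<in> top_of_set (fin_supp d) interior_of ?B"
      unfolding interior_of_def by (intro CollectI exI conjI) (assumption | force)+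
  next
    have "(\<lambda>_. 0) \<in> ?B" by (simp add: fin_supp_def)
    then show "?B \<noteq> {}" by blast
  qed (use c comp in auto)
qed

theorem dilation_body_homeomorphism:
  assumes "dilation_body d c Q"
  obtains h h' where "homeomorphic_maps (Euclidean_space d) (Euclidean_space d) h h'"
    "\<And>x. x \<in> fin_supp d \<Longrightarrow> x \<in> Q \<longleftrightarrow> (\<Sum>i<d. (h x i)\<^sup>2) \<le> 1"
    "\<And>x. x \<in> fin_supp d \<Longrightarrow> x \<in> Euclidean_space d interior_of Q \<longleftrightarrow> (\<Sum>i<d. (h x i)\<^sup>2) < 1"
proof -
  interpret A: dilation_body d c Q by fact
  let ?B = "{x \<in> fin_supp d. (\<Sum>i<d. (x i)\<^sup>2) \<le> 1}"
  interpret B: dilation_body d c ?B by (rule dilation_body_ball) (rule A.c_pos)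
  interpret AB: two_bodies d c Q ?B by unfold_locales
  interpret BA: two_bodies d c ?B Q by unfold_locales
  have hm: "homeomorphic_maps (Euclidean_space d) (Euclidean_space d) AB.rescale BA.rescale"
    unfolding homeomorphic_maps_def Euclidean_space_eq
    using AB.continuous_rescale BA.continuous_rescale AB.rescale_in BA.rescale_in
      rescale_inverse[OF AB.two_bodies_axioms] rescale_inverse[OF BA.two_bodies_axioms]
    by (auto simp: continuous_map_in_subtopology)
  have Q: "x \<in> Q \<longleftrightarrow> (\<Sum>i<d. (AB.rescale x i)\<^sup>2) \<le> 1" if x: "x \<in> fin_supp d" for x
  proof -
    have "x \<in> Q \<longleftrightarrow> AB.rescale x \<in> ?B"
      by (subst A.Q_eq, subst B.Q_eq) (simp add: x AB.rescale_in AB.gauge_rescale)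
    then show ?thesis using AB.rescale_in[OF x] by simp
  qed
  \<comment> \<open>A point of gauge below some \<open>s < 1\<close> is the image under the dilation
    by \<open>s\<close> of a point of the ball, hence strictly inside. Conversely, the open ball is
    relatively open and so lies in the interior.\<close>
  have B_int: "B.gauge y < 1 \<longleftrightarrow> (\<Sum>i<d. (y i)\<^sup>2) < 1" if y: "y \<in> fin_supp d" for y
  proof
    assume less: "B.gauge y < 1"
    obtain s where s: "B.gauge y < s" "s < 1" using dense[OF less] by blast
    have s0: "s > 0" using s B.gauge_nonneg[OF y] by linarith
    have "dil c (1 / s) y \<in> ?B" using B.gauge_le_iff[OF y s0] s by simp
    then have "(\<Sum>i<d. (dil c s (dil c (1 / s) y) i)\<^sup>2) < 1"
      using s0 s(2) by (intro dilation_body_ball(2)) (auto simp: A.c_pos)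
    then show "(\<Sum>i<d. (y i)\<^sup>2) < 1" using s0 by (simp add: dil_dil dil_1)
  next
    assume less: "(\<Sum>i<d. (y i)\<^sup>2) < 1"
    have "open {x :: nat \<Rightarrow> real. (\<Sum>i<d. (x i)\<^sup>2) < 1}"
      by (rule open_Collect_less) (intro continuous_intros continuous_on_apply)+
    then have "openin (top_of_set (fin_supp d)) (fin_supp d \<inter> {x. (\<Sum>i<d. (x i)\<^sup>2) < 1})"
      by (rule openin_open_Int)
    then have "y \<in> B.IQ" using less y
      unfolding interior_of_def by (intro CollectI exI conjI) (assumption | force)+
    then show "B.gauge y < 1" unfolding B.IQ_eq by simp
  qed
  have "x \<in> Euclidean_space d interior_of Q \<longleftrightarrow> (\<Sum>i<d. (AB.rescale x i)\<^sup>2) < 1" if x: "x \<in> fin_supp d" for x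
    unfolding Euclidean_space_eq A.IQ_eq
    using B_int[OF AB.rescale_in[OF x]] x by (simp add: AB.gauge_rescale)
  then show ?thesis using that[OF hm Q] by blast
qed

section \<open>Affine charts of the real Grassmannian\<close>

lemma continuous_map_times:
  fixes f g :: "'a \<Rightarrow> 'b::real_normed_algebra"
  assumes "continuous_map X euclidean f" "continuous_map X euclidean g"
  shows "continuous_map X euclidean (\<lambda>x. f x * g x)"
  using assms by (simp add: continuous_map_atin tendsto_mult)

lemma continuous_map_divide_field:
  fixes f g :: "'a \<Rightarrow> 'b::real_normed_field"
  assumes "continuous_map X euclidean f" "continuous_map X euclidean g" "\<And>x. x \<in> topspace X \<Longrightarrow> g x \<noteq> 0"
  shows "continuous_map X euclidean (\<lambda>x. f x / g x)"
  using assms by (simp add: continuous_map_atin tendsto_divide)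

lemma continuous_map_Re: "continuous_map X euclidean f \<Longrightarrow> continuous_map X euclidean (\<lambda>x. Re (f x))"
  by (simp add: continuous_map_atin tendsto_Re)

lemma continuous_map_of_real: "continuous_map X euclidean f \<Longrightarrow> continuous_map X euclidean (\<lambda>x. complex_of_real (f x))"
  by (simp add: continuous_map_atin tendsto_of_real)

lemma continuous_map_det:
  fixes f :: "'a \<Rightarrow> nat \<Rightarrow> nat \<Rightarrow> 'b::real_normed_field"
  assumes "\<And>i j. i < k \<Longrightarrow> j < k \<Longrightarrow> continuous_map X euclidean (\<lambda>x. f x i j)"
  shows "continuous_map X euclidean (\<lambda>x. det (mat k k (\<lambda>(i, j). f x i j)))"
proof -
  have "continuous_map X euclidean (\<lambda>x. \<Prod>i = 0..<k. f x i (p i))" if p: "p permutes {0..<k}" for p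
  proof -
    have "((\<lambda>x. \<Prod>i = 0..<k. f x i (p i)) \<longlongrightarrow> (\<Prod>i = 0..<k. f y i (p i))) (atin X y)" if "y \<in> topspace X" for y
      using assms permutes_lt[OF p] that by (intro tendsto_prod) (auto simp: continuous_map_atin)
    then show ?thesis by (simp add: continuous_map_atin)
  qed
  then show ?thesis
    unfolding det_mat by (intro continuous_map_sum continuous_map_times) (auto simp: finite_permutations)
qed

lemma continuous_map_frame_entry:
  assumes "i < n" "j < k"
  shows "continuous_map (frame_topology k n) euclidean (\<lambda>A. A $$ (i, j))"
proof -
  have "continuous_map (frame_topology k n) euclidean
      ((\<lambda>x. x (i, j)) \<circ> (\<lambda>A. \<lambda>ij\<in>{..<n} \<times> {..<k}. A $$ ij))"
    unfolding frame_topology_def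
    by (intro continuous_map_pullback continuous_map_product_projection) (use assms in auto)
  then show ?thesis using assms by (simp add: o_def)
qed

lemma continuous_map_into_frames:
  assumes "\<And>i j. i < n \<Longrightarrow> j < k \<Longrightarrow> continuous_map X euclidean (\<lambda>x. f x $$ (i, j))"
    and "\<And>x. x \<in> topspace X \<Longrightarrow> f x \<in> frames k n"
  shows "continuous_map X (frame_topology k n) f"
  unfolding frame_topology_def
proof (rule continuous_map_pullback')
  show "continuous_map X (product_topology (\<lambda>_. euclidean) ({..<n} \<times> {..<k}))
      ((\<lambda>A. \<lambda>ij\<in>{..<n} \<times> {..<k}. A $$ ij) \<circ> f)"
    unfolding continuous_map_componentwise using assms(1) by (auto simp: o_def)
qed (use assms(2) in auto)

text \<open>The graph of a linear map from the first \<open>k\<close> to the last \<open>m\<close>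
  coordinates. The map is flattened row by row, so that the chart is parametrized by
  \<open>Euclidean_space (k * m)\<close> and forgetting later rows means cutting off a tail.\<close>

definition chart_mat :: "nat \<Rightarrow> nat \<Rightarrow> (nat \<Rightarrow> real) \<Rightarrow> real mat" where
  "chart_mat k m y = mat (k + m) k (\<lambda>(r, c). if r < k then if r = c then 1 else 0 else y ((r - k) * k + c))"

lemma chart_mat_carrier [simp]: "chart_mat k m y \<in> carrier_mat (k + m) k"
  by (simp add: chart_mat_def)

lemma chart_mat_dim [simp]: "dim_row (chart_mat k m y) = k + m" "dim_col (chart_mat k m y) = k"
  by (simp_all add: chart_mat_def)

lemma chart_mat_top: "r < k \<Longrightarrow> c < k \<Longrightarrow> chart_mat k m y $$ (r, c) = (if r = c then 1 else 0)"
  and chart_mat_bottom: "i < m \<Longrightarrow> c < k \<Longrightarrow> chart_mat k m y $$ (k + i, c) = y (i * k + c)"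
  by (simp_all add: chart_mat_def)

definition chart :: "nat \<Rightarrow> nat \<Rightarrow> real mat \<Rightarrow> (nat \<Rightarrow> real) \<Rightarrow> complex vec set" where
  "chart k m P y = vec_space.col_space (k + m) (complex_mat (P * chart_mat k m y))"

definition chart_coord :: "real mat \<Rightarrow> nat \<Rightarrow> complex mat \<Rightarrow> nat \<Rightarrow> nat \<Rightarrow> complex" where
  "chart_coord R l A r c = (\<Sum>x<l. complex_of_real (R $$ (r, x)) * A $$ (x, c))"

text \<open>If \<open>R\<close> is the inverse of \<open>P\<close>, this is a Pluecker coordinate in
  the basis of the columns of \<open>P\<close>; for a frame \<open>A\<close> it is nonzero exactly
  when the column space is a graph over the first \<open>k\<close> of them.\<close>

definition chart_den :: "nat \<Rightarrow> nat \<Rightarrow> real mat \<Rightarrow> complex mat \<Rightarrow> complex" where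
  "chart_den k m R A = det (mat k k (\<lambda>(r, c). chart_coord R (k + m) A r c))"

text \<open>Cramer's rule: the coordinates of the chart are the quotients \<open>chart_num / chart_den\<close>.\<close>

definition chart_num :: "nat \<Rightarrow> nat \<Rightarrow> real mat \<Rightarrow> complex mat \<Rightarrow> nat \<Rightarrow> complex" where
  "chart_num k m R A t = det (mat k k (\<lambda>(r, c).
     chart_coord R (k + m) A (if r = t mod k then k + t div k else r) c))"

lemma chart_coord_mult:
  assumes "A \<in> carrier_mat l k" "N \<in> carrier_mat k k" "c < k"
  shows "chart_coord R l (A * N) r c = (\<Sum>j<k. chart_coord R l A r j * N $$ (j, c))"
proof -
  have "chart_coord R l (A * N) r c = (\<Sum>x<l. complex_of_real (R $$ (r, x)) * (\<Sum>j<k. A $$ (x, j) * N $$ (j, c)))"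
    unfolding chart_coord_def using assms
    by (intro sum.cong refl) (simp add: scalar_prod_def atLeast0LessThan)
  also have "\<dots> = (\<Sum>j<k. chart_coord R l A r j * N $$ (j, c))"
    unfolding chart_coord_def sum_distrib_left sum_distrib_right by (subst sum.swap) (simp add: mult_ac)
  finally show ?thesis .
qed

lemma det_rows_mult:
  fixes N :: "'a::comm_ring_1 mat"
  assumes N: "N \<in> carrier_mat k k"
  shows "det (mat k k (\<lambda>(r, c). \<Sum>j<k. f r j * N $$ (j, c))) = det (mat k k (\<lambda>(r, c). f r c)) * det N"
proof -
  have "mat k k (\<lambda>(r, c). \<Sum>j<k. f r j * N $$ (j, c)) = mat k k (\<lambda>(r, c). f r c) * N"
    using N by (intro eq_matI) (auto simp: scalar_prod_def atLeast0LessThan)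
  then show ?thesis using det_mult[of "mat k k (\<lambda>(r, c). f r c)" k N] N by simp
qed

lemma chart_den_mult:
  assumes A: "A \<in> carrier_mat (k + m) k" and N: "N \<in> carrier_mat k k"
  shows "chart_den k m R (A * N) = chart_den k m R A * det N"
    and "chart_num k m R (A * N) t = chart_num k m R A t * det N"
proof -
  show "chart_den k m R (A * N) = chart_den k m R A * det N"
    unfolding chart_den_def det_rows_mult[OF N, symmetric]
    by (intro det_mat_cong chart_coord_mult[OF A N])
  show "chart_num k m R (A * N) t = chart_num k m R A t * det N"
    unfolding chart_num_def det_rows_mult[OF N, symmetric]
    by (intro det_mat_cong chart_coord_mult[OF A N])
qed

lemma chart_coord_complex_mat:
  assumes "R \<in> carrier_mat l l" "M \<in> carrier_mat l k" "r < l" "c < k"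
  shows "chart_coord R l (complex_mat M) r c = complex_of_real ((R * M) $$ (r, c))"
  using assms by (simp add: chart_coord_def scalar_prod_def atLeast0LessThan)

lemma det_replace_unit_row:
  assumes "j < k"
  shows "det (mat k k (\<lambda>(r, c). if r = j then v c else if r = c then 1 else 0)) = (v j :: 'a::comm_ring_1)"
proof -
  have e: "(\<Sum>s<k. v s * (if s = c then 1 else 0)) = v c" if "c < k" for c
    using that by (simp add: if_distrib cong: if_cong)
  have "det (mat k k (\<lambda>(r, c). if r = j then v c else if r = c then 1 else 0)) =
    det (mat k k (\<lambda>(r, c). if r = j then \<Sum>s<k. v s * (if s = c then 1 else 0) else if r = c then 1 else 0))"
    by (rule det_mat_cong) (simp only: e)
  also have "\<dots> = (\<Sum>s<k. v s * det (mat k k (\<lambda>(r, c). if r = j then if s = c then 1 else 0 else if r = c then 1 else 0)))"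
    by (rule det_mat_row_sum) (use assms in auto)
  also have "\<dots> = (\<Sum>s<k. if s = j then v j else 0)"
  proof (rule sum.cong[OF refl])
    fix s assume s: "s \<in> {..<k}"
    show "v s * det (mat k k (\<lambda>(r, c). if r = j then if s = c then 1 else 0 else if r = c then 1 else 0)) =
      (if s = j then v j else 0)"
    proof (cases "s = j")
      case True
      have "det (mat k k (\<lambda>(r, c). if r = j then if s = c then 1 else 0 else if r = c then 1 else 0)) =
          det (mat k k (\<lambda>(r, c). if r = c then 1 else (0::'a)))"
        by (rule det_mat_cong) (use True in auto)
      then show ?thesis using True det_mat_delta[where 'a = 'a] by simp
    next
      case False
      have "det (mat k k (\<lambda>(r, c). if r = j then if s = c then 1 else 0 else if r = c then 1 else (0::'a))) = 0"
        by (rule det_mat_identical_rows[of s j]) (use False s assms in auto)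
      then show ?thesis using False by simp
    qed
  qed
  finally show ?thesis using assms by simp
qed

section \<open>The chart as an open embedding of Euclidean space\<close>

locale grassmannian_chart =
  fixes k m :: nat and P R :: "real mat"
  assumes P: "P \<in> carrier_mat (k + m) (k + m)" and R: "R \<in> carrier_mat (k + m) (k + m)"
    and RP: "R * P = 1\<^sub>m (k + m)" and PR: "P * R = 1\<^sub>m (k + m)"
begin

abbreviation "l \<equiv> k + m"
abbreviation "E \<equiv> fin_supp (k * m)"
abbreviation "X \<equiv> frame_topology k l"
abbreviation "G \<equiv> grassmannian_topology k l"
abbreviation "GR \<equiv> real_grassmannian_topology k l"
abbreviation "frame y \<equiv> complex_mat (P * chart_mat k m y)"

lemma frame_carrier: "frame y \<in> carrier_mat l k"
  using P by simp

lemma R_frame: "R * (P * chart_mat k m y) = chart_mat k m y"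
  using assoc_mult_mat[OF R P chart_mat_carrier, symmetric] RP left_mult_one_mat[OF chart_mat_carrier]
  by simp

lemma coord_frame:
  assumes "r < l" "c < k"
  shows "chart_coord R l (frame y) r c = complex_of_real (chart_mat k m y $$ (r, c))"
  using chart_coord_complex_mat[OF R _ assms, of "P * chart_mat k m y"] P by (simp add: R_frame)

lemma den_frame: "chart_den k m R (frame y) = 1"
proof -
  have "chart_den k m R (frame y) = det (mat k k (\<lambda>(r, c). if r = c then 1 else 0))"
    unfolding chart_den_def by (rule det_mat_cong) (simp add: coord_frame chart_mat_top)
  then show ?thesis by (simp add: det_mat_delta)
qed

lemma num_frame:
  assumes t: "t < k * m" shows "chart_num k m R (frame y) t = complex_of_real (y t)"
proof -
  have k: "k > 0" using t by (cases k) auto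
  have div: "t div k < m" using t by (simp add: less_mult_imp_div_less mult.commute)
  let ?j = "t mod k"
  have "chart_num k m R (frame y) t =
    det (mat k k (\<lambda>(r, c). if r = ?j then complex_of_real (y (t div k * k + c)) else if r = c then 1 else 0))"
    unfolding chart_num_def using div
    by (intro det_mat_cong) (simp add: coord_frame chart_mat_top chart_mat_bottom)
  also have "\<dots> = complex_of_real (y (t div k * k + ?j))"
    using k by (intro det_replace_unit_row) simp
  finally show ?thesis by simp
qed

lemma frame_in: "frame y \<in> frames k l"
proof -
  let ?L = "mat k l (\<lambda>(i, x). complex_of_real (R $$ (i, x)))"
  have "?L * frame y = 1\<^sub>m k"
  proof (rule eq_matI)
    fix i c assume "i < dim_row (1\<^sub>m k :: complex mat)" "c < dim_col (1\<^sub>m k :: complex mat)"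
    then have ic: "i < k" "c < k" by auto
    have "(?L * frame y) $$ (i, c) = chart_coord R l (frame y) i c"
      using ic carrier_matD[OF P] by (simp add: chart_coord_def scalar_prod_def atLeast0LessThan)
    then show "(?L * frame y) $$ (i, c) = (1\<^sub>m k) $$ (i, c)" using ic by (simp add: coord_frame chart_mat_top)
  qed (use P in auto)
  then have "vec_space.rank l (frame y) = k" by (intro rank_left_inverse[OF frame_carrier]) auto
  then show ?thesis using frame_carrier by (simp add: frames_def)
qed

lemma chart_real: "chart k m P y \<in> real_grassmannian k l"
proof -
  let ?L = "mat k l (\<lambda>(i, x). R $$ (i, x))"
  have M: "P * chart_mat k m y \<in> carrier_mat l k" using P by simp
  have "?L * (P * chart_mat k m y) = 1\<^sub>m k"
  proof (rule eq_matI)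
    fix i c assume "i < dim_row (1\<^sub>m k :: real mat)" "c < dim_col (1\<^sub>m k :: real mat)"
    then have ic: "i < k" "c < k" by auto
    have "(?L * (P * chart_mat k m y)) $$ (i, c) = (R * (P * chart_mat k m y)) $$ (i, c)"
      using ic carrier_matD[OF P] carrier_matD[OF R] by (simp add: scalar_prod_def)
    then show "(?L * (P * chart_mat k m y)) $$ (i, c) = (1\<^sub>m k) $$ (i, c)"
      unfolding R_frame using ic by (simp add: chart_mat_def)
  qed (use P in auto)
  then have "vec_space.rank l (P * chart_mat k m y) = k" by (intro rank_left_inverse[OF M]) auto
  then show ?thesis unfolding real_grassmannian_def chart_def using M by blast
qed

lemma continuous_apply: "continuous_map (top_of_set S) euclidean (\<lambda>y :: nat \<Rightarrow> real. y i)"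
  by (simp add: continuous_on_apply)

lemma frame_entry:
  assumes "i < l" "j < k"
  shows "frame y $$ (i, j) = (\<Sum>r<l. complex_of_real (P $$ (i, r)) *
    (if r < k then if r = j then 1 else 0 else complex_of_real (y ((r - k) * k + j))))"
  using assms carrier_matD[OF P]
  by (simp add: scalar_prod_def atLeast0LessThan) (intro sum.cong, auto simp: chart_mat_def)

lemma continuous_frame_entry:
  assumes "i < l" "j < k" "\<And>t. continuous_map Y euclidean (\<lambda>x. f x t)"
  shows "continuous_map Y euclidean (\<lambda>x. frame (f x) $$ (i, j))"
proof -
  have "continuous_map Y euclidean (\<lambda>x. if r < k then if r = j then 1 else 0 else complex_of_real (f x ((r - k) * k + j)))" for r
    using continuous_map_of_real[OF assms(3)] by (cases "r < k") auto
  then show ?thesis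
    unfolding frame_entry[OF assms(1,2)] by (intro continuous_map_sum continuous_map_times) auto
qed

lemma continuous_coord:
  assumes "r < l" "c < k"
  shows "continuous_map X euclidean (\<lambda>A. chart_coord R l A r c)"
  unfolding chart_coord_def
  by (intro continuous_map_sum continuous_map_times continuous_map_frame_entry) (use assms in auto)

lemma continuous_den: "continuous_map X euclidean (chart_den k m R)"
  unfolding chart_den_def[abs_def] by (intro continuous_map_det continuous_coord) auto

lemma continuous_num: "t < k * m \<Longrightarrow> continuous_map X euclidean (\<lambda>A. chart_num k m R A t)"
  unfolding chart_num_def
  by (intro continuous_map_det continuous_coord) (auto simp: less_mult_imp_div_less mult.commute)

lemma continuous_chart: "continuous_map (top_of_set E) G (chart k m P)"
proof -
  have "continuous_map (top_of_set E) X frame"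
    by (intro continuous_map_into_frames frame_in continuous_frame_entry continuous_apply)
  then have "continuous_map (top_of_set E) G (vec_space.col_space l \<circ> frame)"
    using quotient_imp_continuous_map[OF quotient_map_grassmannian] continuous_map_compose by blast
  then show ?thesis by (simp add: o_def chart_def[abs_def])
qed

abbreviation "frame_dom \<equiv> {A \<in> frames k l. chart_den k m R A \<noteq> 0}"

text \<open>Changing the frame multiplies numerator and denominator by the same nonzero determinant,
  so the domain and the quotients depend only on the subspace.\<close>

lemma dom_saturated:
  assumes "A \<in> frame_dom" "B \<in> frames k l" "vec_space.col_space l A = vec_space.col_space l B"
  shows "B \<in> frame_dom"
    and "chart_num k m R A t / chart_den k m R A = chart_num k m R B t / chart_den k m R B"
proof -
  have c: "A \<in> carrier_mat l k" "B \<in> carrier_mat l k" "vec_space.rank l A = k"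
    using assms by (auto simp: frames_def)
  obtain N where N: "N \<in> carrier_mat k k" "A = B * N" "det N \<noteq> 0"
    by (rule col_space_eq_factor[OF c(1,2,3)]) (use assms(3) in auto)
  show "B \<in> frame_dom" using assms(1,2) chart_den_mult(1)[OF c(2) N(1)] N(2) by auto
  show "chart_num k m R A t / chart_den k m R A = chart_num k m R B t / chart_den k m R B"
    unfolding N(2) chart_den_mult[OF c(2) N(1)] using N(3) by simp
qed

abbreviation "chart_dom \<equiv> vec_space.col_space l ` frame_dom"

lemma preimage_chart_dom: "{A \<in> topspace X. vec_space.col_space l A \<in> chart_dom} = frame_dom"
  unfolding topspace_frame_topology using dom_saturated(1) by auto

lemma topspace_G: "topspace G = grassmannian k l"
  using quotient_imp_surjective_map[OF quotient_map_grassmannian[of k l]]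
  by (simp add: topspace_frame_topology grassmannian_eq_col_spaces)

lemma open_chart_dom: "openin G chart_dom"
proof -
  have "openin X {A \<in> topspace X. chart_den k m R A \<in> - {0}}"
    by (rule openin_continuous_map_preimage[OF continuous_den]) auto
  then have "openin X frame_dom" by (simp add: topspace_frame_topology)
  have sub: "chart_dom \<subseteq> topspace G"
    unfolding topspace_G grassmannian_eq_col_spaces by auto
  have "openin X {A \<in> topspace X. vec_space.col_space l A \<in> U} = openin G U" if "U \<subseteq> topspace G" for U
    using quotient_map_grassmannian[of k l] that unfolding quotient_map_def by blast
  from this[OF sub, unfolded preimage_chart_dom] \<open>openin X frame_dom\<close> show ?thesis by (rule iffD1)
qed

text \<open>Defined on the whole complex chart domain, so that its continuity can be read off the
  quotient map from frames. \<open>Re\<close> matters only off the real subspaces; on those in the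
  chart this is the inverse of the chart.\<close>

definition unchart :: "complex vec set \<Rightarrow> nat \<Rightarrow> real" where
  "unchart W = (\<lambda>t. if t < k * m
     then let A = (SOME A. A \<in> frame_dom \<and> vec_space.col_space l A = W) in Re (chart_num k m R A t / chart_den k m R A)
     else 0)"

lemma unchart_col_space:
  assumes "A \<in> frame_dom"
  shows "unchart (vec_space.col_space l A) =
    (\<lambda>t. if t < k * m then Re (chart_num k m R A t / chart_den k m R A) else 0)"
proof -
  let ?B = "SOME B. B \<in> frame_dom \<and> vec_space.col_space l B = vec_space.col_space l A"
  have "?B \<in> frame_dom \<and> vec_space.col_space l ?B = vec_space.col_space l A"
    by (rule someI[of _ A]) (use assms in simp)
  then have "chart_num k m R ?B t / chart_den k m R ?B = chart_num k m R A t / chart_den k m R A" for t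
    using dom_saturated(2)[of ?B A t] assms by auto
  note eq = this
  show ?thesis unfolding unchart_def Let_def by (rule ext) (simp only: eq)
qed

lemma unchart_chart:
  assumes "y \<in> E" shows "unchart (chart k m P y) = y"
proof -
  have "frame y \<in> frame_dom" using frame_in den_frame by simp
  then show ?thesis unfolding chart_def unchart_col_space[OF \<open>frame y \<in> frame_dom\<close>]
    using assms by (auto simp: num_frame den_frame fin_supp_def fun_eq_iff)
qed

text \<open>The chart domain is open, so the quotient map restricts to a quotient map over it, and
  upstairs the coordinates are quotients of determinants.\<close>

lemma continuous_unchart: "continuous_map (subtopology G chart_dom) (top_of_set E) unchart"
proof -
  have q: "quotient_map (subtopology X frame_dom) (subtopology G chart_dom) (vec_space.col_space l)"
    by (rule quotient_map_restriction[OF quotient_map_grassmannian preimage_chart_dom])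
       (use open_chart_dom in blast)
  let ?f = "\<lambda>A t. if t < k * m then Re (chart_num k m R A t / chart_den k m R A) else 0"
  have "continuous_map (subtopology X frame_dom) (product_topology (\<lambda>_. euclidean) UNIV) ?f"
    unfolding continuous_map_componentwise
  proof (intro conjI ballI)
    fix t
    show "continuous_map (subtopology X frame_dom) euclidean (\<lambda>A. ?f A t)"
    proof (cases "t < k * m")
      case True
      have "continuous_map (subtopology X frame_dom) euclidean (\<lambda>A. Re (chart_num k m R A t / chart_den k m R A))"
      proof (intro continuous_map_Re continuous_map_divide_field)
        show "continuous_map (subtopology X frame_dom) euclidean (\<lambda>A. chart_num k m R A t)"
          by (rule continuous_map_from_subtopology[OF continuous_num[OF True]])
        show "continuous_map (subtopology X frame_dom) euclidean (chart_den k m R)"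
          by (rule continuous_map_from_subtopology[OF continuous_den])
      qed auto
      then show ?thesis using True by simp
    qed auto
  qed auto
  then have f: "continuous_map (subtopology X frame_dom) euclidean ?f"
    unfolding euclidean_product_topology .
  have "continuous_map (subtopology X frame_dom) (top_of_set E) ?f"
    by (rule continuous_map_into_subtopology[OF f]) (auto simp: fin_supp_def)
  then have "continuous_map (subtopology X frame_dom) (top_of_set E) (unchart \<circ> vec_space.col_space l)"
    by (rule continuous_map_eq) (auto simp: unchart_col_space)
  then show ?thesis by (rule continuous_compose_quotient_map[OF q])
qed

text \<open>For a real subspace in the domain, the top block of \<open>R * B\<close> is invertible
  for a real frame \<open>B\<close>. Dividing by it on the right puts the identity on top, and the
  rest is the real coordinate vector.\<close>

lemma chart_image: "chart k m P ` E = chart_dom \<inter> real_grassmannian k l"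
proof (intro equalityI subsetI)
  fix W assume "W \<in> chart k m P ` E"
  then obtain y where y: "W = chart k m P y" by blast
  have "frame y \<in> frame_dom" using frame_in den_frame by simp
  then show "W \<in> chart_dom \<inter> real_grassmannian k l" using chart_real[of y] unfolding y chart_def by auto
next
  fix W assume W: "W \<in> chart_dom \<inter> real_grassmannian k l"
  then obtain A where A: "A \<in> frame_dom" "W = vec_space.col_space l A" by blast
  obtain B where B: "B \<in> carrier_mat l k" "vec_space.rank l B = k" "W = vec_space.col_space l (complex_mat B)"
    using W unfolding real_grassmannian_def by blast
  have Bc: "complex_mat B \<in> carrier_mat l k" using B by simp
  \<comment> \<open>Only the real rank of \<open>B\<close> is given; the complex rank is read off
    the column space that \<open>B\<close> shares with \<open>A\<close>.\<close>
  have "vec_space.rank l (complex_mat B) = k"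
  proof -
    have "A \<in> carrier_mat l k" "vec_space.rank l A = k" using A by (auto simp: frames_def)
    then obtain N where N: "N \<in> carrier_mat k k" "A = complex_mat B * N" "det N \<noteq> 0"
      by (rule col_space_eq_factor[OF _ Bc]) (use A B in auto)
    have "vec_space.col_space l A = vec_space.col_space l (complex_mat B)" using A B by simp
    then show ?thesis using \<open>vec_space.rank l A = k\<close> by (simp add: vec_space.rank_def vec_space.col_space_def)
  qed
  then have "complex_mat B \<in> frame_dom" using dom_saturated(1)[OF A(1), of "complex_mat B"] A(2) B(3) Bc by (simp add: frames_def)
  define N where "N = mat k k (\<lambda>(r, c). (R * B) $$ (r, c))"
  have N: "N \<in> carrier_mat k k" by (simp add: N_def)
  have "chart_den k m R (complex_mat B) = complex_of_real (det N)"
  proof -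
    have "chart_den k m R (complex_mat B) = det (complex_mat N)"
      unfolding chart_den_def N_def
      by (intro arg_cong[where f = det] eq_matI) (auto simp: chart_coord_complex_mat[OF R B(1)] simp del: index_mult_mat)
    then show ?thesis by (simp add: of_real_hom.hom_det)
  qed
  then have "det N \<noteq> 0" using \<open>complex_mat B \<in> frame_dom\<close> by simp
  then obtain N' where N': "N' \<in> carrier_mat k k" "N * N' = 1\<^sub>m k"
    using mat_inverse_obtain[OF N] by blast
  define M where "M = R * B * N'"
  have M: "M \<in> carrier_mat l k" using R B N' by (simp add: M_def)
  define y where "y t = (if t < k * m then M $$ (k + t div k, t mod k) else 0)" for t
  have "chart_mat k m y = M"
  proof (rule eq_matI)
    fix r c assume "r < dim_row M" "c < dim_col M"
    then have rc: "r < l" "c < k" using M by auto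
    show "chart_mat k m y $$ (r, c) = M $$ (r, c)"
    proof (cases "r < k")
      case True
      have "M $$ (r, c) = row (R * B) r \<bullet> col N' c"
        unfolding M_def by (rule index_mult_mat(1)) (use rc R B N' in auto)
      also have "row (R * B) r = row N r"
        using True R B N by (intro eq_vecI) (auto simp: N_def)
      also have "row N r \<bullet> col N' c = (N * N') $$ (r, c)"
        by (rule index_mult_mat(1)[symmetric]) (use True rc N N' in auto)
      finally have "M $$ (r, c) = (N * N') $$ (r, c)" .
      then show ?thesis using True rc N'(2) by (simp add: chart_mat_def)
    next
      case False
      then have d: "r - k < m" using rc by simp
      then have "(r - k) * k + c < k * m" using rc
        by (metis add.commute less_mult_imp_div_less mod_less div_mult_self3 mult.commute mult_mono
            nat_less_add_iff1 add_mult_distrib less_eq_Suc_le mult_Suc add_less_mono1 less_le_trans mult_le_mono1)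
      then show ?thesis using False rc by (simp add: chart_mat_def y_def)
    qed
  qed (use M in auto)
  then have "P * chart_mat k m y = P * (R * (B * N'))" unfolding M_def using R B N' by (simp add: assoc_mult_mat)
  also have "\<dots> = (P * R) * (B * N')" using P R B N' by (intro assoc_mult_mat[symmetric]) auto
  also have "\<dots> = B * N'" using PR B N' by simp
  finally have PM: "P * chart_mat k m y = B * N'" .
  have "det (N * N') = 1" using N' by simp
  then have "det N' \<noteq> 0" using det_mult[OF N N'(1)] by auto
  have "chart k m P y = vec_space.col_space l (complex_mat B * complex_mat N')"
    unfolding chart_def PM using B N' by (simp add: of_real_hom.mat_hom_mult)
  also have "\<dots> = W"
    unfolding B(3) by (rule col_space_mult_invertible[OF Bc]) (use N' \<open>det N' \<noteq> 0\<close> in \<open>auto simp: of_real_hom.hom_det\<close>)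
  finally have "W = chart k m P y" by simp
  moreover have "y \<in> E" by (simp add: fin_supp_def y_def)
  ultimately show "W \<in> chart k m P ` E" by blast
qed

lemma open_chart_image: "openin GR (chart k m P ` E)"
  unfolding chart_image real_grassmannian_topology_def by (rule openin_subtopology_Int[OF open_chart_dom])

lemma chart_homeomorphism: "homeomorphic_maps (top_of_set E) (subtopology GR (chart k m P ` E)) (chart k m P) unchart"
  unfolding homeomorphic_maps_def
proof (intro conjI ballI)
  have s: "subtopology GR (chart k m P ` E) = subtopology G (chart k m P ` E)"
  proof -
    have "real_grassmannian k l \<inter> chart k m P ` E = chart k m P ` E" unfolding chart_image by blast
    then show ?thesis unfolding real_grassmannian_topology_def subtopology_subtopology by simp
  qed
  show "continuous_map (top_of_set E) (subtopology GR (chart k m P ` E)) (chart k m P)"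
    unfolding s by (rule continuous_map_into_subtopology[OF continuous_chart]) auto
  have "continuous_map (subtopology G (chart k m P ` E)) (top_of_set E) unchart"
    by (rule continuous_map_from_subtopology_mono[OF continuous_unchart]) (use chart_image in blast)
  then show "continuous_map (subtopology GR (chart k m P ` E)) (top_of_set E) unchart" unfolding s .
  show "unchart (chart k m P y) = y" if "y \<in> topspace (top_of_set E)" for y
    using unchart_chart that by simp
  show "chart k m P (unchart W) = W" if "W \<in> topspace (subtopology GR (chart k m P ` E))" for W
    using that unchart_chart by (auto simp: topspace_subtopology)
qed

text \<open>Closedness in the whole Grassmannian, not only in the chart, is needed for the frontier.
  It is checked on frames: \<open>A\<close> spans a point of the image iff some \<open>y\<close> in
  \<open>Q\<close> satisfies \<open>A = frame y * N\<close>, where \<open>N\<close> is the top block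
  of \<open>R\<close> times \<open>A\<close>. This is a closed condition on pairs, and projecting
  away the compact factor keeps it closed.\<close>

lemma closed_chart_image:
  assumes Q: "compact Q" "Q \<subseteq> E"
  shows "closedin GR (chart k m P ` Q)"
proof -
  let ?S = "{A \<in> topspace X. vec_space.col_space l A \<in> chart k m P ` Q}"
  let ?Z = "prod_topology (top_of_set Q) X"
  let ?T = "\<lambda>p i j. \<Sum>c<k. frame (fst p) $$ (i, c) * chart_coord R l (snd p) c j"
  let ?C = "\<lambda>i j. {p \<in> topspace ?Z. snd p $$ (i, j) = ?T p i j}"
  have closed: "closedin ?Z (?C i j)" if ij: "i < l" "j < k" for i j
  proof (rule closedin_continuous_maps_eq[OF Hausdorff_space_euclidean])
    have snd_X: "continuous_map ?Z X snd" by (rule continuous_map_snd)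
    show "continuous_map ?Z euclidean (\<lambda>p. snd p $$ (i, j))"
      using continuous_map_compose[OF snd_X continuous_map_frame_entry[OF ij]] by (simp add: o_def)
    have y: "continuous_map ?Z euclidean (\<lambda>p. fst p t)" for t
      using continuous_map_compose[OF continuous_map_fst continuous_apply] by (simp add: o_def)
    show "continuous_map ?Z euclidean (\<lambda>p. ?T p i j)"
    proof (intro continuous_map_sum continuous_map_times)
      fix c assume "c \<in> {..<k}"
      then show "continuous_map ?Z euclidean (\<lambda>p. frame (fst p) $$ (i, c))"
        using continuous_frame_entry[of i c ?Z fst] ij y by simp
      show "continuous_map ?Z euclidean (\<lambda>p. chart_coord R l (snd p) c j)"
        using continuous_map_compose[OF snd_X continuous_coord[of c j]] \<open>c \<in> {..<k}\<close> ij by (simp add: o_def)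
    qed auto
  qed
  have image: "?S = snd ` {p \<in> topspace ?Z. \<forall>i<l. \<forall>j<k. snd p $$ (i, j) = ?T p i j}"
  proof (intro equalityI subsetI)
    fix A assume A: "A \<in> ?S"
    then obtain y where y: "y \<in> Q" "vec_space.col_space l A = chart k m P y" by blast
    have Af: "A \<in> frames k l" using A by (simp add: topspace_frame_topology)
    then have Ac: "A \<in> carrier_mat l k" "vec_space.rank l A = k" by (auto simp: frames_def)
    obtain N where N: "N \<in> carrier_mat k k" "A = frame y * N" "det N \<noteq> 0"
      by (rule col_space_eq_factor[OF Ac(1) frame_carrier Ac(2)]) (use y in \<open>auto simp: chart_def\<close>)
    \<comment> \<open>In the coordinates given by \<open>R\<close>, \<open>frame y\<close> has the
      identity on top, so the transition matrix is read off the top block of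
      \<open>A\<close>.\<close>
    have top: "chart_coord R l A c j = N $$ (c, j)" if cj: "c < k" "j < k" for c j
    proof -
      have "chart_coord R l A c j = (\<Sum>s<k. chart_coord R l (frame y) c s * N $$ (s, j))"
        unfolding N(2) by (rule chart_coord_mult[OF frame_carrier N(1) cj(2)])
      also have "\<dots> = (\<Sum>s<k. (if c = s then 1 else 0) * N $$ (s, j))"
        using cj by (intro sum.cong refl) (simp add: coord_frame chart_mat_top)
      finally show ?thesis using cj by (simp add: sum_delta_mult)
    qed
    have "A $$ (i, j) = ?T (y, A) i j" if ij: "i < l" "j < k" for i j
    proof -
      have "A $$ (i, j) = (\<Sum>c<k. frame y $$ (i, c) * N $$ (c, j))"
        unfolding N(2) using ij carrier_matD[OF P] carrier_matD[OF N(1)]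
        by (simp add: scalar_prod_def atLeast0LessThan del: index_map_mat(1))
      then show ?thesis using top ij by simp
    qed
    then have "(y, A) \<in> {p \<in> topspace ?Z. \<forall>i<l. \<forall>j<k. snd p $$ (i, j) = ?T p i j}"
      using y(1) Af by (simp add: topspace_frame_topology)
    then show "A \<in> snd ` {p \<in> topspace ?Z. \<forall>i<l. \<forall>j<k. snd p $$ (i, j) = ?T p i j}"
      by (rule image_eqI[rotated]) simp
  next
    fix A assume "A \<in> snd ` {p \<in> topspace ?Z. \<forall>i<l. \<forall>j<k. snd p $$ (i, j) = ?T p i j}"
    then obtain y where y: "y \<in> Q" "A \<in> frames k l" "\<forall>i<l. \<forall>j<k. A $$ (i, j) = ?T (y, A) i j"
      by (auto simp: topspace_frame_topology)
    have Ac: "A \<in> carrier_mat l k" "vec_space.rank l A = k" using y(2) by (auto simp: frames_def)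
    define N where "N = mat k k (\<lambda>(c, j). chart_coord R l A c j)"
    have N: "N \<in> carrier_mat k k" by (simp add: N_def)
    have AN: "A = frame y * N"
    proof (rule eq_matI)
      fix i j assume "i < dim_row (frame y * N)" "j < dim_col (frame y * N)"
      then have ij: "i < l" "j < k" using carrier_matD[OF frame_carrier[of y]] carrier_matD[OF N] by simp_all
      have "(frame y * N) $$ (i, j) = (\<Sum>c<k. frame y $$ (i, c) * N $$ (c, j))"
        using ij carrier_matD[OF P] carrier_matD[OF N]
        by (simp add: scalar_prod_def atLeast0LessThan del: index_map_mat(1))
      also have "\<dots> = A $$ (i, j)" using y(3) ij by (simp add: N_def del: index_map_mat(1))
      finally show "A $$ (i, j) = (frame y * N) $$ (i, j)" by simp
    next
      show "dim_row A = dim_row (frame y * N)" "dim_col A = dim_col (frame y * N)"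
        using Ac(1) carrier_matD[OF frame_carrier[of y]] carrier_matD[OF N] by simp_all
    qed
    have "det N \<noteq> 0"
    proof
      assume "det N = 0"
      then obtain v where v: "v \<in> carrier_vec k" "v \<noteq> 0\<^sub>v k" "N *\<^sub>v v = 0\<^sub>v k"
        using det_0_iff_vec_prod_zero_field[OF N] by blast
      have "A *\<^sub>v v = frame y *\<^sub>v (N *\<^sub>v v)"
        by (subst AN) (rule assoc_mult_mat_vec[OF frame_carrier N v(1)])
      also have "\<dots> = 0\<^sub>v l" using v frame_carrier[of y] P by auto
      finally show False using v Ac vec_space.rank_eq_iff_injective[OF Ac(1)] by blast
    qed
    then have "vec_space.col_space l A = chart k m P y"
      unfolding chart_def by (subst AN) (rule col_space_mult_invertible[OF frame_carrier N])
    then show "A \<in> ?S" using y by (auto simp: topspace_frame_topology)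
  qed
  have closed_graph: "closedin ?Z {p \<in> topspace ?Z. \<forall>i<l. \<forall>j<k. snd p $$ (i, j) = ?T p i j}"
  proof -
    have "closedin ?Z (\<Inter>(insert (topspace ?Z) ((\<lambda>ij. ?C (fst ij) (snd ij)) ` ({..<l} \<times> {..<k}))))"
    proof (rule closedin_Inter)
      fix K assume "K \<in> insert (topspace ?Z) ((\<lambda>ij. ?C (fst ij) (snd ij)) ` ({..<l} \<times> {..<k}))"
      then consider "K = topspace ?Z" | ij where "ij \<in> {..<l} \<times> {..<k}" "K = ?C (fst ij) (snd ij)" by blast
      then show "closedin ?Z K"
      proof cases
        case 1
        show ?thesis unfolding 1 by (rule closedin_topspace)
      next
        case 2
        then have "fst ij < l" "snd ij < k" by auto
        then show ?thesis unfolding 2(2) by (rule closed)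
      qed
    qed simp
    moreover have "\<Inter>(insert (topspace ?Z) ((\<lambda>ij. ?C (fst ij) (snd ij)) ` ({..<l} \<times> {..<k}))) =
      {p \<in> topspace ?Z. \<forall>i<l. \<forall>j<k. snd p $$ (i, j) = ?T p i j}" by auto
    ultimately show ?thesis by simp
  qed
  \<comment> \<open>Projection along a compact factor is a closed map.\<close>
  have "closed_map ?Z X snd"
    by (rule closed_map_snd) (use Q in \<open>simp add: compact_space_subtopology\<close>)
  from this[unfolded closed_map_def, rule_format, OF closed_graph]
  have "closedin X ?S" unfolding image .
  moreover have sub: "chart k m P ` Q \<subseteq> topspace G"
    using continuous_chart Q(2) by (auto simp: continuous_map_def)
  ultimately have "closedin G (chart k m P ` Q)"
    using quotient_map_grassmannian[of k l] unfolding quotient_map_closedin by blast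
  then have "closedin GR (chart k m P ` Q \<inter> real_grassmannian k l)"
    unfolding real_grassmannian_topology_def closedin_subtopology by blast
  moreover have "chart k m P ` Q \<subseteq> real_grassmannian k l" using chart_real by auto
  ultimately show ?thesis by (simp add: inf.absorb1)
qed

text \<open>The image of the chart is open, so interiors may be computed in Euclidean space. The
  image of \<open>Q\<close> is closed in the Grassmannian, so its frontier is the image of
  \<open>Q\<close> without its interior, and no limit points appear outside the chart.\<close>

theorem chart_ball:
  assumes Q: "dilation_body (k * m) c Q"
  shows "subtopology GR (chart k m P ` Q) homeomorphic_space closed_unit_ball (k * m)"
    and "subtopology GR (GR interior_of chart k m P ` Q) homeomorphic_space open_unit_ball (k * m)"
    and "subtopology GR (GR frontier_of chart k m P ` Q) homeomorphic_space unit_sphere (k * m)"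
proof -
  interpret Q: dilation_body "k * m" c Q by fact
  let ?E = "top_of_set E" and ?\<psi> = "chart k m P" and ?S = "chart k m P ` E"
  let ?I = "?E interior_of Q"
  have "\<exists>h h'. homeomorphic_maps ?E ?E h h' \<and> (\<forall>x\<in>E. x \<in> Q \<longleftrightarrow> (\<Sum>i<k * m. (h x i)\<^sup>2) \<le> 1)
      \<and> (\<forall>x\<in>E. x \<in> ?I \<longleftrightarrow> (\<Sum>i<k * m. (h x i)\<^sup>2) < 1)"
    by (rule dilation_body_homeomorphism[OF Q, unfolded Euclidean_space_eq]) blast
  then obtain h h' where hE: "homeomorphic_maps ?E ?E h h'"
    and hQ: "\<And>x. x \<in> E \<Longrightarrow> x \<in> Q \<longleftrightarrow> (\<Sum>i<k * m. (h x i)\<^sup>2) \<le> 1"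
    and hI: "\<And>x. x \<in> E \<Longrightarrow> x \<in> ?I \<longleftrightarrow> (\<Sum>i<k * m. (h x i)\<^sup>2) < 1"
    by (elim exE conjE) blast
  have "homeomorphic_map ?E ?E h" using hE homeomorphic_maps_map by blast
  from homeomorphic_imp_surjective_map[OF this] have h_onto: "h ` E = E" by simp
  have restrict: "subtopology GR (?\<psi> ` T) homeomorphic_space subtopology (Euclidean_space (k * m)) B"
    if T: "T \<subseteq> E" "\<And>x. x \<in> E \<Longrightarrow> x \<in> T \<longleftrightarrow> h x \<in> B" for T B
  proof -
    have "?S \<subseteq> topspace GR" using open_chart_image openin_subset by blast
    then have "homeomorphic_maps (subtopology ?E T) (subtopology (subtopology GR ?S) (?\<psi> ` T)) ?\<psi> unchart"
      by (intro homeomorphic_maps_subtopologies[OF chart_homeomorphism]) (use T(1) in auto)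
    then have 1: "subtopology ?E T homeomorphic_space subtopology (subtopology GR ?S) (?\<psi> ` T)"
      using homeomorphic_maps_imp_homeomorphic_space by blast
    have "h ` (E \<inter> T) = E \<inter> B"
    proof (intro equalityI subsetI)
      fix x assume "x \<in> h ` (E \<inter> T)"
      then show "x \<in> E \<inter> B" using T(2) h_onto by blast
    next
      fix x assume x: "x \<in> E \<inter> B"
      then have "x \<in> h ` E" using h_onto by simp
      then obtain x' where "x' \<in> E" "x = h x'" by blast
      then show "x \<in> h ` (E \<inter> T)" using T(2) x by blast
    qed
    then have "homeomorphic_maps (subtopology ?E T) (subtopology ?E B) h h'"
      by (intro homeomorphic_maps_subtopologies[OF hE]) simp
    then have 2: "subtopology ?E T homeomorphic_space subtopology ?E B"
      using homeomorphic_maps_imp_homeomorphic_space by blast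
    have "subtopology (subtopology GR ?S) (?\<psi> ` T) = subtopology GR (?\<psi> ` T)"
      using T(1) by (simp add: subtopology_subtopology inf.absorb2 image_mono)
    with 1 have "subtopology ?E T homeomorphic_space subtopology GR (?\<psi> ` T)" by simp
    from homeomorphic_space_trans[OF iffD1[OF homeomorphic_space_sym this] 2] show ?thesis unfolding Euclidean_space_eq .
  qed
  have int: "GR interior_of ?\<psi> ` Q = ?\<psi> ` ?I"
  proof -
    have "homeomorphic_map ?E (subtopology GR ?S) ?\<psi>" using chart_homeomorphism homeomorphic_maps_map by blast
    then have "subtopology GR ?S interior_of (?\<psi> ` Q) = ?\<psi> ` ?I"
      by (rule homeomorphic_map_interior_of) (use Q.sub in auto)
    then have "?S \<inter> GR interior_of (?\<psi> ` Q) = ?\<psi> ` ?I"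
      unfolding interior_of_subtopology_open[OF open_chart_image] .
    moreover have "GR interior_of (?\<psi> ` Q) \<subseteq> ?S"
      by (rule subset_trans[OF interior_of_subset image_mono[OF Q.sub]])
    ultimately show ?thesis by (simp add: inf.absorb2)
  qed
  have front: "GR frontier_of ?\<psi> ` Q = ?\<psi> ` (Q - ?I)"
  proof -
    have "GR closure_of (?\<psi> ` Q) = ?\<psi> ` Q"
      using closed_chart_image[OF Q.comp Q.sub] by (simp add: closure_of_closedin)
    moreover have "inj_on ?\<psi> E" by (metis inj_on_inverseI unchart_chart)
    then have "?\<psi> ` (Q - ?I) = ?\<psi> ` Q - ?\<psi> ` ?I"
      using Q.sub subset_trans[OF interior_of_subset Q.sub, of ?E] by (intro inj_on_image_set_diff[where C = E]) blast+
    ultimately show ?thesis unfolding frontier_of_def int by simp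
  qed
  show "subtopology GR (?\<psi> ` Q) homeomorphic_space closed_unit_ball (k * m)"
    unfolding closed_unit_ball_def by (rule restrict) (use Q.sub hQ in auto)
  show "subtopology GR (GR interior_of ?\<psi> ` Q) homeomorphic_space open_unit_ball (k * m)"
    unfolding open_unit_ball_def int by (rule restrict) (use Q.IQ_sub Q.sub hI in auto)
  show "subtopology GR (GR frontier_of ?\<psi> ` Q) homeomorphic_space unit_sphere (k * m)"
    unfolding unit_sphere_def front by (rule restrict) (use Q.sub hQ hI in \<open>auto simp: le_less\<close>)
qed

end

section \<open>The amplituhedron in an eigenbasis chart\<close>

lemma image_col_space:
  fixes A B :: "'a::field mat"
  assumes A: "A \<in> carrier_mat n k" and B: "B \<in> carrier_mat l n"
  shows "(\<lambda>v. B *\<^sub>v v) ` vec_space.col_space n A = vec_space.col_space l (B * A)"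
  unfolding col_space_conv[OF A] col_space_conv[OF mult_carrier_mat[OF B A]] image_image
  by (intro image_cong refl) (simp add: assoc_mult_mat_vec[OF B A])

lemma minor_mult:
  fixes A :: "'a::comm_ring_1 mat"
  assumes A: "A \<in> carrier_mat n k" and N: "N \<in> carrier_mat k k" and I: "I \<in> ksets n k"
  shows "minor k (\<lambda>i j. (A * N) $$ (i, j)) I = minor k (\<lambda>i j. A $$ (i, j)) I * det N"
proof -
  have "minor k (\<lambda>i j. (A * N) $$ (i, j)) I = det (mat k k (\<lambda>(r, c). \<Sum>j<k. A $$ (pick I r, j) * N $$ (j, c)))"
    unfolding minor_def using A N ksetsD(4)[OF I]
    by (intro det_mat_cong) (simp add: scalar_prod_def atLeast0LessThan)
  then show ?thesis unfolding minor_def by (simp only: det_rows_mult[OF N])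
qed

text \<open>If all maximal minors vanished, the Gram matrix would be singular by Cauchy-Binet, and a
  vector in its kernel would be mapped by \<open>A\<close> to a vector of length 0.\<close>

lemma real_rank_minor:
  fixes A :: "real mat"
  assumes A: "A \<in> carrier_mat n k" and rank: "vec_space.rank n A = k"
  shows "\<exists>I\<in>ksets n k. minor k (\<lambda>i j. A $$ (i, j)) I \<noteq> 0"
proof (rule ccontr)
  assume "\<not> ?thesis"
  then have "det (mat k k (\<lambda>(i, j). \<Sum>l<n. A $$ (l, i) * A $$ (l, j))) = 0"
    unfolding cauchy_binet[where f = "\<lambda>l i. A $$ (l, i)" and g = "\<lambda>l j. A $$ (l, j)"] by simp
  moreover have "mat k k (\<lambda>(i, j). \<Sum>l<n. A $$ (l, i) * A $$ (l, j)) = transpose_mat A * A"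
    using A by (intro eq_matI) (auto simp: scalar_prod_def atLeast0LessThan)
  ultimately have "det (transpose_mat A * A) = 0" by simp
  moreover have AA: "transpose_mat A * A \<in> carrier_mat k k" using A by simp
  ultimately obtain v where v: "v \<in> carrier_vec k" "v \<noteq> 0\<^sub>v k" "(transpose_mat A * A) *\<^sub>v v = 0\<^sub>v k"
    using det_0_iff_vec_prod_zero_field by blast
  have Av: "A *\<^sub>v v \<in> carrier_vec n" using A v by simp
  have "(A *\<^sub>v v) \<bullet> (A *\<^sub>v v) = (transpose_mat A *\<^sub>v (A *\<^sub>v v)) \<bullet> v"
    using transpose_vec_mult_scalar[OF A v(1) Av] by simp
  also have "transpose_mat A *\<^sub>v (A *\<^sub>v v) = 0\<^sub>v k"
    using v A by (simp add: assoc_mult_mat_vec[of "transpose_mat A" k n A k v])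
  finally have "(A *\<^sub>v v) \<bullet> (A *\<^sub>v v) = 0" using v by simp
  moreover have "u \<bullet> u = (\<Sum>i<n. u $ i * u $ i)" if "u \<in> carrier_vec n" for u :: "real vec"
    using that by (simp add: scalar_prod_def atLeast0LessThan)
  ultimately have "(\<Sum>i<n. (A *\<^sub>v v) $ i * (A *\<^sub>v v) $ i) = 0" using Av by metis
  then have "(A *\<^sub>v v) $ i = 0" if "i < n" for i
    using that by (subst (asm) sum_nonneg_eq_0_iff) auto
  then have "A *\<^sub>v v = 0\<^sub>v n" using carrier_matD[OF A] by (intro eq_vecI) auto
  then show False using v rank vec_space.rank_eq_iff_injective[OF A] by blast
qed

locale amplituhedron_eigenbasis =
  fixes n k m :: nat and Z :: "real mat" and a b \<mu> :: "nat \<Rightarrow> real" and U :: "nat \<Rightarrow> nat \<Rightarrow> real"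
  assumes kmn: "k + m \<le> n" and Z: "Z \<in> carrier_mat (k + m) n"
    and Zpos: "\<And>J. J \<in> ksets n (k + m) \<Longrightarrow> minor (k + m) (\<lambda>i r. Z $$ (r, i)) J > 0"
    and a: "\<And>i. a i > 0"
    and mono: "\<And>i j. i < j \<Longrightarrow> j < n \<Longrightarrow> \<mu> i > \<mu> j"
    and cols: "\<And>i j. i < n \<Longrightarrow> j < n \<Longrightarrow> (\<Sum>r<n. U r i * U r j) = (if i = j then 1 else 0)"
    and rows: "\<And>i j. i < n \<Longrightarrow> j < n \<Longrightarrow> (\<Sum>r<n. U i r * U j r) = (if i = j then 1 else 0)"
    and eig: "\<And>i c. i < n \<Longrightarrow> c < n \<Longrightarrow> (\<Sum>j<n. jacobi a b i j * U j c) = \<mu> c * U i c"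
    and Upos: "\<And>I. I \<in> ksets n k \<Longrightarrow> minor k U I > 0"
    and stable: "kernel_stable n (k + m) (\<lambda>r i. Z $$ (r, i)) a b"
begin

text \<open>Coordinates with respect to all \<open>n\<close> eigenvectors, flattened as in
  \<open>chart_mat\<close>; the rows from \<open>k + m\<close> on belong to eigenvectors that
  \<open>Z\<close> kills.\<close>

definition graph_mat :: "(nat \<Rightarrow> real) \<Rightarrow> nat \<Rightarrow> nat \<Rightarrow> real" where
  "graph_mat x q j = (if q < k then if q = j then 1 else 0 else x ((q - k) * k + j))"

definition point :: "(nat \<Rightarrow> real) \<Rightarrow> nat \<Rightarrow> nat \<Rightarrow> real" where
  "point x i j = (\<Sum>q<n. U i q * graph_mat x q j)"

lemma project_point:
  assumes "q < n" shows "(\<Sum>i<n. U i q * point x i j) = graph_mat x q j"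
proof -
  have "(\<Sum>i<n. U i q * point x i j) = (\<Sum>p<n. (\<Sum>i<n. U i q * U i p) * graph_mat x p j)"
    unfolding point_def sum_distrib_left sum_distrib_right by (subst sum.swap) (simp add: mult_ac)
  also have "\<dots> = (\<Sum>p<n. (if q = p then 1 else 0) * graph_mat x p j)"
    using assms by (intro sum.cong refl) (simp add: cols)
  finally show ?thesis using assms by (simp add: sum_delta_mult)
qed

text \<open>Cauchy-Binet for the identity block on top. With the positive weights
  \<open>minor k U I\<close> it bounds nonnegative minors and forbids them all to vanish.\<close>

lemma sum_minor_point: "(\<Sum>I\<in>ksets n k. minor k U I * minor k (point x) I) = 1"
proof -
  have "det (mat k k (\<lambda>(i, j). \<Sum>l<n. U l i * point x l j)) = det (mat k k (\<lambda>(i, j). if i = j then 1 else 0))"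
    using kmn by (intro det_mat_cong) (simp add: project_point graph_mat_def)
  then show ?thesis unfolding cauchy_binet det_mat_delta .
qed

definition nonneg_graphs :: "(nat \<Rightarrow> real) set" where
  "nonneg_graphs = {x \<in> fin_supp (k * (n - k)). \<forall>I\<in>ksets n k. minor k (point x) I \<ge> 0}"

lemma continuous_minor_point:
  assumes "\<And>t. continuous_on S (\<lambda>y. f y t)"
  shows "continuous_on S (\<lambda>y. minor k (point (f y)) I)"
proof -
  have "continuous_on S (\<lambda>y. graph_mat (f y) q j)" for q j
    unfolding graph_mat_def using assms by (cases "q < k") auto
  then have "continuous_on S (\<lambda>y. point (f y) i j)" for i j
    unfolding point_def by (intro continuous_intros) auto
  then have "continuous_map (top_of_set S) euclidean (\<lambda>y. minor k (point (f y)) I)"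
    unfolding minor_def by (intro continuous_map_det) simp
  then show ?thesis by simp
qed

text \<open>Cramer's rule in Cauchy-Binet form: eigenvector \<open>j\<close> is replaced by
  eigenvector \<open>k + s\<close>. The coordinates are linear in the minors and therefore bounded
  with them.\<close>

lemma coordinate_as_minors:
  assumes s: "s < n - k" and j: "j < k"
  shows "x (s * k + j) = (\<Sum>I\<in>ksets n k. minor k (\<lambda>i r. U i (if r = j then k + s else r)) I * minor k (point x) I)"
proof -
  have "det (mat k k (\<lambda>(r, c). \<Sum>l<n. U l (if r = j then k + s else r) * point x l c)) =
    det (mat k k (\<lambda>(r, c). if r = j then x (s * k + c) else if r = c then 1 else 0))"
    using s kmn by (intro det_mat_cong) (simp add: project_point graph_mat_def)
  also have "\<dots> = x (s * k + j)" by (rule det_replace_unit_row[OF j])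
  finally show ?thesis unfolding cauchy_binet[where f = "\<lambda>l r. U l (if r = j then k + s else r)" and g = "point x"] by simp
qed

lemma compact_nonneg_graphs: "compact nonneg_graphs"
proof -
  \<comment> \<open>The largest value that the normalization of the weighted sum to 1 leaves for the
    minor at \<open>I\<close>.\<close>
  define u where "u I = 1 / minor k U I" for I
  define B where "B t = (\<Sum>I\<in>ksets n k. \<bar>minor k (\<lambda>i r. U i (if r = t mod k then k + t div k else r)) I\<bar> * u I)" for t
  have bound: "\<bar>x t\<bar> \<le> B t" if x: "x \<in> nonneg_graphs" for x t
  proof (cases "t < k * (n - k)")
    case True
    then have k: "k > 0" by (cases k) auto
    have s: "t div k < n - k" using True by (simp add: less_mult_imp_div_less mult.commute)
    have minor_le: "\<bar>minor k (point x) I\<bar> \<le> u I" if I: "I \<in> ksets n k" for I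
    proof -
      have nn: "minor k (point x) J \<ge> 0" if "J \<in> ksets n k" for J using x that by (simp add: nonneg_graphs_def)
      have "minor k U I * minor k (point x) I \<le> (\<Sum>I\<in>ksets n k. minor k U I * minor k (point x) I)"
        by (rule member_le_sum[OF I _ finite_ksets]) (simp add: nn less_imp_le[OF Upos])
      then have "minor k (point x) I * minor k U I \<le> 1" unfolding sum_minor_point by (simp add: mult.commute)
      then show ?thesis using Upos[OF I] nn[OF I] by (simp add: u_def pos_le_divide_eq)
    qed
    have "x t = x (t div k * k + t mod k)" by simp
    also have "\<dots> = (\<Sum>I\<in>ksets n k. minor k (\<lambda>i r. U i (if r = t mod k then k + t div k else r)) I * minor k (point x) I)"
      by (rule coordinate_as_minors[OF s]) (use k in simp)
    also have "\<bar>\<dots>\<bar> \<le> B t"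
    proof -
      have "\<bar>c I * minor k (point x) I\<bar> \<le> \<bar>c I\<bar> * u I" if "I \<in> ksets n k" for I c
        unfolding abs_mult using minor_le[OF that] by (rule mult_left_mono) simp
      then show ?thesis unfolding B_def by (intro order_trans[OF sum_abs] sum_mono)
    qed
    finally show ?thesis .
  next
    case False
    then have "x t = 0" using x by (simp add: nonneg_graphs_def fin_supp_def)
    moreover have "B t \<ge> 0" unfolding B_def u_def
      by (intro sum_nonneg mult_nonneg_nonneg) (auto intro!: less_imp_le[OF Upos])
    ultimately show ?thesis by simp
  qed
  have "nonneg_graphs = (fin_supp (k * (n - k)) \<inter> (\<Inter>I\<in>ksets n k. {x. 0 \<le> minor k (point x) I})) \<inter> {x. \<forall>t. x t \<in> {- B t..B t}}"
  proof (intro equalityI subsetI)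
    fix x assume x: "x \<in> nonneg_graphs"
    have "x t \<in> {- B t..B t}" for t using bound[OF x, of t] by (simp add: abs_le_iff)
    then show "x \<in> (fin_supp (k * (n - k)) \<inter> (\<Inter>I\<in>ksets n k. {x. 0 \<le> minor k (point x) I})) \<inter> {x. \<forall>t. x t \<in> {- B t..B t}}"
      using x by (simp add: nonneg_graphs_def)
  qed (simp add: nonneg_graphs_def)
  moreover have "closed {x. 0 \<le> minor k (point x) I}" for I
    by (intro closed_Collect_le continuous_on_const continuous_minor_point continuous_on_apply)
  then have "closed (fin_supp (k * (n - k)) \<inter> (\<Inter>I\<in>ksets n k. {x. 0 \<le> minor k (point x) I}))"
    by (intro closed_Int closed_fin_supp closed_INT) auto
  ultimately show ?thesis
    using closed_Int_compact[OF _ compact_box_fun[of "\<lambda>t. {- B t..B t}"]] by simp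
qed

text \<open>Index \<open>t\<close> stands for the entry in row \<open>k + t div k\<close> and column
  \<open>t mod k\<close>. The rate is the gap between the two eigenvalues, positive because the
  column index is smaller than the row index.\<close>

definition rate :: "nat \<Rightarrow> real" where
  "rate t = \<mu> (t mod k) - \<mu> (k + t div k)"

lemma rate_pos:
  assumes "t < k * (n - k)" shows "rate t > 0"
proof -
  have k: "k > 0" using assms by (cases k) auto
  have "t div k < n - k" using assms by (simp add: less_mult_imp_div_less mult.commute)
  moreover have "t mod k < k" using k by simp
  ultimately show ?thesis unfolding rate_def using mono[of "t mod k" "k + t div k"] by simp
qed

text \<open>The dilation by \<open>s\<close> is the flow at time \<open>- ln s\<close>, read in the
  chart: the flow scales row \<open>q\<close> of the graph by \<open>exp (t * \<mu> q)\<close>, and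
  renormalizing the identity block divides column \<open>j\<close> by
  \<open>exp (t * \<mu> j)\<close>.\<close>

lemma flow_point:
  assumes x: "x \<in> nonneg_graphs" and s: "0 < s" "s < 1" and I: "I \<in> ksets n k"
  shows "minor k (point (dil rate s x)) I > 0"
proof -
  define t where "t = - ln s"
  have t: "t > 0" using s by (simp add: t_def)
  have sp: "s powr c = exp (- t * c)" for c using s by (simp add: t_def powr_def mult.commute)
  define F where "F t i j = (\<Sum>q<n. U i q * (exp (t * \<mu> q) * graph_mat x q j))" for t i j
  have F0: "F 0 = point x" by (simp add: F_def point_def fun_eq_iff)
  have "\<exists>I0\<in>ksets n k. minor k (point x) I0 > 0"
  proof (rule ccontr)
    assume *: "\<not> ?thesis"
    have "minor k (point x) J = 0" if J: "J \<in> ksets n k" for J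
    proof -
      have "minor k (point x) J \<ge> 0" using x J by (simp add: nonneg_graphs_def)
      moreover have "\<not> minor k (point x) J > 0" using * J by blast
      ultimately show ?thesis by linarith
    qed
    then show False using sum_minor_point[of x] by simp
  qed
  then obtain I0 where I0: "I0 \<in> ksets n k" "minor k (point x) I0 > 0" by blast
  have "minor k (F t) I > 0"
  proof (rule minor_flow_pos[where F = F and n = n and ?I0.0 = I0 and a = a and b = b])
    show "((\<lambda>t. F t i j) has_real_derivative (\<Sum>l<n. jacobi a b i l * F t l j)) (at t)" if "i < n" for i j t
      unfolding F_def by (rule flow_deriv[OF eig that])
    show "minor k (F 0) J \<ge> 0" if "J \<in> ksets n k" for J
      unfolding F0 using x that by (simp add: nonneg_graphs_def)
  qed (use a I0 I t in \<open>simp_all add: F0\<close>)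
  moreover have "minor k (F t) I = (\<Prod>j<k. exp (t * \<mu> j)) * minor k (point (dil rate s x)) I"
  proof -
    \<comment> \<open>The column factors are pulled out here; their product is positive and does not
      affect the sign of the minor.\<close>
    have graph_mat: "exp (t * \<mu> q) * graph_mat x q j = exp (t * \<mu> j) * graph_mat (dil rate s x) q j" if j: "j < k" for q j
    proof (cases "q < k")
      case False
      then have "((q - k) * k + j) div k = q - k" "((q - k) * k + j) mod k = j" using j by auto
      then have "dil rate s x ((q - k) * k + j) = exp (- t * (\<mu> j - \<mu> q)) * x ((q - k) * k + j)"
        using False unfolding dil_def rate_def sp by simp
      then show ?thesis using False by (simp add: graph_mat_def algebra_simps flip: exp_add mult.assoc)
    qed (auto simp: graph_mat_def)
    have "F t i j = exp (t * \<mu> j) * point (dil rate s x) i j" if "j < k" for i j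
      unfolding F_def point_def sum_distrib_left graph_mat[OF that] by (simp add: mult_ac)
    then have "minor k (F t) I = det (mat k k (\<lambda>(i, j). exp (t * \<mu> j) * point (dil rate s x) (pick I i) j))"
      unfolding minor_def by (intro det_mat_cong) simp
    then show ?thesis unfolding minor_def by (simp only: det_mat_col_scale)
  qed
  moreover have "(\<Prod>j<k. exp (t * \<mu> j)) > 0" by (simp add: prod_pos)
  ultimately show ?thesis by (simp add: zero_less_mult_iff)
qed

text \<open>The effect of \<open>Z\<close> in eigen-coordinates: the entries for the eigenvectors in
  its kernel form a tail of the flattened vector and are dropped.\<close>

definition trunc :: "(nat \<Rightarrow> real) \<Rightarrow> nat \<Rightarrow> real" where
  "trunc x = (\<lambda>t. if t < k * m then x t else 0)"

lemma continuous_trunc: "continuous_on S trunc"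
proof (rule continuous_on_fun)
  fix t show "continuous_on S (\<lambda>x. trunc x t)"
    unfolding trunc_def by (cases "t < k * m") (auto intro: continuous_on_apply)
qed

lemma km_le: "k * m \<le> k * (n - k)"
  using kmn by (intro mult_left_mono) auto

text \<open>A dilated graph has strictly positive minors, and these stay positive when its first
  \<open>k * m\<close> coordinates are moved a little. So its truncation is an interior point of the
  projected set.\<close>

lemma body: "dilation_body (k * m) rate (trunc ` nonneg_graphs)"
proof
  show "rate i > 0" if "i < k * m" for i using rate_pos[of i] that km_le by linarith
  show "compact (trunc ` nonneg_graphs)" by (rule compact_continuous_image[OF continuous_trunc compact_nonneg_graphs])
  show "trunc ` nonneg_graphs \<subseteq> fin_supp (k * m)" by (auto simp: trunc_def fin_supp_def)
  have "point (\<lambda>_. 0) i j = U i j" if "j < k" for i j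
  proof -
    have "point (\<lambda>_. 0) i j = (\<Sum>q<n. (if j = q then 1 else 0) * U i q)"
      unfolding point_def graph_mat_def using that by (intro sum.cong) auto
    then show ?thesis using that kmn by (simp add: sum_delta_mult)
  qed
  then have "minor k (point (\<lambda>_. 0)) I = minor k U I" for I
    unfolding minor_def by (intro det_mat_cong)
  then have "(\<lambda>_. 0) \<in> nonneg_graphs" using Upos by (auto simp: nonneg_graphs_def fin_supp_def intro: less_imp_le)
  then show "trunc ` nonneg_graphs \<noteq> {}" by blast
  fix s :: real and y assume s: "0 < s" "s < 1" and y: "y \<in> trunc ` nonneg_graphs"
  then obtain x where x: "x \<in> nonneg_graphs" "y = trunc x" by blast
  define x' where "x' = dil rate s x"
  have y': "dil rate s y = trunc x'" unfolding x'_def x(2) by (simp add: dil_def trunc_def fun_eq_iff)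
  \<comment> \<open>A section of \<open>trunc\<close> near the dilated point: the tail of
    \<open>x'\<close> is kept while the first \<open>k * m\<close> coordinates vary.\<close>
  define e where "e y' = (\<lambda>t. if t < k * m then y' t else x' t)" for y'
  define O' where "O' = (\<Inter>I\<in>ksets n k. {y'. 0 < minor k (point (e y')) I})"
  have "continuous_on UNIV (\<lambda>y'. e y' t)" for t
    unfolding e_def by (cases "t < k * m") (auto intro: continuous_on_apply)
  then have "open {y'. 0 < minor k (point (e y')) I}" for I
    by (intro open_Collect_less continuous_on_const continuous_minor_point)
  then have "open O'" unfolding O'_def by (intro open_INT) auto
  then have "openin (top_of_set (fin_supp (k * m))) (fin_supp (k * m) \<inter> O')" by (rule openin_open_Int)
  moreover have "fin_supp (k * m) \<inter> O' \<subseteq> trunc ` nonneg_graphs"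
  proof
    fix y' assume y': "y' \<in> fin_supp (k * m) \<inter> O'"
    have "x' \<in> fin_supp (k * (n - k))" using x dil_fin_supp by (simp add: x'_def nonneg_graphs_def)
    then have "e y' t = 0" if "t \<ge> k * (n - k)" for t
      using that y' order_trans[OF km_le that] by (simp add: e_def fin_supp_def)
    then have "e y' \<in> fin_supp (k * (n - k))" by (simp add: fin_supp_def)
    then have "e y' \<in> nonneg_graphs" using y' by (auto simp: nonneg_graphs_def O'_def intro: less_imp_le)
    moreover have "trunc (e y') = y'" using y' by (auto simp: trunc_def e_def fin_supp_def fun_eq_iff)
    ultimately show "y' \<in> trunc ` nonneg_graphs" by (metis image_eqI)
  qed
  moreover have "trunc x' \<in> fin_supp (k * m) \<inter> O'"
  proof -
    have "e (trunc x') = x'" by (auto simp: e_def trunc_def)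
    then show ?thesis using flow_point[OF x(1) s] by (auto simp: O'_def x'_def trunc_def fin_supp_def)
  qed
  ultimately show "dil rate s y \<in> top_of_set (fin_supp (k * m)) interior_of trunc ` nonneg_graphs"
    unfolding y' interior_of_def by blast
qed

section \<open>The amplituhedron as the chart image of the contracted body\<close>

definition P :: "real mat" where
  "P = mat (k + m) (k + m) (\<lambda>(r, c). \<Sum>i<n. Z $$ (r, i) * U i c)"

lemma P_carrier: "P \<in> carrier_mat (k + m) (k + m)"
  by (simp add: P_def)

lemma det_P: "det P \<noteq> 0"
  unfolding P_def by (rule stable_kernel_top_eigenspace(1)[OF a mono cols rows eig kmn Zpos stable])

lemma Z_eq: "r < k + m \<Longrightarrow> i < n \<Longrightarrow> Z $$ (r, i) = (\<Sum>c<k + m. P $$ (r, c) * U i c)"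
  using stable_kernel_top_eigenspace(3)[OF a mono cols rows eig kmn Zpos stable, of r i]
  by (simp add: P_def)

text \<open>\<open>Z\<close> is \<open>P\<close> times the transpose of the first
  \<open>k + m\<close> eigenvectors, so it picks out the first \<open>k + m\<close> rows of the
  graph and applies \<open>P\<close>.\<close>

lemma Z_point:
  assumes A: "A \<in> carrier_mat n k" and x: "\<And>i j. i < n \<Longrightarrow> j < k \<Longrightarrow> A $$ (i, j) = point x i j"
  shows "Z * A = P * chart_mat k m (trunc x)"
proof (rule eq_matI)
  fix r j assume "r < dim_row (P * chart_mat k m (trunc x))" "j < dim_col (P * chart_mat k m (trunc x))"
  then have rj: "r < k + m" "j < k" using P_carrier by auto
  have "(Z * A) $$ (r, j) = (\<Sum>i<n. Z $$ (r, i) * A $$ (i, j))"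
    using rj Z A by (simp add: scalar_prod_def atLeast0LessThan)
  also have "\<dots> = (\<Sum>i<n. (\<Sum>c<k + m. P $$ (r, c) * U i c) * point x i j)"
    using rj by (intro sum.cong refl) (simp add: Z_eq x)
  also have "\<dots> = (\<Sum>c<k + m. P $$ (r, c) * (\<Sum>i<n. U i c * point x i j))"
    unfolding sum_distrib_left sum_distrib_right by (subst sum.swap) (simp only: mult.assoc)
  also have "\<dots> = (\<Sum>c<k + m. P $$ (r, c) * chart_mat k m (trunc x) $$ (c, j))"
  proof (rule sum.cong[OF refl])
    fix c assume c: "c \<in> {..<k + m}"
    have "(c - k) * k + j < k * m" if "\<not> c < k"
    proof -
      have "Suc (c - k) \<le> m" using c that by auto
      then have "Suc (c - k) * k \<le> m * k" by (rule mult_right_mono) simp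
      then show ?thesis using rj by (simp add: mult.commute)
    qed
    then have "graph_mat x c j = chart_mat k m (trunc x) $$ (c, j)"
      using c rj by (auto simp: graph_mat_def chart_mat_def trunc_def)
    then show "P $$ (r, c) * (\<Sum>i<n. U i c * point x i j) = P $$ (r, c) * chart_mat k m (trunc x) $$ (c, j)"
      using c kmn by (simp add: project_point)
  qed
  also have "\<dots> = (P * chart_mat k m (trunc x)) $$ (r, j)"
    using rj carrier_matD[OF P_carrier] by (simp add: scalar_prod_def atLeast0LessThan)
  finally show "(Z * A) $$ (r, j) = (P * chart_mat k m (trunc x)) $$ (r, j)" .
qed (use Z A P_carrier in auto)

lemma image_Z:
  assumes A: "A \<in> carrier_mat n k"
  shows "(\<lambda>v. complex_mat Z *\<^sub>v v) ` vec_space.col_space n (complex_mat A) =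
    vec_space.col_space (k + m) (complex_mat (Z * A))"
  using image_col_space[of "complex_mat A" n k "complex_mat Z" "k + m"] A Z
  by (simp add: of_real_hom.mat_hom_mult[OF Z A])

text \<open>Every totally nonnegative subspace is a graph over the first \<open>k\<close>
  eigenvectors: the determinant of its coordinates there pairs positive minors with nonnegative
  ones, not all zero. Being positive, that determinant can be normalized away without changing the
  sign of any minor.\<close>

lemma amplituhedron_eq: "amplituhedron n k Z = chart k m P ` trunc ` nonneg_graphs"
proof (intro equalityI subsetI)
  fix V assume "V \<in> amplituhedron n k Z"
  then obtain A where A: "A \<in> carrier_mat n k" "vec_space.rank n A = k"
    and nonneg: "\<And>I. I \<in> ksets n k \<Longrightarrow> det (submatrix A I {..<k}) \<ge> 0"
    and V: "V = (\<lambda>v. complex_mat Z *\<^sub>v v) ` vec_space.col_space n (complex_mat A)"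
    unfolding amplituhedron_def nonneg_grassmannian_def by auto
  have Anonneg: "minor k (\<lambda>i j. A $$ (i, j)) I \<ge> 0" if "I \<in> ksets n k" for I
    using nonneg[OF that] det_submatrix_rows[OF A(1) that] by simp
  obtain I0 where I0: "I0 \<in> ksets n k" "minor k (\<lambda>i j. A $$ (i, j)) I0 \<noteq> 0"
    using real_rank_minor[OF A] by blast
  \<comment> \<open>The coordinates of the columns of \<open>A\<close> along the first
    \<open>k\<close> eigenvectors; \<open>N'\<close> makes this block the identity.\<close>
  define N where "N = mat k k (\<lambda>(r, c). \<Sum>i<n. U i r * A $$ (i, c))"
  have N: "N \<in> carrier_mat k k" by (simp add: N_def)
  have "det N = (\<Sum>I\<in>ksets n k. minor k U I * minor k (\<lambda>i j. A $$ (i, j)) I)"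
    unfolding N_def by (rule cauchy_binet)
  also have "\<dots> > 0"
  proof (rule sum_pos2[OF finite_ksets I0(1)])
    show "minor k U I0 * minor k (\<lambda>i j. A $$ (i, j)) I0 > 0"
      using Upos[OF I0(1)] Anonneg[OF I0(1)] I0(2) by simp
  qed (use Upos Anonneg less_imp_le in \<open>blast intro: mult_nonneg_nonneg\<close>)
  finally have detN: "det N > 0" .
  then obtain N' where N': "N' \<in> carrier_mat k k" "N * N' = 1\<^sub>m k"
    using mat_inverse_obtain[OF N] by force
  have "det N * det N' = 1" using det_mult[OF N N'(1)] N'(2) by simp
  then have "det N * det N' > 0" by simp
  then have detN': "det N' > 0" using detN by (rule zero_less_mult_pos)
  define B where "B = A * N'"
  have B: "B \<in> carrier_mat n k" using A N' by (simp add: B_def)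
  have UB: "(\<Sum>i<n. U i q * B $$ (i, j)) = (\<Sum>c<k. (\<Sum>i<n. U i q * A $$ (i, c)) * N' $$ (c, j))"
    if j: "j < k" for q j
  proof -
    have "(\<Sum>i<n. U i q * B $$ (i, j)) = (\<Sum>i<n. U i q * (\<Sum>c<k. A $$ (i, c) * N' $$ (c, j)))"
      unfolding B_def using A N' j by (intro sum.cong refl) (simp add: scalar_prod_def atLeast0LessThan)
    also have "\<dots> = (\<Sum>c<k. (\<Sum>i<n. U i q * A $$ (i, c)) * N' $$ (c, j))"
      unfolding sum_distrib_left sum_distrib_right by (subst sum.swap) (simp only: mult.assoc)
    finally show ?thesis .
  qed
  have low: "(\<Sum>i<n. U i q * B $$ (i, j)) = (if q = j then 1 else 0)" if qj: "q < k" "j < k" for q j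
  proof -
    have "(N * N') $$ (q, j) = (\<Sum>c<k. (\<Sum>i<n. U i q * A $$ (i, c)) * N' $$ (c, j))"
      using qj N'(1) by (simp add: N_def scalar_prod_def atLeast0LessThan)
    then show ?thesis unfolding UB[OF qj(2)] N'(2) using qj by simp
  qed
  \<comment> \<open>The coordinates of the normalized frame \<open>B\<close> along the remaining
    eigenvectors, flattened as in \<open>graph_mat\<close>.\<close>
  define x where "x t = (if t < k * (n - k) then \<Sum>i<n. U i (k + t div k) * B $$ (i, t mod k) else 0)" for t
  have Wx: "graph_mat x q j = (\<Sum>i<n. U i q * B $$ (i, j))" if q: "q < n" and j: "j < k" for q j
  proof (cases "q < k")
    case False
    have "Suc (q - k) \<le> n - k" using False q by auto
    then have "Suc (q - k) * k \<le> (n - k) * k" by (rule mult_right_mono) simp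
    then have "(q - k) * k + j < k * (n - k)" using j by (simp add: mult.commute)
    moreover have "((q - k) * k + j) div k = q - k" "((q - k) * k + j) mod k = j" using j by auto
    ultimately show ?thesis using False by (simp add: graph_mat_def x_def)
  qed (use low j in \<open>simp add: graph_mat_def\<close>)
  have Bx: "B $$ (i, j) = point x i j" if i: "i < n" and j: "j < k" for i j
  proof -
    have "point x i j = (\<Sum>q<n. U i q * (\<Sum>p<n. U p q * B $$ (p, j)))"
      unfolding point_def using Wx j by (intro sum.cong refl) simp
    also have "\<dots> = (\<Sum>p<n. (\<Sum>q<n. U i q * U p q) * B $$ (p, j))"
      unfolding sum_distrib_left sum_distrib_right by (subst sum.swap) (simp only: mult.assoc)
    also have "\<dots> = (\<Sum>p<n. (if i = p then 1 else 0) * B $$ (p, j))"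
      using i by (intro sum.cong refl) (simp add: rows)
    finally show ?thesis using i by (simp add: sum_delta_mult)
  qed
  have "x \<in> nonneg_graphs"
  proof -
    have "minor k (point x) I \<ge> 0" if I: "I \<in> ksets n k" for I
    proof -
      have "minor k (point x) I = minor k (\<lambda>i j. B $$ (i, j)) I"
        by (rule minor_cong) (use Bx I in auto)
      also have "\<dots> = minor k (\<lambda>i j. A $$ (i, j)) I * det N'"
        unfolding B_def by (rule minor_mult[OF A(1) N'(1) I])
      finally show ?thesis using Anonneg[OF I] detN' by simp
    qed
    then show ?thesis by (simp add: nonneg_graphs_def fin_supp_def x_def)
  qed
  moreover have "V = chart k m P (trunc x)"
  proof -
    have Ac: "complex_mat (Z * A) \<in> carrier_mat (k + m) k" using Z A by simp
    have "P * chart_mat k m (trunc x) = Z * A * N'"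
    proof -
      have "Z * B = P * chart_mat k m (trunc x)" by (rule Z_point[OF B]) (rule Bx)
      then show ?thesis unfolding B_def using assoc_mult_mat[OF Z A(1) N'(1)] by simp
    qed
    then have "complex_mat (P * chart_mat k m (trunc x)) = complex_mat (Z * A) * complex_mat N'"
      by (simp only: of_real_hom.mat_hom_mult[OF mult_carrier_mat[OF Z A(1)] N'(1)])
    then have "chart k m P (trunc x) = vec_space.col_space (k + m) (complex_mat (Z * A) * complex_mat N')"
      unfolding chart_def by simp
    also have "\<dots> = vec_space.col_space (k + m) (complex_mat (Z * A))"
      by (rule col_space_mult_invertible[OF Ac]) (use N' detN' in \<open>auto simp: of_real_hom.hom_det\<close>)
    finally show ?thesis unfolding V image_Z[OF A(1)] by simp
  qed
  ultimately show "V \<in> chart k m P ` trunc ` nonneg_graphs" by blast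
next
  fix V assume "V \<in> chart k m P ` trunc ` nonneg_graphs"
  then obtain x where x: "x \<in> nonneg_graphs" "V = chart k m P (trunc x)" by blast
  define A where "A = mat n k (\<lambda>(i, j). point x i j)"
  have A: "A \<in> carrier_mat n k" by (simp add: A_def)
  have Ax: "A $$ (i, j) = point x i j" if "i < n" "j < k" for i j using that by (simp add: A_def)
  let ?L = "mat k n (\<lambda>(q, i). U i q)"
  have "?L * A = 1\<^sub>m k"
  proof (rule eq_matI)
    fix q j assume "q < dim_row (1\<^sub>m k :: real mat)" "j < dim_col (1\<^sub>m k :: real mat)"
    then have qj: "q < k" "j < k" by auto
    have "(?L * A) $$ (q, j) = (\<Sum>i<n. U i q * point x i j)"
      using qj by (simp add: A_def scalar_prod_def atLeast0LessThan)
    then show "(?L * A) $$ (q, j) = (1\<^sub>m k) $$ (q, j)" using qj kmn by (simp add: project_point graph_mat_def)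
  qed (use A in auto)
  then have "vec_space.rank n A = k" by (intro rank_left_inverse[OF A]) auto
  moreover have "det (submatrix A I {..<k}) \<ge> 0" if "I \<in> ksets n k" for I
  proof -
    have "det (submatrix A I {..<k}) = minor k (\<lambda>i j. A $$ (i, j)) I" by (rule det_submatrix_rows[OF A that])
    also have "\<dots> = minor k (point x) I" by (rule minor_cong) (use Ax that in auto)
    finally show ?thesis using x that by (simp add: nonneg_graphs_def)
  qed
  ultimately have "vec_space.col_space n (complex_mat A) \<in> nonneg_grassmannian k n"
    unfolding nonneg_grassmannian_def using A by auto
  moreover have "Z * A = P * chart_mat k m (trunc x)" by (rule Z_point[OF A]) (rule Ax)
  then have "V = (\<lambda>v. complex_mat Z *\<^sub>v v) ` vec_space.col_space n (complex_mat A)"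
    unfolding image_Z[OF A] x(2) chart_def by simp
  ultimately show "V \<in> amplituhedron n k Z" unfolding amplituhedron_def by blast
qed

theorem amplituhedron_ball:
  shows "subtopology (real_grassmannian_topology k (k + m)) (amplituhedron n k Z)
        homeomorphic_space closed_unit_ball (k * m)"
    and "subtopology (real_grassmannian_topology k (k + m))
        (real_grassmannian_topology k (k + m) interior_of amplituhedron n k Z)
        homeomorphic_space open_unit_ball (k * m)"
    and "subtopology (real_grassmannian_topology k (k + m))
        (real_grassmannian_topology k (k + m) frontier_of amplituhedron n k Z)
        homeomorphic_space unit_sphere (k * m)"
proof -
  obtain R where R: "R \<in> carrier_mat (k + m) (k + m)" "P * R = 1\<^sub>m (k + m)" "R * P = 1\<^sub>m (k + m)"
    using mat_inverse_obtain[OF P_carrier det_P] by blast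
  interpret C: grassmannian_chart k m P R
    by unfold_locales (use P_carrier R in auto)
  show "subtopology (real_grassmannian_topology k (k + m)) (amplituhedron n k Z)
        homeomorphic_space closed_unit_ball (k * m)"
    unfolding amplituhedron_eq by (rule C.chart_ball(1)[OF body])
  show "subtopology (real_grassmannian_topology k (k + m))
        (real_grassmannian_topology k (k + m) interior_of amplituhedron n k Z)
        homeomorphic_space open_unit_ball (k * m)"
    unfolding amplituhedron_eq by (rule C.chart_ball(2)[OF body])
  show "subtopology (real_grassmannian_topology k (k + m))
        (real_grassmannian_topology k (k + m) frontier_of amplituhedron n k Z)
        homeomorphic_space unit_sphere (k * m)"
    unfolding amplituhedron_eq by (rule C.chart_ball(3)[OF body])
qed

end

text \<open>The common sign of the minors is absorbed by the first eigenvector, which belongs to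
  every left-justified minor unless \<open>k = 0\<close>; in that case the only minor is 1.\<close>

lemma positive_eigenbasis:
  assumes a: "\<And>i. a i > 0" and k: "k \<le> n"
  shows "\<exists>\<mu> U. (\<forall>i j. i < j \<longrightarrow> j < n \<longrightarrow> \<mu> i > \<mu> j) \<and>
     (\<forall>i<n. \<forall>j<n. (\<Sum>r<n. U r i * U r j) = (if i = j then 1 else 0)) \<and>
     (\<forall>i<n. \<forall>j<n. (\<Sum>r<n. U i r * U j r) = (if i = j then 1 else 0)) \<and>
     (\<forall>i<n. \<forall>c<n. (\<Sum>j<n. jacobi a b i j * U j c) = \<mu> c * U i c) \<and>
     (\<forall>I\<in>ksets n k. minor k U I > (0::real))"
proof -
  obtain \<mu> U where "jacobi_eigensystem n a b \<mu> U"
    using exists_jacobi_eigensystem[of a n b] a by blast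
  note mono = jacobi_eigensystemD(1)[OF this] and cols = jacobi_eigensystemD(2)[OF this]
    and rows = jacobi_eigensystemD(3)[OF this] and eig = jacobi_eigensystemD(4)[OF this]
  have "\<exists>\<epsilon>::real. (\<epsilon> = 1 \<or> \<epsilon> = - 1) \<and> (\<forall>I\<in>ksets n k. \<epsilon> * minor k U I > 0)"
    by (rule perron_minors[of a n \<mu> U b k]) (use a mono cols rows eig k in auto)
  then obtain \<epsilon> :: real where eps: "\<epsilon> = 1 \<or> \<epsilon> = - 1" "\<And>I. I \<in> ksets n k \<Longrightarrow> \<epsilon> * minor k U I > 0"
    by blast
  define s where "s c = (if c = (0::nat) then \<epsilon> else 1)" for c
  define U' where "U' i c = s c * U i c" for i c
  have ss: "s c * s c = 1" for c using eps(1) by (auto simp: s_def)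
  have "(\<Sum>r<n. U' r i * U' r j) = (if i = j then 1 else 0)" if ij: "i < n" "j < n" for i j
  proof -
    have "(\<Sum>r<n. U' r i * U' r j) = s i * s j * (\<Sum>r<n. U r i * U r j)"
      by (simp add: U'_def sum_distrib_left mult_ac)
    then show ?thesis using cols[OF ij] ss by simp
  qed
  moreover have "(\<Sum>r<n. U' i r * U' j r) = (if i = j then 1 else 0)" if ij: "i < n" "j < n" for i j
  proof -
    have "U' i r * U' j r = (s r * s r) * (U i r * U j r)" for r by (simp add: U'_def mult_ac)
    then show ?thesis using rows[OF ij] ss by simp
  qed
  moreover have "(\<Sum>j<n. jacobi a b i j * U' j c) = \<mu> c * U' i c" if ic: "i < n" "c < n" for i c
  proof -
    have "(\<Sum>j<n. jacobi a b i j * U' j c) = s c * (\<Sum>j<n. jacobi a b i j * U j c)"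
      by (simp add: U'_def sum_distrib_left mult_ac)
    then show ?thesis using eig[OF ic] by (simp add: U'_def)
  qed
  moreover have "minor k U' I > 0" if I: "I \<in> ksets n k" for I
  proof (cases k)
    case 0
    then show ?thesis by (simp add: minor_def det_dim_zero[OF mat_carrier])
  next
    case (Suc k')
    have "minor k U' I = (\<Prod>c<k. s c) * minor k U I"
      unfolding minor_def U'_def by (rule det_mat_col_scale)
    also have "(\<Prod>c<k. s c) = \<epsilon>"
      unfolding Suc prod.lessThan_Suc_shift by (simp add: s_def)
    finally show ?thesis using eps(2)[OF I] by simp
  qed
  ultimately show ?thesis using mono by (intro exI[of _ \<mu>] exI[of _ U']) simp
qed

theorem corollary7p22:
  fixes n k m :: nat and Z :: "real mat"
  assumes "n \<ge> 1" and "k + m \<le> n"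
    and "Z \<in> carrier_mat (k + m) n"
    and "\<And>J. J \<subseteq> {..<n} \<Longrightarrow> card J = k + m \<Longrightarrow> det (submatrix Z {..<k + m} J) > 0"
    and "k + m \<le> 2 \<or> n - k - m \<le> 2"
  shows "twisted_vandermonde n k m Z
    \<and> subtopology (real_grassmannian_topology k (k + m)) (amplituhedron n k Z)
        homeomorphic_space closed_unit_ball (k * m)
    \<and> subtopology (real_grassmannian_topology k (k + m))
        (real_grassmannian_topology k (k + m) interior_of amplituhedron n k Z)
        homeomorphic_space open_unit_ball (k * m)
    \<and> subtopology (real_grassmannian_topology k (k + m))
        (real_grassmannian_topology k (k + m) frontier_of amplituhedron n k Z)
        homeomorphic_space unit_sphere (k * m)"
proof -
  have pos: "minor (k + m) (\<lambda>i r. Z $$ (r, i)) J > 0" if "J \<in> ksets n (k + m)" for J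
    using assms(4)[of J] det_submatrix_cols[OF assms(3) that] that by simp
  have small: "k + m \<le> 2 \<or> n - (k + m) \<le> 2" using assms(5) by simp
  have "\<exists>a b. (\<forall>i. a i > 0) \<and> kernel_stable n (k + m) (\<lambda>r i. Z $$ (r, i)) a b"
    by (rule kernel_stable_jacobi[where z = "\<lambda>r i. Z $$ (r, i)", OF _ assms(2) small]) (use pos in blast)+
  then obtain a b where a: "\<And>i. a i > 0" and stable: "kernel_stable n (k + m) (\<lambda>r i. Z $$ (r, i)) a b"
    by blast
  have "twisted_vandermonde n k m Z"
    by (rule twisted_vandermonde_of_stable[OF assms(3,2) pos a stable])
  \<comment> \<open>The same Jacobi matrix is used with other signs of the eigenvectors: the
    Vandermonde flag needs a positive first row, while the chart needs positive minors of size
    \<open>k\<close>.\<close>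
  moreover have "k \<le> n" using assms(2) by simp
  from positive_eigenbasis[where a = a and b = b, OF a this] obtain \<mu> U where basis:
    "(\<forall>i j. i < j \<longrightarrow> j < n \<longrightarrow> \<mu> i > \<mu> j) \<and>
     (\<forall>i<n. \<forall>j<n. (\<Sum>r<n. U r i * U r j) = (if i = j then 1 else 0)) \<and>
     (\<forall>i<n. \<forall>j<n. (\<Sum>r<n. U i r * U j r) = (if i = j then 1 else 0)) \<and>
     (\<forall>i<n. \<forall>c<n. (\<Sum>j<n. jacobi a b i j * U j c) = \<mu> c * U i c) \<and>
     (\<forall>I\<in>ksets n k. minor k U I > (0::real))"
    by (elim exE)
  note mono = conjunct1[OF basis] and basis = conjunct2[OF basis]
  note cols = conjunct1[OF basis] and basis = conjunct2[OF basis]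
  note rows = conjunct1[OF basis] and basis = conjunct2[OF basis]
  note eig = conjunct1[OF basis] and Upos = conjunct2[OF basis]
  interpret amplituhedron_eigenbasis n k m Z a b \<mu> U
    by unfold_locales (fact assms(2) assms(3) pos a stable mono[rule_format] cols[rule_format]
      rows[rule_format] eig[rule_format] Upos[rule_format])+
  note amplituhedron_ball
  ultimately show ?thesis by blast
qed

end
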